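(* Let $r>0$ be fixed. For the Repeated Balls-into-Bins process with $L$ sites and $rL$ particles, the mixing time $t_{\mathrm{mix}}(\epsilon)$ is of order $L$: there are positive constants $c,c'$ depending only on $r$ such that for every $\epsilon\in(0,1/2)$ and every $L\in\mathbb{N}$ with $rL\in\mathbb{N}$ and $L\ge c/\epsilon$, $$\frac{rL}{2}\leq t_{\mathrm{mix}}(\epsilon)\leq c'L.$$ Moreover, for fixed $\epsilon\in(0,1/2)$, if $\eta=\eta^{(L)}$ are configurations with $L$ sites and $rL$ particles such that $\Vert\eta^{(L)}\Vert_\infty=o(L)$ as $L\to\infty$ (along $L$ with $rL\in\mathbb{N}$), then $t_{\mathrm{mix}}(\eta^{(L)},\epsilon)=o(L)$.
   Context: $\mathbb{N}=\{1,2,\dots\}$, $\mathbb{Z}_+=\mathbb{N}\cup\{0\}$, $[L]=\{1,\dots,L\}$, and $\Vert\eta\Vert_\infty=\max_{x\in[L]}\eta_x$ for $\eta\in\mathbb{Z}_+^L$. $\Vert\mu-\nu\Vert$ denotes the total variation distance between probability measures. Repeated Balls-into-Bins (RBB) process with $L$ sites: let $U_y(t)$, $y\in[L]$, $t\in\mathbb{N}$, be i.i.d. random variables uniformly distributed on $[L]$. The discrete-time Markov chain $(\eta(t))_{t\in\mathbb{Z}_+}$ with values in $\mathbb{Z}_+^L$ is defined from an initial state $\eta(0)=\eta$ by $$\eta_x(t+1)=\eta_x(t)-\mathbf{1}_{\{\eta_x(t)>0\}}+\sum_{y=1}^L\mathbf{1}_{\{\eta_y(t)>0\}}\mathbf{1}_{\{U_y(t+1)=x\}},\qquad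 x\in[L].$$ The total number of particles is conserved. On the configurations with exactly $rL$ particles the chain is a finite irreducible (ergodic) Markov chain, and $\nu$ denotes its unique invariant probability measure. $\mathbb{P}_\eta$ is the law of the process started at $\eta(0)=\eta$. For $\eta$ with $rL$ particles, $t_{\mathrm{mix}}(\eta,\epsilon):=\inf\{t\geq0\colon \Vert \mathbb{P}_\eta(\eta(t)\in\cdot)-\nu\Vert<\epsilon\}$ (with $t\in\mathbb{Z}_+$), and $t_{\mathrm{mix}}(\epsilon):=\sup_{\eta} t_{\mathrm{mix}}(\eta,\epsilon)$, the supremum being over all $\eta\in\mathbb{Z}_+^L$ with $\sum_x\eta_x=rL$. *)

theory Defs
  imports "HOL-Probability.Probability"
begin

text \<open>
  A configuration in $\mathbb{Z}_+^L$ is a function \<open>nat \<Rightarrow> nat\<close> vanishing outside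
  \<open>{1..L}\<close>. The particle number is prescribed through the density \<open>r\<close>: the set is
  empty unless \<open>r * L\<close> is a natural number.
\<close>

definition configs :: "real \<Rightarrow> nat \<Rightarrow> (nat \<Rightarrow> nat) set" where
  "configs r L = {\<eta>. (\<forall>x. x \<notin> {1..L} \<longrightarrow> \<eta> x = 0) \<and> real (\<Sum>x\<in>{1..L}. \<eta> x) = r * real L}"

definition config_norm :: "nat \<Rightarrow> (nat \<Rightarrow> nat) \<Rightarrow> nat" where
  "config_norm L \<eta> = Max (\<eta> ` {1..L})"

definition rbb_update :: "nat \<Rightarrow> (nat \<Rightarrow> nat) \<Rightarrow> (nat \<Rightarrow> nat) \<Rightarrow> nat \<Rightarrow> nat" where
  "rbb_update L u \<eta> x =
     (if x \<in> {1..L}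
      then \<eta> x - of_bool (\<eta> x > 0)
           + (\<Sum>y\<in>{1..L}. of_bool (\<eta> y > 0) * of_bool (u y = x))
      else 0)"

definition rbb_step :: "nat \<Rightarrow> (nat \<Rightarrow> nat) \<Rightarrow> (nat \<Rightarrow> nat) pmf" where
  "rbb_step L \<eta> =
     map_pmf (\<lambda>u. rbb_update L u \<eta>) (Pi_pmf {1..L} 0 (\<lambda>_. pmf_of_set {1..L}))"

primrec rbb_law :: "nat \<Rightarrow> (nat \<Rightarrow> nat) \<Rightarrow> nat \<Rightarrow> (nat \<Rightarrow> nat) pmf" where
  "rbb_law L \<eta> 0 = return_pmf \<eta>"
| "rbb_law L \<eta> (Suc t) = bind_pmf (rbb_law L \<eta> t) (rbb_step L)"

definition rbb_invariant :: "real \<Rightarrow> nat \<Rightarrow> (nat \<Rightarrow> nat) pmf \<Rightarrow> bool" where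
  "rbb_invariant r L \<nu> \<longleftrightarrow> set_pmf \<nu> \<subseteq> configs r L \<and> bind_pmf \<nu> (rbb_step L) = \<nu>"

definition rbb_stationary :: "real \<Rightarrow> nat \<Rightarrow> (nat \<Rightarrow> nat) pmf" where
  "rbb_stationary r L = (THE \<nu>. rbb_invariant r L \<nu>)"

definition tv_dist :: "'a pmf \<Rightarrow> 'a pmf \<Rightarrow> real" where
  "tv_dist \<mu> \<nu> = (SUP A. \<bar>measure_pmf.prob \<mu> A - measure_pmf.prob \<nu> A\<bar>)"

text \<open>
  Mixing times are \<open>enat\<close>-valued, so that the infimum of the empty set is \<open>\<infinity>\<close>
  (on \<open>nat\<close> it would be \<open>0\<close>).
\<close>

definition mixing_time_from :: "real \<Rightarrow> nat \<Rightarrow> (nat \<Rightarrow> nat) \<Rightarrow> real \<Rightarrow> enat" where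
  "mixing_time_from r L \<eta> \<epsilon> =
     Inf {enat t | t. tv_dist (rbb_law L \<eta> t) (rbb_stationary r L) < \<epsilon>}"

definition mixing_time :: "real \<Rightarrow> nat \<Rightarrow> real \<Rightarrow> enat" where
  "mixing_time r L \<epsilon> = (SUP \<eta>\<in>configs r L. mixing_time_from r L \<eta> \<epsilon>)"

definition admissible_sizes :: "real \<Rightarrow> nat set" where
  "admissible_sizes r = {L. L \<ge> 1 \<and> r * real L \<in> \<nat>}"

text \<open>The limit \<open>L \<rightarrow> \<infinity>\<close> along admissible sizes; trivial filter if there are none.\<close>

definition sizes_at_top :: "real \<Rightarrow> nat filter" where
  "sizes_at_top r = inf sequentially (principal (admissible_sizes r))"

end

theory Submission
  imports Defs
begin

text \<open>
  The upper bounds rest on a path coupling with exponential weights. Two configurations that differ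
  in the position of one particle are written as \<open>put a \<zeta>\<close> and \<open>put b \<zeta>\<close>. The extra particles at
  \<open>a\<close> and \<open>b\<close> are second class particles: they wait while first class particles occupy their
  site and jump to a uniform site otherwise. When both can jump at the same time they use the
  same target and the two copies coincide from then on (\<open>coupling_bound\<close>). The influence of the
  initial configuration is thus bounded by the probability that the two particles are still
  apart.

  A site receives on average less than one particle per step, by a margin equal to the fraction of
  empty sites. From every configuration of density at most \<open>r\<close> the mean
  fraction of empty sites is bounded below after \<open>T\<close> steps, where \<open>2 * r \<le> T\<close> (\<open>mean_empty\<close>).
  Hence exponential moments of the loads contract over blocks of \<open>Suc T\<close> steps (\<open>block_drift\<close>),
  and so does a Lyapunov function built from the loads seen by the second class particles and
  the mean exponential weight of a site (\<open>lyapunov_block\<close>). While this function is bounded, the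
  particles meet within a bounded number of steps with a probability that is bounded
  below uniformly in \<open>L\<close> (\<open>can_meet_any\<close>): many sites are occupied, so single arrivals can be used to
  equalize the two loads, after which both particles become free at the same time. Both facts
  together give a contraction (\<open>pair_contraction\<close>), and summing along a path of configurations gives
  convergence to the invariant law with an error of order \<open>L\<^sup>2 * \<alpha> ^ n\<close> times
  \<open>exp (\<theta> * config_norm L \<eta>)\<close> after \<open>M * n\<close> steps (\<open>exponential_convergence\<close>). The time needed is
  therefore of the order of the maximal load, up to logarithmic terms, which yields \<open>O(L)\<close> in general and
  \<open>o(L)\<close> for initial configurations of maximal load \<open>o(L)\<close>.

  For the lower bound, a site with all \<open>r * L\<close> particles keeps more than half of them as long as fewer
  than \<open>r * L / 2\<close> steps have passed, whereas at a suitable site such a load has stationary probability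
  at most \<open>1 / L\<close>
  (\<open>mixing_time_ge\<close>).
\<close>

section \<open>Averages over random targets\<close>

definition choices :: "nat \<Rightarrow> (nat \<Rightarrow> nat) set" where
  "choices L = PiE_dflt {1..L} 0 (\<lambda>_. {1..L})"

definition avg :: "nat \<Rightarrow> ((nat \<Rightarrow> nat) \<Rightarrow> real) \<Rightarrow> real" where
  "avg L f = (\<Sum>u\<in>choices L. f u) / real (card (choices L))"

lemma choices_iff: "u \<in> choices L \<longleftrightarrow> (\<forall>y\<in>{1..L}. u y \<in> {1..L}) \<and> (\<forall>y. y \<notin> {1..L} \<longrightarrow> u y = 0)"
  unfolding choices_def PiE_dflt_def by blast

lemma choices_site: "u \<in> choices L \<Longrightarrow> y \<in> {1..L} \<Longrightarrow> u y \<in> {1..L}"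
  unfolding choices_iff by blast

lemma finite_choices [simp]: "finite (choices L)"
  unfolding choices_def by auto

lemma choices_nonempty [simp]: "choices L \<noteq> {}"
  unfolding choices_def by auto

lemma card_choices_pos [simp]: "real (card (choices L)) > 0"
  by (simp add: card_gt_0_iff)

lemma avg_const [simp]: "avg L (\<lambda>_. c) = c"
  unfolding avg_def using card_choices_pos[of L] by (simp del: card_choices_pos)

lemma avg_add: "avg L (\<lambda>u. f u + g u) = avg L f + avg L g"
  unfolding avg_def by (simp add: sum.distrib add_divide_distrib)

lemma avg_diff: "avg L (\<lambda>u. f u - g u) = avg L f - avg L g"
  unfolding avg_def by (simp add: sum_subtractf diff_divide_distrib)

lemma avg_cmult: "avg L (\<lambda>u. c * f u) = c * avg L f"
  unfolding avg_def by (simp add: sum_distrib_left)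

lemma avg_sum: "avg L (\<lambda>u. \<Sum>i\<in>A. f i u) = (\<Sum>i\<in>A. avg L (f i))"
  unfolding avg_def by (subst sum.swap) (simp add: sum_divide_distrib)

lemma avg_mono: "(\<And>u. u \<in> choices L \<Longrightarrow> f u \<le> g u) \<Longrightarrow> avg L f \<le> avg L g"
  unfolding avg_def by (intro divide_right_mono sum_mono) auto

lemma avg_cong: "(\<And>u. u \<in> choices L \<Longrightarrow> f u = g u) \<Longrightarrow> avg L f = avg L g"
  unfolding avg_def by simp

lemma targets_eq: "L \<ge> 1 \<Longrightarrow> Pi_pmf {1..L} 0 (\<lambda>_. pmf_of_set {1..L}) = pmf_of_set (choices L)"
  unfolding choices_def by (rule Pi_pmf_of_set) auto

lemma expectation_targets:
  assumes "L \<ge> 1"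
  shows "measure_pmf.expectation (Pi_pmf {1..L} 0 (\<lambda>_. pmf_of_set {1..L})) f = avg L f"
  unfolding targets_eq[OF assms] by (subst integral_pmf_of_set) (auto simp: avg_def)

lemma avg_prod:
  fixes f :: "nat \<Rightarrow> nat \<Rightarrow> real"
  assumes "L \<ge> 1" and "\<And>y x. y \<in> {1..L} \<Longrightarrow> x \<in> {1..L} \<Longrightarrow> f y x \<ge> 0"
  shows "avg L (\<lambda>u. \<Prod>y\<in>{1..L}. f y (u y)) = (\<Prod>y\<in>{1..L}. (\<Sum>x\<in>{1..L}. f y x) / real L)"
proof -
  have "avg L (\<lambda>u. \<Prod>y\<in>{1..L}. f y (u y)) =
        measure_pmf.expectation (Pi_pmf {1..L} 0 (\<lambda>_. pmf_of_set {1..L})) (\<lambda>u. \<Prod>y\<in>{1..L}. f y (u y))"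
    by (rule expectation_targets[OF assms(1), symmetric])
  also have "\<dots> = (\<Prod>y\<in>{1..L}. measure_pmf.expectation (pmf_of_set {1..L}) (f y))"
    using assms by (intro expectation_prod_Pi_pmf) (auto intro!: integrable_measure_pmf_finite)
  also have "\<dots> = (\<Prod>y\<in>{1..L}. (\<Sum>x\<in>{1..L}. f y x) / real L)"
    using assms(1) by (intro prod.cong refl, subst integral_pmf_of_set) auto
  finally show ?thesis .
qed

lemma avg_transpose:
  assumes "a \<in> {1..L}" "b \<in> {1..L}"
  shows "avg L (\<lambda>u. f (u \<circ> Transposition.transpose a b)) = avg L f"
proof -
  let ?t = "Transposition.transpose a b"
  have m: "?t y \<in> {1..L} \<longleftrightarrow> y \<in> {1..L}" for y
    using assms by (cases "y = a"; cases "y = b") auto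
  have cl: "u \<circ> ?t \<in> choices L" if "u \<in> choices L" for u
    using that m unfolding choices_iff by (simp del: atLeastAtMost_iff)
  have "bij_betw (\<lambda>u. u \<circ> ?t) (choices L) (choices L)"
    by (rule bij_betw_byWitness[where f' = "\<lambda>u. u \<circ> ?t"]) (auto simp: cl comp_assoc)
  then have "(\<Sum>u\<in>choices L. f (u \<circ> ?t)) = (\<Sum>u\<in>choices L. f u)"
    by (rule sum.reindex_bij_betw)
  then show ?thesis unfolding avg_def by simp
qed

section \<open>Transition operators of random maps\<close>

text \<open>
  For a Markov chain driven by \<open>s \<mapsto> \<phi> u s\<close> with uniform targets \<open>u\<close>, this is the
  transition operator acting on observables.
\<close>

definition trans_op ::
    "nat \<Rightarrow> ((nat \<Rightarrow> nat) \<Rightarrow> 's \<Rightarrow> 's) \<Rightarrow> ('s \<Rightarrow> real) \<Rightarrow> 's \<Rightarrow> real" where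
  "trans_op L \<phi> F s = avg L (\<lambda>u. F (\<phi> u s))"

lemma trans_op_pow_Suc:
  "(trans_op L \<phi> ^^ Suc n) F s = avg L (\<lambda>u. (trans_op L \<phi> ^^ n) F (\<phi> u s))"
  unfolding funpow.simps o_apply by (rule trans_op_def)

definition closed_under :: "nat \<Rightarrow> ((nat \<Rightarrow> nat) \<Rightarrow> 's \<Rightarrow> 's) \<Rightarrow> 's set \<Rightarrow> bool" where
  "closed_under L \<phi> S \<longleftrightarrow> (\<forall>u\<in>choices L. \<forall>s\<in>S. \<phi> u s \<in> S)"

lemma closed_underD: "closed_under L \<phi> S \<Longrightarrow> u \<in> choices L \<Longrightarrow> s \<in> S \<Longrightarrow> \<phi> u s \<in> S"
  unfolding closed_under_def by blast

lemma trans_op_mono: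
  assumes "closed_under L \<phi> S" "s \<in> S" "\<And>s. s \<in> S \<Longrightarrow> F s \<le> G s"
  shows "trans_op L \<phi> F s \<le> trans_op L \<phi> G s"
  unfolding trans_op_def using assms by (intro avg_mono) (auto dest: closed_underD)

lemma trans_op_pow_mono:
  assumes "closed_under L \<phi> S" "s \<in> S" "\<And>s. s \<in> S \<Longrightarrow> F s \<le> G s"
  shows "(trans_op L \<phi> ^^ n) F s \<le> (trans_op L \<phi> ^^ n) G s"
  using assms(2)
proof (induction n arbitrary: s)
  case 0
  then show ?case using assms(3) by simp
next
  case (Suc n)
  then show ?case by (auto intro: trans_op_mono[OF assms(1)])
qed

lemma trans_op_pow_cong:
  assumes "closed_under L \<phi> S" "s \<in> S" "\<And>s. s \<in> S \<Longrightarrow> F s = G s"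
  shows "(trans_op L \<phi> ^^ n) F s = (trans_op L \<phi> ^^ n) G s"
  by (intro antisym trans_op_pow_mono[OF assms(1,2)]) (simp_all add: assms(3))

lemma trans_op_const [simp]: "trans_op L \<phi> (\<lambda>_. c) = (\<lambda>_. c)"
  by (rule ext) (simp add: trans_op_def)

lemma trans_op_add: "trans_op L \<phi> (\<lambda>s. F s + G s) = (\<lambda>s. trans_op L \<phi> F s + trans_op L \<phi> G s)"
  by (rule ext) (simp add: trans_op_def avg_add)

lemma trans_op_diff: "trans_op L \<phi> (\<lambda>s. F s - G s) = (\<lambda>s. trans_op L \<phi> F s - trans_op L \<phi> G s)"
  by (rule ext) (simp add: trans_op_def avg_diff)

lemma trans_op_cmult: "trans_op L \<phi> (\<lambda>s. c * F s) = (\<lambda>s. c * trans_op L \<phi> F s)"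
  by (rule ext) (simp add: trans_op_def avg_cmult)

lemma trans_op_pow_const [simp]: "(trans_op L \<phi> ^^ n) (\<lambda>_. c) = (\<lambda>_. c)"
  by (induction n) auto

lemma trans_op_pow_add:
  "(trans_op L \<phi> ^^ n) (\<lambda>s. F s + G s) = (\<lambda>s. (trans_op L \<phi> ^^ n) F s + (trans_op L \<phi> ^^ n) G s)"
  by (induction n) (auto simp: trans_op_add)

lemma trans_op_pow_diff:
  "(trans_op L \<phi> ^^ n) (\<lambda>s. F s - G s) = (\<lambda>s. (trans_op L \<phi> ^^ n) F s - (trans_op L \<phi> ^^ n) G s)"
  by (induction n) (auto simp: trans_op_diff)

lemma trans_op_pow_cmult:
  "(trans_op L \<phi> ^^ n) (\<lambda>s. c * F s) = (\<lambda>s. c * (trans_op L \<phi> ^^ n) F s)"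
  by (induction n) (auto simp: trans_op_cmult)

lemma trans_op_pow_sum:
  "(trans_op L \<phi> ^^ n) (\<lambda>s. \<Sum>i\<in>A. F i s) s = (\<Sum>i\<in>A. (trans_op L \<phi> ^^ n) (F i) s)"
proof (induction n arbitrary: s)
  case (Suc n)
  have "(trans_op L \<phi> ^^ n) (\<lambda>s. \<Sum>i\<in>A. F i s) = (\<lambda>s. \<Sum>i\<in>A. (trans_op L \<phi> ^^ n) (F i) s)"
    using Suc by blast
  then show ?case by (simp only: trans_op_pow_Suc avg_sum)
qed auto

lemma trans_op_pow_nonneg:
  assumes "closed_under L \<phi> S" "s \<in> S" "\<And>s. s \<in> S \<Longrightarrow> 0 \<le> F s"
  shows "0 \<le> (trans_op L \<phi> ^^ n) F s"
  using trans_op_pow_mono[OF assms(1,2), of "\<lambda>_. 0" F n] assms(3) by simp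

text \<open>
  If \<open>\<pi>\<close> maps each step in law to a step of a second chain, then it projects the first chain
  onto the second. The equality of averages leaves room for a permutation of the targets.
\<close>

lemma trans_op_pow_project:
  assumes cl: "closed_under L \<phi> S"
    and pr: "\<And>s F. s \<in> S \<Longrightarrow> avg L (\<lambda>u. F (\<pi> (\<phi> u s))) = avg L (\<lambda>u. F (\<psi> u (\<pi> s)))"
    and s: "s \<in> S"
  shows "(trans_op L \<phi> ^^ n) (\<lambda>s. F (\<pi> s)) s = (trans_op L \<psi> ^^ n) F (\<pi> s)"
  using s
proof (induction n arbitrary: s)
  case (Suc n)
  have "(trans_op L \<phi> ^^ Suc n) (\<lambda>s. F (\<pi> s)) s = avg L (\<lambda>u. (trans_op L \<phi> ^^ n) (\<lambda>s. F (\<pi> s)) (\<phi> u s))"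
    by (rule trans_op_pow_Suc)
  also have "\<dots> = avg L (\<lambda>u. (trans_op L \<psi> ^^ n) F (\<pi> (\<phi> u s)))"
    using Suc cl by (intro avg_cong) (auto dest: closed_underD)
  also have "\<dots> = avg L (\<lambda>u. (trans_op L \<psi> ^^ n) F (\<psi> u (\<pi> s)))"
    by (rule pr[OF Suc.prems])
  finally show ?case by (simp only: trans_op_pow_Suc)
qed auto

section \<open>Conservation and the pair of second class particles\<close>

definition confs :: "nat \<Rightarrow> nat \<Rightarrow> (nat \<Rightarrow> nat) set" where
  "confs L N = {\<zeta>. (\<forall>x. x \<notin> {1..L} \<longrightarrow> \<zeta> x = 0) \<and> (\<Sum>x\<in>{1..L}. \<zeta> x) = N}"

lemma configs_eq_confs: "real N = r * real L \<Longrightarrow> configs r L = confs L N"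
  unfolding configs_def confs_def by (metis of_nat_eq_iff)

lemma finite_confs [simp]: "finite (confs L N)"
proof (rule finite_subset)
  show "confs L N \<subseteq> PiE_dflt {1..L} 0 (\<lambda>_. {0..N})"
  proof
    fix \<zeta> assume z: "\<zeta> \<in> confs L N"
    have "\<zeta> x \<le> N" if "x \<in> {1..L}" for x
      using z that unfolding confs_def by (auto intro!: member_le_sum)
    then show "\<zeta> \<in> PiE_dflt {1..L} 0 (\<lambda>_. {0..N})"
      using z unfolding confs_def PiE_dflt_def by auto
  qed
qed auto

lemma closed_update: "closed_under L (rbb_update L) (confs L N)"
proof -
  have "rbb_update L u \<zeta> \<in> confs L N" if u: "u \<in> choices L" and z: "\<zeta> \<in> confs L N" for u \<zeta>
  proof -
    have "(\<Sum>x\<in>{1..L}. \<Sum>y\<in>{1..L}. of_bool (\<zeta> y > 0) * of_bool (u y = x) :: nat)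
        = (\<Sum>y\<in>{1..L}. \<Sum>x\<in>{1..L}. of_bool (\<zeta> y > 0) * of_bool (u y = x))"
      by (rule sum.swap)
    also have "\<dots> = (\<Sum>y\<in>{1..L}. of_bool (\<zeta> y > 0))"
    proof (rule sum.cong[OF refl])
      fix y assume "y \<in> {1..L}"
      then have "u y \<in> {1..L}" using u by (rule choices_site[rotated])
      then have "(\<Sum>x\<in>{1..L}. of_bool (u y = x) :: nat) = 1" by (simp add: of_bool_def)
      then show "(\<Sum>x\<in>{1..L}. of_bool (\<zeta> y > 0) * of_bool (u y = x) :: nat) = of_bool (\<zeta> y > 0)"
        by (simp only: sum_distrib_left[symmetric])
    qed
    finally have arr: "(\<Sum>x\<in>{1..L}. \<Sum>y\<in>{1..L}. of_bool (\<zeta> y > 0) * of_bool (u y = x) :: nat)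
        = (\<Sum>y\<in>{1..L}. of_bool (\<zeta> y > 0))" .
    have "(\<Sum>x\<in>{1..L}. rbb_update L u \<zeta> x)
        = (\<Sum>x\<in>{1..L}. \<zeta> x - of_bool (\<zeta> x > 0) + (\<Sum>y\<in>{1..L}. of_bool (\<zeta> y > 0) * of_bool (u y = x)))"
      by (rule sum.cong[OF refl]) (simp only: rbb_update_def if_True)
    also have "\<dots> = (\<Sum>x\<in>{1..L}. \<zeta> x - of_bool (\<zeta> x > 0)) + (\<Sum>y\<in>{1..L}. of_bool (\<zeta> y > 0))"
      by (simp only: sum.distrib arr)
    also have "\<dots> = (\<Sum>x\<in>{1..L}. \<zeta> x - of_bool (\<zeta> x > 0) + of_bool (\<zeta> x > 0))"
      by (simp only: sum.distrib)
    also have "\<dots> = (\<Sum>x\<in>{1..L}. \<zeta> x)"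
      by (rule sum.cong) auto
    finally have "(\<Sum>x\<in>{1..L}. rbb_update L u \<zeta> x) = (\<Sum>x\<in>{1..L}. \<zeta> x)" .
    then show ?thesis using z unfolding confs_def by (auto simp: rbb_update_def)
  qed
  then show ?thesis unfolding closed_under_def by blast
qed

definition put :: "nat \<Rightarrow> (nat \<Rightarrow> nat) \<Rightarrow> nat \<Rightarrow> nat" where
  "put a \<zeta> = \<zeta>(a := \<zeta> a + 1)"

type_synonym pairstate = "(nat \<Rightarrow> nat) \<times> nat \<times> nat"

text \<open>
  The configuration of first class particles evolves by itself; a second class particle
  moves only from a site that holds no first class particle. If both can move, they move
  to the same site; the choice of \<open>min a b\<close> keeps the roles of the two particles symmetric.
\<close>

definition move :: "nat \<Rightarrow> (nat \<Rightarrow> nat) \<Rightarrow> pairstate \<Rightarrow> pairstate" where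
  "move L u s = (case s of (\<zeta>, a, b) \<Rightarrow>
     (rbb_update L u \<zeta>,
      if \<zeta> a = 0 then u (if \<zeta> b = 0 then min a b else a) else a,
      if \<zeta> b = 0 then u (if \<zeta> a = 0 then min a b else b) else b))"

definition pairs :: "nat \<Rightarrow> nat \<Rightarrow> pairstate set" where
  "pairs L N = confs L N \<times> {1..L} \<times> {1..L}"

lemma closed_move: "closed_under L (move L) (pairs L N)"
proof -
  have "move L u s \<in> pairs L N" if u: "u \<in> choices L" and s: "s \<in> pairs L N" for u s
  proof -
    obtain \<zeta> a b where seq: "s = (\<zeta>, a, b)" by (cases s) auto
    have ab: "\<zeta> \<in> confs L N" "a \<in> {1..L}" "b \<in> {1..L}" using s unfolding seq pairs_def by auto
    have "min a b \<in> {1..L}" using ab by (simp add: min_def)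
    then show ?thesis
      using ab choices_site[OF u] closed_underD[OF closed_update u ab(1)]
      unfolding seq move_def pairs_def by (simp del: atLeastAtMost_iff)
  qed
  then show ?thesis unfolding closed_under_def by blast
qed

lemma update_put:
  assumes a: "a \<in> {1..L}" and u: "u \<in> choices L"
  shows "rbb_update L u (put a \<zeta>) = put (if \<zeta> a = 0 then u a else a) (rbb_update L u \<zeta>)"
proof
  fix x
  have ua: "u a \<in> {1..L}" using choices_site[OF u a] .
  have S: "(\<Sum>y\<in>{1..L}. of_bool (put a \<zeta> y > 0) * of_bool (u y = x) :: nat)
      = (\<Sum>y\<in>{1..L}. of_bool (\<zeta> y > 0) * of_bool (u y = x)) + of_bool (\<zeta> a = 0 \<and> u a = x)"
  proof -
    have "(\<Sum>y\<in>{1..L} - {a}. of_bool (put a \<zeta> y > 0) * of_bool (u y = x) :: nat)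
        = (\<Sum>y\<in>{1..L} - {a}. of_bool (\<zeta> y > 0) * of_bool (u y = x))"
      by (rule sum.cong) (auto simp: put_def)
    moreover have "(of_bool (put a \<zeta> a > 0) * of_bool (u a = x) :: nat)
        = of_bool (\<zeta> a > 0) * of_bool (u a = x) + of_bool (\<zeta> a = 0 \<and> u a = x)"
      by (simp add: put_def)
    moreover have "(\<Sum>y\<in>{1..L}. of_bool (put a \<zeta> y > 0) * of_bool (u y = x) :: nat)
        = of_bool (put a \<zeta> a > 0) * of_bool (u a = x)
          + (\<Sum>y\<in>{1..L} - {a}. of_bool (put a \<zeta> y > 0) * of_bool (u y = x))"
      by (rule sum.remove[OF finite_atLeastAtMost a])
    moreover have "(\<Sum>y\<in>{1..L}. of_bool (\<zeta> y > 0) * of_bool (u y = x) :: nat)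
        = of_bool (\<zeta> a > 0) * of_bool (u a = x)
          + (\<Sum>y\<in>{1..L} - {a}. of_bool (\<zeta> y > 0) * of_bool (u y = x))"
      by (rule sum.remove[OF finite_atLeastAtMost a])
    ultimately show ?thesis by linarith
  qed
  have arith: "put a \<zeta> x - of_bool (put a \<zeta> x > 0) + (S + of_bool (\<zeta> a = 0 \<and> u a = x))
      = \<zeta> x - of_bool (\<zeta> x > 0) + S + of_bool (x = (if \<zeta> a = 0 then u a else a))" for S
    by (auto simp: put_def of_bool_def)
  show "rbb_update L u (put a \<zeta>) x = put (if \<zeta> a = 0 then u a else a) (rbb_update L u \<zeta>) x"
  proof (cases "x \<in> {1..L}")
    case True
    have "rbb_update L u (put a \<zeta>) x = put a \<zeta> x - of_bool (put a \<zeta> x > 0)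
        + ((\<Sum>y\<in>{1..L}. of_bool (\<zeta> y > 0) * of_bool (u y = x)) + of_bool (\<zeta> a = 0 \<and> u a = x))"
      using True unfolding rbb_update_def S by (simp only: if_True)
    also have "\<dots> = \<zeta> x - of_bool (\<zeta> x > 0) + (\<Sum>y\<in>{1..L}. of_bool (\<zeta> y > 0) * of_bool (u y = x))
        + of_bool (x = (if \<zeta> a = 0 then u a else a))"
      by (rule arith)
    also have "\<dots> = put (if \<zeta> a = 0 then u a else a) (rbb_update L u \<zeta>) x"
      using True by (auto simp: put_def rbb_update_def)
    finally show ?thesis .
  next
    case False
    moreover have "x \<noteq> (if \<zeta> a = 0 then u a else a)" using False a ua by presburger
    ultimately show ?thesis by (simp only: put_def rbb_update_def fun_upd_apply if_False)
  qed
qed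

lemma update_transpose_empty:
  assumes "\<zeta> a = 0" "\<zeta> b = 0"
  shows "rbb_update L (u \<circ> Transposition.transpose a b) \<zeta> = rbb_update L u \<zeta>"
proof
  fix x
  have "(of_bool (\<zeta> y > 0) * of_bool ((u \<circ> Transposition.transpose a b) y = x) :: nat)
      = of_bool (\<zeta> y > 0) * of_bool (u y = x)" for y
    using assms by (cases "y = a"; cases "y = b") (auto simp: transpose_def)
  then have "(\<Sum>y\<in>{1..L}. of_bool (\<zeta> y > 0) * of_bool ((u \<circ> Transposition.transpose a b) y = x) :: nat)
      = (\<Sum>y\<in>{1..L}. of_bool (\<zeta> y > 0) * of_bool (u y = x))"
    by (intro sum.cong refl)
  then show "rbb_update L (u \<circ> Transposition.transpose a b) \<zeta> x = rbb_update L u \<zeta> x"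
    unfolding rbb_update_def by presburger
qed

definition first_conf :: "pairstate \<Rightarrow> nat \<Rightarrow> nat" where
  "first_conf s = put (fst (snd s)) (fst s)"

definition swap_pair :: "pairstate \<Rightarrow> pairstate" where
  "swap_pair s = (fst s, snd (snd s), fst (snd s))"

lemma move_swap: "move L u (swap_pair s) = swap_pair (move L u s)"
  by (cases s) (auto simp: move_def swap_pair_def min.commute)

lemma swap_pair_in: "s \<in> pairs L N \<Longrightarrow> swap_pair s \<in> pairs L N"
  by (auto simp: pairs_def swap_pair_def)

lemma avg_first_conf:
  assumes s: "s \<in> pairs L N"
  shows "avg L (\<lambda>u. F (first_conf (move L u s))) = avg L (\<lambda>u. F (rbb_update L u (first_conf s)))"
proof -
  obtain \<zeta> a b where seq: "s = (\<zeta>, a, b)" by (cases s) auto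
  have ab: "a \<in> {1..L}" "b \<in> {1..L}" using s unfolding seq pairs_def by auto
  have mv: "first_conf (move L u s)
      = put (if \<zeta> a = 0 then u (if \<zeta> b = 0 then min a b else a) else a) (rbb_update L u \<zeta>)" for u
    by (simp add: seq move_def first_conf_def)
  show ?thesis
  proof (cases "\<zeta> a = 0 \<and> \<zeta> b = 0 \<and> b \<le> a")
    case False
    then have "first_conf (move L u s) = rbb_update L u (first_conf s)" if "u \<in> choices L" for u
      unfolding mv using update_put[OF ab(1) that, of \<zeta>]
      by (auto simp: seq first_conf_def min_def)
    then show ?thesis by (intro avg_cong) simp
  next
    case True
    let ?t = "Transposition.transpose a b"
    have m: "?t y \<in> {1..L} \<longleftrightarrow> y \<in> {1..L}" for y
      using ab by (cases "y = a"; cases "y = b") auto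
    have "rbb_update L (u \<circ> ?t) (first_conf s) = first_conf (move L u s)" if u: "u \<in> choices L" for u
    proof -
      have ut: "u \<circ> ?t \<in> choices L" using u m unfolding choices_iff by (simp del: atLeastAtMost_iff)
      note that0 = update_put[OF ab(1) ut, of \<zeta>] and zz = True
      show ?thesis
      proof (cases "a = b")
        case True
        then show ?thesis using that0 unfolding mv by (simp add: seq first_conf_def)
      next
        case False
        then show ?thesis unfolding mv using that0 zz by (simp add: seq first_conf_def min_def update_transpose_empty)
      qed
    qed
    then have "avg L (\<lambda>u. F (first_conf (move L u s))) = avg L (\<lambda>u. F (rbb_update L (u \<circ> ?t) (first_conf s)))"
      by (intro avg_cong) simp
    also have "\<dots> = avg L (\<lambda>u. F (rbb_update L u (first_conf s)))"
      by (rule avg_transpose[OF ab, of "\<lambda>u. F (rbb_update L u (first_conf s))"])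
    finally show ?thesis .
  qed
qed

definition apart :: "pairstate \<Rightarrow> real" where
  "apart s = of_bool (fst (snd s) \<noteq> snd (snd s))"

lemma apart_range: "0 \<le> apart s" "apart s \<le> 1"
  by (auto simp: apart_def)

lemma apart_move: "apart (move L u s) \<le> apart s"
  by (cases s) (auto simp: apart_def move_def)

lemma trans_op_apart: "trans_op L (move L) apart s \<le> apart s"
proof -
  have "avg L (\<lambda>u. apart (move L u s)) \<le> avg L (\<lambda>u. apart s)"
    by (intro avg_mono apart_move)
  then show ?thesis by (simp add: trans_op_def)
qed

lemma apart_pow_antimono:
  assumes "m \<le> n" "s \<in> pairs L N"
  shows "(trans_op L (move L) ^^ n) apart s \<le> (trans_op L (move L) ^^ m) apart s"
proof -
  have "(trans_op L (move L) ^^ Suc k) apart s \<le> (trans_op L (move L) ^^ k) apart s" for k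
    unfolding funpow_Suc_right o_apply
    by (rule trans_op_pow_mono[OF closed_move assms(2) trans_op_apart])
  then show ?thesis by (rule lift_Suc_antimono_le[OF _ assms(1)])
qed

text \<open>
  The two projections of the pair process are copies of the chain that agree once the second
  class particles have met.
\<close>

lemma coupling_bound:
  fixes f :: "(nat \<Rightarrow> nat) \<Rightarrow> real"
  assumes f: "\<And>\<eta>. 0 \<le> f \<eta>" "\<And>\<eta>. f \<eta> \<le> 1"
    and s: "\<zeta> \<in> confs L N" "a \<in> {1..L}" "b \<in> {1..L}"
  shows "(trans_op L (rbb_update L) ^^ n) f (put a \<zeta>) - (trans_op L (rbb_update L) ^^ n) f (put b \<zeta>)
         \<le> (trans_op L (move L) ^^ n) apart (\<zeta>, a, b)"
proof -
  let ?Q = "trans_op L (move L)" and ?P = "trans_op L (rbb_update L)"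
  have mem: "(\<zeta>, a, b) \<in> pairs L N" "(\<zeta>, b, a) \<in> pairs L N" using s by (auto simp: pairs_def)
  have proj: "(?Q ^^ n) (\<lambda>s. f (first_conf s)) s = (?P ^^ n) f (first_conf s)" if "s \<in> pairs L N" for s
    by (rule trans_op_pow_project[OF closed_move avg_first_conf that])
  have 1: "(?Q ^^ n) (\<lambda>s. f (first_conf s)) (\<zeta>, a, b) = (?P ^^ n) f (put a \<zeta>)"
    using proj[OF mem(1)] by (simp add: first_conf_def)
  have "(?Q ^^ n) (\<lambda>s. (\<lambda>s. f (first_conf s)) (swap_pair s)) (\<zeta>, a, b)
      = (?Q ^^ n) (\<lambda>s. f (first_conf s)) (swap_pair (\<zeta>, a, b))"
    by (rule trans_op_pow_project[OF closed_move _ mem(1)]) (simp add: move_swap)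
  also have "\<dots> = (?P ^^ n) f (put b \<zeta>)"
    using proj[OF mem(2)] by (simp add: first_conf_def swap_pair_def)
  finally have 2: "(?Q ^^ n) (\<lambda>s. f (first_conf (swap_pair s))) (\<zeta>, a, b) = (?P ^^ n) f (put b \<zeta>)"
    by simp
  have "(?P ^^ n) f (put a \<zeta>) - (?P ^^ n) f (put b \<zeta>)
      = (?Q ^^ n) (\<lambda>s. f (first_conf s) - f (first_conf (swap_pair s))) (\<zeta>, a, b)"
    by (simp only: trans_op_pow_diff 1 2)
  also have "\<dots> \<le> (?Q ^^ n) apart (\<zeta>, a, b)"
  proof (rule trans_op_pow_mono[OF closed_move mem(1)])
    fix s :: pairstate
    show "f (first_conf s) - f (first_conf (swap_pair s)) \<le> apart s"
      using f[of "first_conf s"] f[of "first_conf (swap_pair s)"]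
      by (cases s) (auto simp: apart_def first_conf_def swap_pair_def)
  qed
  finally show ?thesis .
qed

section \<open>Exponential moments of the loads\<close>

definition emp :: "nat \<Rightarrow> (nat \<Rightarrow> nat) \<Rightarrow> real" where
  "emp L \<zeta> = (\<Sum>x\<in>{1..L}. of_bool (\<zeta> x = 0)) / real L"

definition mean_exp :: "real \<Rightarrow> nat \<Rightarrow> (nat \<Rightarrow> nat) \<Rightarrow> real" where
  "mean_exp \<theta> L \<zeta> = (\<Sum>x\<in>{1..L}. exp (\<theta> * real (\<zeta> x))) / real L"

lemma mean_exp_nonneg: "0 \<le> mean_exp \<theta> L \<zeta>"
  unfolding mean_exp_def by (intro divide_nonneg_nonneg sum_nonneg) auto

lemma emp_range: "0 \<le> emp L \<zeta>" "emp L \<zeta> \<le> 1"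
proof -
  show "0 \<le> emp L \<zeta>" unfolding emp_def by (intro divide_nonneg_nonneg sum_nonneg) auto
  have "(\<Sum>x\<in>{1..L}. of_bool (\<zeta> x = 0) :: real) \<le> (\<Sum>x\<in>{1..L}. 1)" by (rule sum_mono) auto
  then show "emp L \<zeta> \<le> 1" unfolding emp_def by (intro divide_le_eq_1[THEN iffD2]) auto
qed

lemma exp_load_update:
  assumes "x \<in> {1..L}"
  shows "exp (\<theta> * real (rbb_update L u \<zeta> x)) = exp (\<theta> * real (\<zeta> x - of_bool (\<zeta> x > 0)))
    * (\<Prod>y\<in>{1..L}. if \<zeta> y > 0 \<and> u y = x then exp \<theta> else 1)"
proof -
  have e: "exp (\<theta> * real (of_bool (\<zeta> y > 0) * of_bool (u y = x)))
      = (if \<zeta> y > 0 \<and> u y = x then exp \<theta> else 1)" for y by auto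
  show ?thesis
    using assms unfolding rbb_update_def
    by (simp only: if_True of_nat_add of_nat_sum distrib_left sum_distrib_left exp_add
        exp_sum finite_atLeastAtMost e)
qed

text \<open>
  The arrivals at a site are binomial with mean \<open>1 - emp L \<zeta>\<close>. The second bound holds because
  the target of an empty site \<open>c\<close> is independent of the arrivals; it serves a second class particle
  that jumps from \<open>c\<close>.
\<close>

lemma avg_arrivals_mgf:
  assumes L: "L \<ge> 1" and x: "x \<in> {1..L}" and t: "\<theta> \<ge> 0"
  shows "avg L (\<lambda>u. \<Prod>y\<in>{1..L}. if \<zeta> y > 0 \<and> u y = x then exp \<theta> else 1)
      \<le> exp ((exp \<theta> - 1) * (1 - emp L \<zeta>))" (is "avg L ?F \<le> _")
    and "c \<in> {1..L} \<Longrightarrow> \<zeta> c = 0 \<Longrightarrow>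
      avg L (\<lambda>u. of_bool (u c = x) * (\<Prod>y\<in>{1..L}. if \<zeta> y > 0 \<and> u y = x then exp \<theta> else 1))
      \<le> exp ((exp \<theta> - 1) * (1 - emp L \<zeta>)) / real L"
proof -
  have L0: "real L > 0" using L by simp
  let ?f = "\<lambda>y v. if \<zeta> y > 0 \<and> v = x then exp \<theta> else (1::real)"
  have s: "(\<Sum>v\<in>{1..L}. ?f y v) = real L + of_bool (\<zeta> y > 0) * (exp \<theta> - 1)" for y
  proof -
    have "(\<Sum>v\<in>{1..L}. ?f y v) = (\<Sum>v\<in>{1..L}. 1 + (if v = x then of_bool (\<zeta> y > 0) * (exp \<theta> - 1) else 0))"
      by (rule sum.cong) auto
    also have "\<dots> = real L + of_bool (\<zeta> y > 0) * (exp \<theta> - 1)"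
      using x by (simp add: sum.distrib)
    finally show ?thesis .
  qed
  have le: "(\<Sum>v\<in>{1..L}. ?f y v) / real L \<le> exp (of_bool (\<zeta> y > 0) * (exp \<theta> - 1) / real L)" for y
  proof -
    have "(\<Sum>v\<in>{1..L}. ?f y v) / real L = 1 + of_bool (\<zeta> y > 0) * (exp \<theta> - 1) / real L"
      unfolding s using L0 by (simp add: add_divide_distrib)
    then show ?thesis using exp_ge_add_one_self by metis
  qed
  have sumle: "(\<Sum>y\<in>{1..L}. of_bool (\<zeta> y > 0) * (exp \<theta> - 1) / real L) = (exp \<theta> - 1) * (1 - emp L \<zeta>)"
  proof -
    have "1 - emp L \<zeta> = (\<Sum>y\<in>{1..L}. 1 - of_bool (\<zeta> y = 0)) / real L"
      unfolding emp_def using L0 by (simp add: sum_subtractf diff_divide_distrib)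
    also have "\<dots> = (\<Sum>y\<in>{1..L}. of_bool (\<zeta> y > 0)) / real L"
      by (intro arg_cong2[where f="(/)"] sum.cong refl) auto
    finally show ?thesis
      by (simp only: sum_divide_distrib sum_distrib_left) (simp only: mult.commute times_divide_eq_right)
  qed
  have pr: "(\<Prod>y\<in>A. (\<Sum>v\<in>{1..L}. ?f y v) / real L) \<le> exp ((exp \<theta> - 1) * (1 - emp L \<zeta>))"
    if A: "A \<subseteq> {1..L}" for A
  proof -
    have "(\<Prod>y\<in>A. (\<Sum>v\<in>{1..L}. ?f y v) / real L)
        \<le> (\<Prod>y\<in>A. exp (of_bool (\<zeta> y > 0) * (exp \<theta> - 1) / real L))"
      using le by (intro prod_mono conjI divide_nonneg_nonneg sum_nonneg) auto
    also have "\<dots> = exp (\<Sum>y\<in>A. of_bool (\<zeta> y > 0) * (exp \<theta> - 1) / real L)"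
      using A by (intro exp_sum[symmetric]) (auto intro: finite_subset)
    also have "\<dots> \<le> exp (\<Sum>y\<in>{1..L}. of_bool (\<zeta> y > 0) * (exp \<theta> - 1) / real L)"
      using t A by (intro exp_le_cancel_iff[THEN iffD2] sum_mono2) auto
    finally show ?thesis unfolding sumle .
  qed
  have "avg L ?F = (\<Prod>y\<in>{1..L}. (\<Sum>v\<in>{1..L}. ?f y v) / real L)"
    by (rule avg_prod[OF L]) auto
  then show "avg L ?F \<le> exp ((exp \<theta> - 1) * (1 - emp L \<zeta>))" using pr[of "{1..L}"] by simp
  assume c: "c \<in> {1..L}" "\<zeta> c = 0"
  let ?g = "\<lambda>y v. if y = c then of_bool (v = x) else ?f y v"
  have "avg L (\<lambda>u. of_bool (u c = x) * ?F u) = avg L (\<lambda>u. \<Prod>y\<in>{1..L}. ?g y (u y))"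
  proof (rule avg_cong)
    fix u
    have 1: "?F u = (\<Prod>y\<in>{1..L}-{c}. ?f y (u y))"
      using c by (simp only: prod.remove[OF finite_atLeastAtMost c(1)]) simp
    have 2: "(\<Prod>y\<in>{1..L}. ?g y (u y)) = of_bool (u c = x) * (\<Prod>y\<in>{1..L}-{c}. ?g y (u y))"
      by (subst prod.remove[OF finite_atLeastAtMost c(1)]) simp
    have 3: "(\<Prod>y\<in>{1..L}-{c}. ?g y (u y)) = (\<Prod>y\<in>{1..L}-{c}. ?f y (u y))"
      by (rule prod.cong) auto
    show "of_bool (u c = x) * ?F u = (\<Prod>y\<in>{1..L}. ?g y (u y))"
      unfolding 1 2 3 ..
  qed
  also have "\<dots> = (\<Prod>y\<in>{1..L}. (\<Sum>v\<in>{1..L}. ?g y v) / real L)"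
    by (rule avg_prod[OF L]) auto
  also have "\<dots> = (\<Sum>v\<in>{1..L}. ?g c v) / real L * (\<Prod>y\<in>{1..L}-{c}. (\<Sum>v\<in>{1..L}. ?g y v) / real L)"
    by (rule prod.remove[OF finite_atLeastAtMost c(1)])
  also have "(\<Sum>v\<in>{1..L}. ?g c v) = 1"
    using x by (simp add: of_bool_def)
  also have "(\<Prod>y\<in>{1..L}-{c}. (\<Sum>v\<in>{1..L}. ?g y v) / real L) = (\<Prod>y\<in>{1..L}-{c}. (\<Sum>v\<in>{1..L}. ?f y v) / real L)"
    by (rule prod.cong) auto
  also have "1 / real L * (\<Prod>y\<in>{1..L}-{c}. (\<Sum>v\<in>{1..L}. ?f y v) / real L)
      \<le> 1 / real L * exp ((exp \<theta> - 1) * (1 - emp L \<zeta>))"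
    by (intro mult_left_mono pr) auto
  finally show "avg L (\<lambda>u. of_bool (u c = x) * ?F u) \<le> exp ((exp \<theta> - 1) * (1 - emp L \<zeta>)) / real L"
    by simp
qed

text \<open>
  A nonempty site loses one particle, which compensates the mean of the arrivals up to the
  proportion \<open>z\<close> of empty sites. The term \<open>exp 2\<close> is for empty sites.
\<close>

lemma load_factor_bound:
  fixes \<theta> z :: real and X :: nat
  assumes t: "0 \<le> \<theta>" "\<theta> \<le> 1" and z: "0 \<le> z" "z \<le> 1"
  shows "exp (\<theta> * real (X - of_bool (X > 0))) * exp ((exp \<theta> - 1) * (1 - z))
    \<le> exp (\<theta>\<^sup>2) * (1 - \<theta> / 2 * z) * exp (\<theta> * real X) + exp 2"
proof (cases "X = 0")
  case True
  have "(exp \<theta> - 1) * (1 - z) \<le> (\<theta> + \<theta>\<^sup>2) * 1"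
    using exp_bound[OF t] t z by (intro mult_mono) auto
  also have "\<dots> \<le> 2" using t power_le_one[OF t, of 2] by simp
  finally have "exp ((exp \<theta> - 1) * (1 - z)) \<le> exp 2" by simp
  moreover have "0 \<le> exp (\<theta>\<^sup>2) * (1 - \<theta> / 2 * z)"
    using mult_mono[of "\<theta>/2" 1 z 1] t z by simp
  moreover have "exp (\<theta> * real (X - of_bool (X > 0))) = 1" "exp (\<theta> * real X) = 1"
    using True by simp_all
  ultimately show ?thesis by (simp only: mult_1 mult_1_right)
next
  case False
  let ?y = "\<theta> * z"
  have y: "0 \<le> ?y" "?y \<le> 1" using t z mult_mono[of \<theta> 1 z 1] by auto
  have "(exp \<theta> - 1) * (1 - z) \<le> (\<theta> + \<theta>\<^sup>2) * (1 - z)"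
    using exp_bound[OF t] z by (intro mult_right_mono) auto
  also have "\<dots> \<le> \<theta> + \<theta>\<^sup>2 - ?y" using z by (simp add: algebra_simps)
  finally have 1: "\<theta> * (real X - 1) + (exp \<theta> - 1) * (1 - z) \<le> \<theta>\<^sup>2 + (- ?y) + \<theta> * real X"
    by (simp add: algebra_simps)
  have "exp (- ?y) \<le> 1 / (1 + ?y)"
    using exp_ge_add_one_self[of ?y] y by (simp add: exp_minus field_simps)
  also have "\<dots> \<le> 1 - ?y / 2"
  proof -
    have "?y * ?y \<le> ?y * 1" using y by (intro mult_left_mono)
    then have "1 \<le> (1 - ?y / 2) * (1 + ?y)" by (simp add: algebra_simps)
    then show ?thesis using y by (simp add: divide_le_eq)
  qed
  finally have 2: "exp (- ?y) \<le> 1 - \<theta> / 2 * z" by simp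
  have "exp (\<theta> * real (X - of_bool (X > 0))) * exp ((exp \<theta> - 1) * (1 - z))
      = exp (\<theta> * (real X - 1) + (exp \<theta> - 1) * (1 - z))"
    using False by (simp add: exp_add of_nat_diff)
  also have "\<dots> \<le> exp (\<theta>\<^sup>2 + (- ?y) + \<theta> * real X)" using 1 by simp
  also have "\<dots> = exp (\<theta>\<^sup>2) * exp (- ?y) * exp (\<theta> * real X)" by (simp only: exp_add)
  also have "\<dots> \<le> exp (\<theta>\<^sup>2) * (1 - \<theta> / 2 * z) * exp (\<theta> * real X)"
    using 2 by (intro mult_right_mono mult_left_mono) auto
  also have "\<dots> \<le> \<dots> + exp 2" by simp
  finally show ?thesis .
qed

lemma one_step_site:
  assumes L: "L \<ge> 1" and x: "x \<in> {1..L}" and t: "0 \<le> \<theta>" "\<theta> \<le> 1"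
  shows "avg L (\<lambda>u. exp (\<theta> * real (rbb_update L u \<zeta> x)))
    \<le> exp (\<theta>\<^sup>2) * (1 - \<theta> / 2 * emp L \<zeta>) * exp (\<theta> * real (\<zeta> x)) + exp 2"
proof -
  have "avg L (\<lambda>u. exp (\<theta> * real (rbb_update L u \<zeta> x)))
     = exp (\<theta> * real (\<zeta> x - of_bool (\<zeta> x > 0)))
        * avg L (\<lambda>u. \<Prod>y\<in>{1..L}. if \<zeta> y > 0 \<and> u y = x then exp \<theta> else 1)"
    unfolding exp_load_update[OF x] avg_cmult ..
  also have "\<dots> \<le> exp (\<theta> * real (\<zeta> x - of_bool (\<zeta> x > 0))) * exp ((exp \<theta> - 1) * (1 - emp L \<zeta>))"
    by (intro mult_left_mono avg_arrivals_mgf L x t) auto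
  also have "\<dots> \<le> exp (\<theta>\<^sup>2) * (1 - \<theta> / 2 * emp L \<zeta>) * exp (\<theta> * real (\<zeta> x)) + exp 2"
    by (intro load_factor_bound t emp_range)
  finally show ?thesis .
qed

lemma one_step_mean_exp:
  assumes L: "L \<ge> 1" and t: "0 \<le> \<theta>" "\<theta> \<le> 1"
  shows "avg L (\<lambda>u. mean_exp \<theta> L (rbb_update L u \<zeta>))
    \<le> exp (\<theta>\<^sup>2) * (1 - \<theta> / 2 * emp L \<zeta>) * mean_exp \<theta> L \<zeta> + exp 2"
proof -
  have "avg L (\<lambda>u. mean_exp \<theta> L (rbb_update L u \<zeta>))
      = (\<Sum>x\<in>{1..L}. avg L (\<lambda>u. exp (\<theta> * real (rbb_update L u \<zeta> x)))) / real L"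
    unfolding mean_exp_def avg_sum[symmetric] using avg_cmult[of L "1 / real L"] by simp
  also have "\<dots> \<le> (\<Sum>x\<in>{1..L}. exp (\<theta>\<^sup>2) * (1 - \<theta> / 2 * emp L \<zeta>) * exp (\<theta> * real (\<zeta> x)) + exp 2) / real L"
    by (intro divide_right_mono sum_mono one_step_site L t) auto
  also have "\<dots> = exp (\<theta>\<^sup>2) * (1 - \<theta> / 2 * emp L \<zeta>) * mean_exp \<theta> L \<zeta> + exp 2"
    unfolding sum.distrib sum_distrib_left[symmetric] mean_exp_def
    using L by (simp add: add_divide_distrib)
  finally show ?thesis .
qed

text \<open>
  A jumping particle sees the load of a uniform site, hence an average of exponential weights.
\<close>

lemma one_step_jump:
  assumes L: "L \<ge> 1" and t: "0 \<le> \<theta>" "\<theta> \<le> 1" and c: "c \<in> {1..L}" "\<zeta> c = 0"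
  shows "avg L (\<lambda>u. exp (\<theta> * real (rbb_update L u \<zeta> (u c)))) \<le> exp 1 * mean_exp \<theta> L \<zeta> + exp 2"
proof -
  let ?A = "\<lambda>u x. \<Prod>y\<in>{1..L}. if \<zeta> y > 0 \<and> u y = x then exp \<theta> else 1"
  have "avg L (\<lambda>u. exp (\<theta> * real (rbb_update L u \<zeta> (u c))))
     = avg L (\<lambda>u. \<Sum>x\<in>{1..L}. exp (\<theta> * real (\<zeta> x - of_bool (\<zeta> x > 0))) * (of_bool (u c = x) * ?A u x))"
  proof (rule avg_cong)
    fix u assume u: "u \<in> choices L"
    have uc: "u c \<in> {1..L}" by (rule choices_site[OF u c(1)])
    have "(\<Sum>x\<in>{1..L}. exp (\<theta> * real (\<zeta> x - of_bool (\<zeta> x > 0))) * (of_bool (u c = x) * ?A u x))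
        = (\<Sum>x\<in>{1..L}. if x = u c then exp (\<theta> * real (rbb_update L u \<zeta> x)) else 0)"
    proof (rule sum.cong[OF refl])
      fix x assume "x \<in> {1..L}"
      then show "exp (\<theta> * real (\<zeta> x - of_bool (\<zeta> x > 0))) * (of_bool (u c = x) * ?A u x)
        = (if x = u c then exp (\<theta> * real (rbb_update L u \<zeta> x)) else 0)"
        by (cases "x = u c") (simp_all only: exp_load_update, simp_all)
    qed
    also have "\<dots> = exp (\<theta> * real (rbb_update L u \<zeta> (u c)))"
      using uc by (simp only: sum.delta finite_atLeastAtMost if_True)
    finally show "exp (\<theta> * real (rbb_update L u \<zeta> (u c)))
        = (\<Sum>x\<in>{1..L}. exp (\<theta> * real (\<zeta> x - of_bool (\<zeta> x > 0))) * (of_bool (u c = x) * ?A u x))"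
      by (rule sym)
  qed
  also have "\<dots> = (\<Sum>x\<in>{1..L}. exp (\<theta> * real (\<zeta> x - of_bool (\<zeta> x > 0))) * avg L (\<lambda>u. of_bool (u c = x) * ?A u x))"
    unfolding avg_sum avg_cmult ..
  also have "\<dots> \<le> (\<Sum>x\<in>{1..L}. exp (\<theta> * real (\<zeta> x - of_bool (\<zeta> x > 0)))
      * (exp ((exp \<theta> - 1) * (1 - emp L \<zeta>)) / real L))"
    by (intro sum_mono mult_left_mono avg_arrivals_mgf(2) L t c) auto
  also have "\<dots> \<le> (\<Sum>x\<in>{1..L}. (exp 1 * exp (\<theta> * real (\<zeta> x)) + exp 2) / real L)"
  proof (rule sum_mono)
    fix x
    have "\<theta>\<^sup>2 \<le> 1" using t by (simp add: power_le_one)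
    then have "exp (\<theta>\<^sup>2) * (1 - \<theta> / 2 * emp L \<zeta>) \<le> exp 1 * 1"
      using mult_mono[of "\<theta>/2" 1 "emp L \<zeta>" 1] t emp_range[of L \<zeta>]
      by (intro mult_mono) auto
    then have "exp (\<theta>\<^sup>2) * (1 - \<theta> / 2 * emp L \<zeta>) * exp (\<theta> * real (\<zeta> x)) \<le> exp 1 * exp (\<theta> * real (\<zeta> x))"
      by (intro mult_right_mono) auto
    with load_factor_bound[OF t emp_range, of "\<zeta> x" L \<zeta>]
    have "exp (\<theta> * real (\<zeta> x - of_bool (\<zeta> x > 0))) * exp ((exp \<theta> - 1) * (1 - emp L \<zeta>))
      \<le> exp 1 * exp (\<theta> * real (\<zeta> x)) + exp 2" by linarith
    from divide_right_mono[OF this, of "real L"]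
    show "exp (\<theta> * real (\<zeta> x - of_bool (\<zeta> x > 0))) * (exp ((exp \<theta> - 1) * (1 - emp L \<zeta>)) / real L)
      \<le> (exp 1 * exp (\<theta> * real (\<zeta> x)) + exp 2) / real L" by simp
  qed
  also have "\<dots> = exp 1 * mean_exp \<theta> L \<zeta> + exp 2"
    using L unfolding mean_exp_def sum_divide_distrib[symmetric] sum.distrib sum_distrib_left[symmetric]
    by (simp add: add_divide_distrib)
  finally show ?thesis .
qed

section \<open>Empty sites\<close>

lemma one_minus_power_bound:
  assumes "L \<ge> 4"
  shows "exp (-4) \<le> (1 - 2 / real L) ^ L"
proof -
  let ?x = "2 / real L"
  have x: "0 \<le> ?x" "?x \<le> 1/2" using assms by (auto simp: field_simps)
  have "- ?x - 2 * ?x\<^sup>2 \<le> ln (1 - ?x)" by (rule ln_one_minus_pos_lower_bound[OF x])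
  moreover have "- 2 * ?x \<le> - ?x - 2 * ?x\<^sup>2"
    using mult_left_mono[OF x(2) x(1)] by (simp add: power2_eq_square)
  ultimately have "real L * (- 2 * ?x) \<le> real L * ln (1 - ?x)" by (intro mult_left_mono) auto
  then have "- 4 \<le> real L * ln (1 - ?x)" using assms by simp
  then have "exp (-4) \<le> exp (real L * ln (1 - ?x))" by simp
  also have "\<dots> = (1 - ?x) ^ L" using x by (subst exp_of_nat_mult) simp
  finally show ?thesis .
qed

lemma avg_no_arrival:
  assumes L: "L \<ge> 4" and x: "x \<in> {1..L}"
  shows "exp (-4) \<le> avg L (\<lambda>u. of_bool (\<forall>y\<in>{1..L}. u y \<noteq> x))"
proof -
  have L1: "L \<ge> 1" using L by simp
  have "avg L (\<lambda>u. of_bool (\<forall>y\<in>{1..L}. u y \<noteq> x)) = avg L (\<lambda>u. \<Prod>y\<in>{1..L}. of_bool (u y \<noteq> x))"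
  proof (rule avg_cong)
    fix u :: "nat \<Rightarrow> nat"
    show "of_bool (\<forall>y\<in>{1..L}. u y \<noteq> x) = (\<Prod>y\<in>{1..L}. of_bool (u y \<noteq> x) :: real)"
      by (cases "\<forall>y\<in>{1..L}. u y \<noteq> x") auto
  qed
  also have "\<dots> = (\<Prod>y\<in>{1..L}. (\<Sum>v\<in>{1..L}. of_bool (v \<noteq> x)) / real L)"
    by (rule avg_prod[OF L1]) auto
  also have "(\<Sum>v\<in>{1..L}. of_bool (v \<noteq> x) :: real) = real L - 1"
  proof -
    have "(\<Sum>v\<in>{1..L}. of_bool (v \<noteq> x) :: real) = (\<Sum>v\<in>{1..L}. 1 - (if v = x then 1 else 0))"
      by (rule sum.cong) auto
    also have "\<dots> = real L - 1" using x by (simp add: sum_subtractf)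
    finally show ?thesis .
  qed
  also have "(\<Prod>y\<in>{1..L}. (real L - 1) / real L) = (1 - 1 / real L) ^ L"
    using L by (simp add: diff_divide_distrib)
  also have "(1 - 1 / real L) ^ L \<ge> (1 - 2 / real L) ^ L"
    using L by (intro power_mono) (auto simp: field_simps)
  finally show ?thesis using one_minus_power_bound[OF L] by linarith
qed

lemma update_no_arrival:
  assumes x: "x \<in> {1..L}" and o: "\<And>y. y \<in> {1..L} \<Longrightarrow> \<zeta> y > 0 \<Longrightarrow> u y \<noteq> x"
  shows "rbb_update L u \<zeta> x = \<zeta> x - 1"
proof -
  have "(\<Sum>y\<in>{1..L}. of_bool (\<zeta> y > 0) * of_bool (u y = x) :: nat) = 0"
  proof (intro sum.neutral ballI)
    fix y assume "y \<in> {1..L}"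
    then show "(of_bool (\<zeta> y > 0) * of_bool (u y = x) :: nat) = 0"
      using o[of y] by (cases "\<zeta> y = 0") auto
  qed
  then show ?thesis
    unfolding rbb_update_def if_P[OF x] by (simp only:) (auto simp: of_bool_def)
qed

lemma update_ge: "x \<in> {1..L} \<Longrightarrow> \<zeta> x - 1 \<le> rbb_update L u \<zeta> x"
  unfolding rbb_update_def by (simp only: if_True) (cases "\<zeta> x = 0"; simp)

lemma prob_site_empty:
  assumes L: "L \<ge> 4" and x: "x \<in> {1..L}" and z: "\<zeta> x \<le> s"
  shows "exp (-4) ^ s \<le> (trans_op L (rbb_update L) ^^ s) (\<lambda>\<zeta>. of_bool (\<zeta> x = 0)) \<zeta>"
  using z
proof (induction s arbitrary: \<zeta>)
  case (Suc s)
  let ?P = "trans_op L (rbb_update L)"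
  have "exp (-4) ^ Suc s \<le> exp (-4) ^ s * avg L (\<lambda>u. of_bool (\<forall>y\<in>{1..L}. u y \<noteq> x))"
    using avg_no_arrival[OF L x] by (simp add: mult.commute)
  also have "\<dots> = avg L (\<lambda>u. exp (-4) ^ s * of_bool (\<forall>y\<in>{1..L}. u y \<noteq> x))"
    by (simp only: avg_cmult)
  also have "\<dots> \<le> avg L (\<lambda>u. (?P ^^ s) (\<lambda>\<zeta>. of_bool (\<zeta> x = 0)) (rbb_update L u \<zeta>))"
  proof (rule avg_mono)
    fix u
    show "exp (-4) ^ s * of_bool (\<forall>y\<in>{1..L}. u y \<noteq> x)
        \<le> (?P ^^ s) (\<lambda>\<zeta>. of_bool (\<zeta> x = 0)) (rbb_update L u \<zeta>)"
    proof (cases "\<forall>y\<in>{1..L}. u y \<noteq> x")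
      case True
      have "rbb_update L u \<zeta> x = \<zeta> x - 1" by (rule update_no_arrival[OF x]) (use True in blast)
      then have "rbb_update L u \<zeta> x \<le> s" using Suc.prems by simp
      from Suc.IH[of "rbb_update L u \<zeta>", OF this] True show ?thesis by simp
    next
      case False
      have "0 \<le> (?P ^^ s) (\<lambda>\<zeta>. of_bool (\<zeta> x = 0)) (rbb_update L u \<zeta>)"
        by (rule trans_op_pow_nonneg[of _ _ UNIV]) (auto simp: closed_under_def)
      moreover have "of_bool (\<forall>y\<in>{1..L}. u y \<noteq> x) = (0::real)" using False by (simp only: of_bool_eq)
      ultimately show ?thesis by (simp only: mult_zero_right)
    qed
  qed
  also have "\<dots> = (?P ^^ Suc s) (\<lambda>\<zeta>. of_bool (\<zeta> x = 0)) \<zeta>" by (rule trans_op_pow_Suc[symmetric])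
  finally show ?case .
qed auto

lemma card_low_load:
  assumes z: "\<zeta> \<in> confs L N" and N: "2 * N \<le> s * L"
  shows "real L \<le> 2 * real (card {x\<in>{1..L}. \<zeta> x \<le> s})"
proof -
  let ?A = "{x\<in>{1..L}. \<zeta> x \<le> s}"
  have "(\<Sum>x\<in>{1..L} - ?A. s) \<le> (\<Sum>x\<in>{1..L} - ?A. \<zeta> x)"
    by (rule sum_mono) auto
  then have "s * card ({1..L} - ?A) \<le> (\<Sum>x\<in>{1..L} - ?A. \<zeta> x)"
    by (simp only: sum_constant of_nat_id mult.commute)
  also have "\<dots> \<le> N" using z unfolding confs_def by (auto intro!: sum_mono2)
  finally have 1: "2 * (s * card ({1..L} - ?A)) \<le> s * L" using N by linarith
  show "real L \<le> 2 * real (card ?A)"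
  proof (cases "s = 0")
    case True
    then have "N = 0" using N by simp
    then have "?A = {1..L}" using z unfolding confs_def by auto
    then show ?thesis by simp
  next
    case False
    then have "2 * card ({1..L} - ?A) \<le> L" using 1 by simp
    moreover have "card ({1..L} - ?A) = L - card ?A"
      by (subst card_Diff_subset) auto
    ultimately have "L \<le> 2 * card ?A" by linarith
    then show ?thesis by linarith
  qed
qed

text \<open>
  Half of the sites start with load at most \<open>s\<close>, and such a site is empty after \<open>s\<close> steps
  unless a particle arrives there.
\<close>

lemma mean_empty:
  assumes L: "L \<ge> 4" and z: "\<zeta> \<in> confs L N" and N: "2 * N \<le> s * L"
  shows "exp (-4) ^ s / 2 \<le> (trans_op L (rbb_update L) ^^ s) (emp L) \<zeta>"
proof -
  let ?P = "trans_op L (rbb_update L)"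
  let ?A = "{x\<in>{1..L}. \<zeta> x \<le> s}"
  have L0: "real L > 0" using L by simp
  have big: "real L \<le> 2 * real (card ?A)" by (rule card_low_load[OF z N])
  have e: "emp L = (\<lambda>\<zeta>. (1 / real L) * (\<Sum>x\<in>{1..L}. of_bool (\<zeta> x = 0)))"
    by (rule ext) (simp add: emp_def)
  have "real (card ?A) * exp (-4) ^ s = (\<Sum>x\<in>?A. exp (-4) ^ s)" by simp
  also have "\<dots> \<le> (\<Sum>x\<in>?A. (?P ^^ s) (\<lambda>\<zeta>. of_bool (\<zeta> x = 0)) \<zeta>)"
    by (intro sum_mono prob_site_empty L) auto
  also have "\<dots> \<le> (\<Sum>x\<in>{1..L}. (?P ^^ s) (\<lambda>\<zeta>. of_bool (\<zeta> x = 0)) \<zeta>)"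
    by (intro sum_mono2) (auto intro!: trans_op_pow_nonneg[of _ _ UNIV] simp: closed_under_def)
  finally have "real (card ?A) * exp (-4) ^ s \<le> (\<Sum>x\<in>{1..L}. (?P ^^ s) (\<lambda>\<zeta>. of_bool (\<zeta> x = 0)) \<zeta>)" .
  moreover have "real L / 2 * exp (-4) ^ s \<le> real (card ?A) * exp (-4) ^ s"
    using big by (intro mult_right_mono) auto
  ultimately have "(1 / real L) * (real L / 2 * exp (-4) ^ s)
      \<le> (1 / real L) * (\<Sum>x\<in>{1..L}. (?P ^^ s) (\<lambda>\<zeta>. of_bool (\<zeta> x = 0)) \<zeta>)"
    by (intro mult_left_mono order_trans[OF \<open>real L / 2 * _ \<le> _\<close>]) simp_all
  moreover have "(1 / real L) * (real L / 2 * exp (-4) ^ s) = exp (-4) ^ s / 2" using L0 by simp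
  ultimately show ?thesis
    unfolding e trans_op_pow_cmult trans_op_pow_sum by (simp only:)
qed

section \<open>Drift over a block of steps\<close>

text \<open>
  The contraction factor of one step depends on the random proportion \<open>z\<close> of empty sites, whose
  mean is bounded below only after \<open>T\<close> steps, and \<open>z\<close> may be correlated with \<open>f\<close>. As \<open>f\<close> loses at
  most the factor \<open>e\<close> per step, the gain \<open>z * f\<close> in the last step of a block is at least
  \<open>e ^ T * z\<close> times the initial value of \<open>f\<close>, and only the mean of \<open>z\<close> matters.
\<close>

lemma block_drift:
  fixes f z h :: "'s \<Rightarrow> real"
  assumes cl: "closed_under L \<phi> S"
    and f0: "\<And>s. s \<in> S \<Longrightarrow> 0 \<le> f s" and z01: "\<And>s. s \<in> S \<Longrightarrow> 0 \<le> z s"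
    and h0: "\<And>s. s \<in> S \<Longrightarrow> 0 \<le> h s"
    and step: "\<And>s. s \<in> S \<Longrightarrow> trans_op L \<phi> f s \<le> \<gamma> * (1 - \<kappa> * z s) * f s + h s"
    and slow: "\<And>u s. u \<in> choices L \<Longrightarrow> s \<in> S \<Longrightarrow> e * f s \<le> f (\<phi> u s)"
    and mz: "\<And>s. s \<in> S \<Longrightarrow> p \<le> (trans_op L \<phi> ^^ T) z s"
    and hA: "\<And>s. s \<in> S \<Longrightarrow> trans_op L \<phi> h s \<le> A * h s"
    and pos: "1 \<le> \<gamma>" "\<gamma> \<le> A" "0 \<le> \<kappa>" "0 \<le> e"
    and s: "s \<in> S"
  shows "(trans_op L \<phi> ^^ Suc T) f s \<le> (\<gamma> ^ Suc T - \<gamma> * \<kappa> * e ^ T * p) * f s + real (Suc T) * A ^ Suc T * h s"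
proof -
  let ?Q = "trans_op L \<phi>"
  have A1: "1 \<le> A" using pos by simp
  have step': "?Q f s \<le> \<gamma> * f s + h s" if "s \<in> S" for s
  proof -
    have "0 \<le> \<gamma> * (\<kappa> * z s) * f s" using pos z01[OF that] f0[OF that] by simp
    then show ?thesis using step[OF that] by (simp add: algebra_simps)
  qed
  have Qh: "(?Q ^^ n) h s \<le> A ^ n * h s" if "s \<in> S" for n s
  proof (induction n)
    case (Suc n)
    have "(?Q ^^ Suc n) h s = (?Q ^^ n) (?Q h) s" by (simp add: funpow_swap1)
    also have "\<dots> \<le> (?Q ^^ n) (\<lambda>s. A * h s) s"
      by (rule trans_op_pow_mono[OF cl that hA])
    also have "\<dots> = A * (?Q ^^ n) h s" by (simp add: trans_op_pow_cmult)
    also have "\<dots> \<le> A * (A ^ n * h s)" using Suc A1 by (intro mult_left_mono) auto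
    finally show ?case by (simp add: mult.assoc)
  qed simp
  have Qf: "(?Q ^^ n) f s \<le> \<gamma> ^ n * f s + real n * A ^ n * h s" if s: "s \<in> S" for n s
  proof (induction n)
    case (Suc n)
    have "(?Q ^^ Suc n) f s = (?Q ^^ n) (?Q f) s" by (simp add: funpow_swap1)
    also have "\<dots> \<le> (?Q ^^ n) (\<lambda>s. \<gamma> * f s + h s) s"
      by (rule trans_op_pow_mono[OF cl s step'])
    also have "\<dots> = \<gamma> * (?Q ^^ n) f s + (?Q ^^ n) h s" by (simp add: trans_op_pow_cmult trans_op_pow_add)
    also have "\<dots> \<le> \<gamma> * (\<gamma> ^ n * f s + real n * A ^ n * h s) + A ^ n * h s"
      using Suc pos Qh[OF s] by (intro add_mono mult_left_mono) auto
    also have "\<dots> \<le> \<gamma> ^ Suc n * f s + (A * (real n * A ^ n * h s) + A * (A ^ n * h s))"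
    proof -
      have "\<gamma> * (real n * A ^ n * h s) \<le> A * (real n * A ^ n * h s)"
        using pos A1 h0[OF s] by (intro mult_right_mono) auto
      moreover have "1 * (A ^ n * h s) \<le> A * (A ^ n * h s)"
        using A1 h0[OF s] by (intro mult_right_mono) auto
      ultimately show ?thesis by (simp add: distrib_left mult.assoc)
    qed
    also have "\<dots> = \<gamma> ^ Suc n * f s + real (Suc n) * A ^ Suc n * h s" by (simp add: algebra_simps)
    finally show ?case .
  qed simp
  have Qz: "e ^ n * f s * (?Q ^^ n) z s \<le> (?Q ^^ n) (\<lambda>s. z s * f s) s" if "s \<in> S" for n s
    using that
  proof (induction n arbitrary: s)
    case 0 then show ?case by (simp add: mult.commute)
  next
    case (Suc n)
    have "e ^ Suc n * f s * (?Q ^^ Suc n) z s = avg L (\<lambda>u. e ^ Suc n * f s * (?Q ^^ n) z (\<phi> u s))"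
      by (simp only: trans_op_pow_Suc avg_cmult)
    also have "\<dots> \<le> avg L (\<lambda>u. (?Q ^^ n) (\<lambda>s. z s * f s) (\<phi> u s))"
    proof (rule avg_mono)
      fix u assume u: "u \<in> choices L"
      have m: "\<phi> u s \<in> S" by (rule closed_underD[OF cl u Suc.prems])
      have "e ^ Suc n * f s * (?Q ^^ n) z (\<phi> u s) = e ^ n * (e * f s) * (?Q ^^ n) z (\<phi> u s)" by simp
      also have "\<dots> \<le> e ^ n * f (\<phi> u s) * (?Q ^^ n) z (\<phi> u s)"
        using slow[OF u Suc.prems] pos
        by (intro mult_right_mono mult_left_mono trans_op_pow_nonneg[OF cl m z01]) auto
      also have "\<dots> \<le> (?Q ^^ n) (\<lambda>s. z s * f s) (\<phi> u s)" by (rule Suc.IH[OF m])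
      finally show "e ^ Suc n * f s * (?Q ^^ n) z (\<phi> u s) \<le> (?Q ^^ n) (\<lambda>s. z s * f s) (\<phi> u s)" .
    qed
    also have "\<dots> = (?Q ^^ Suc n) (\<lambda>s. z s * f s) s" by (rule trans_op_pow_Suc[symmetric])
    finally show ?case .
  qed
  have "(?Q ^^ Suc T) f s = (?Q ^^ T) (?Q f) s" by (simp add: funpow_swap1)
  also have "\<dots> \<le> (?Q ^^ T) (\<lambda>s. \<gamma> * f s + (h s - \<gamma> * \<kappa> * (z s * f s))) s"
    by (rule trans_op_pow_mono[OF cl s]) (use step in \<open>simp add: algebra_simps\<close>)
  also have "\<dots> = \<gamma> * (?Q ^^ T) f s + ((?Q ^^ T) h s - \<gamma> * \<kappa> * (?Q ^^ T) (\<lambda>s. z s * f s) s)"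
    by (simp only: trans_op_pow_add trans_op_pow_diff trans_op_pow_cmult)
  also have "\<dots> \<le> \<gamma> * (\<gamma> ^ T * f s + real T * A ^ T * h s) + (A ^ T * h s - \<gamma> * \<kappa> * (e ^ T * f s * p))"
  proof -
    have "e ^ T * f s * p \<le> e ^ T * f s * (?Q ^^ T) z s"
      using mz[OF s] f0[OF s] pos by (intro mult_left_mono) auto
    also note Qz[OF s]
    finally have "\<gamma> * \<kappa> * (e ^ T * f s * p) \<le> \<gamma> * \<kappa> * (?Q ^^ T) (\<lambda>s. z s * f s) s"
      using pos by (intro mult_left_mono) auto
    moreover have "\<gamma> * (?Q ^^ T) f s \<le> \<gamma> * (\<gamma> ^ T * f s + real T * A ^ T * h s)"
      using Qf[OF s] pos by (intro mult_left_mono) auto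
    ultimately show ?thesis using Qh[OF s, of T] by linarith
  qed
  also have "\<dots> \<le> (\<gamma> ^ Suc T - \<gamma> * \<kappa> * e ^ T * p) * f s + real (Suc T) * A ^ Suc T * h s"
  proof -
    have "\<gamma> * (real T * A ^ T * h s) \<le> A * (real T * A ^ T * h s)"
      using pos A1 h0[OF s] by (intro mult_right_mono) auto
    moreover have "1 * (A ^ T * h s) \<le> A * (A ^ T * h s)"
      using A1 h0[OF s] by (intro mult_right_mono) auto
    ultimately show ?thesis by (simp add: algebra_simps)
  qed
  finally show ?thesis .
qed

lemma iterated_drift:
  assumes cl: "closed_under L \<phi> S" and l: "0 \<le> \<rho>" "\<rho> < 1" and D: "0 \<le> D"
    and d: "\<And>s. s \<in> S \<Longrightarrow> (trans_op L \<phi> ^^ t) V s \<le> \<rho> * V s + D"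
    and s: "s \<in> S"
  shows "(trans_op L \<phi> ^^ (t * m)) V s \<le> \<rho> ^ m * V s + D / (1 - \<rho>)"
proof (induction m)
  case 0
  then show ?case using l D by simp
next
  case (Suc m)
  let ?Q = "trans_op L \<phi>"
  have "(?Q ^^ (t * Suc m)) V s = (?Q ^^ (t * m)) ((?Q ^^ t) V) s"
    by (simp only: mult_Suc_right add.commute[of t] funpow_add o_apply)
  also have "\<dots> \<le> (?Q ^^ (t * m)) (\<lambda>s. \<rho> * V s + D) s"
    by (rule trans_op_pow_mono[OF cl s d])
  also have "\<dots> = \<rho> * (?Q ^^ (t * m)) V s + D"
    by (simp only: trans_op_pow_add trans_op_pow_cmult trans_op_pow_const)
  also have "\<dots> \<le> \<rho> * (\<rho> ^ m * V s + D / (1 - \<rho>)) + D"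
    using Suc l by (intro add_right_mono mult_left_mono) auto
  also have "\<dots> = \<rho> ^ Suc m * V s + D / (1 - \<rho>)"
    using l by (simp add: field_simps)
  finally show ?case .
qed

text \<open>
  A rate below one exists because the loss \<open>exp (\<theta>\<^sup>2) ^ T\<close> of a block is quadratic in \<open>\<theta>\<close>
  and the gain is linear.
\<close>

lemma exists_block_rate:
  fixes p :: real
  assumes p: "0 < p" "p \<le> 1"
  shows "\<exists>\<theta> \<rho>. 0 < \<theta> \<and> \<theta> \<le> 1 \<and> 0 < \<rho> \<and> \<rho> < 1 \<and>
    exp (\<theta>\<^sup>2) ^ Suc T - exp (\<theta>\<^sup>2) * (\<theta> / 2) * exp (-\<theta>) ^ T * p \<le> \<rho>"
proof -
  define \<theta> where "\<theta> = p / (16 * real (Suc T))"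
  have T: "real (Suc T) \<ge> 1" by simp
  have t: "0 < \<theta>" "\<theta> \<le> 1 / 16"
    using p T unfolding \<theta>_def by (auto simp: field_simps intro: order_trans[of p 1])
  have tT: "real (Suc T) * \<theta> = p / 16" unfolding \<theta>_def by (simp add: field_simps)
  let ?x = "real (Suc T) * \<theta>\<^sup>2"
  have x: "?x = p / 16 * \<theta>" using tT by (simp add: power2_eq_square mult.assoc[symmetric])
  have x1: "0 \<le> ?x" "?x \<le> 1"
    using mult_mono[of "p/16" 1 \<theta> 1] p t unfolding x by auto
  have "exp (\<theta>\<^sup>2) ^ Suc T = exp ?x" by (simp only: exp_of_nat_mult)
  also have "\<dots> \<le> 1 + ?x + ?x\<^sup>2" by (rule exp_bound[OF x1])
  also have "\<dots> \<le> 1 + 2 * ?x" using mult_left_mono[OF x1(2) x1(1)] by (simp add: power2_eq_square)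
  finally have 1: "exp (\<theta>\<^sup>2) ^ Suc T \<le> 1 + p * \<theta> / 8" unfolding x by (simp add: mult.commute)
  have "1 / 2 \<le> 1 + real T * (- \<theta>)"
    using tT p t by (simp add: algebra_simps)
  also have "\<dots> \<le> exp (real T * (- \<theta>))" by (rule exp_ge_add_one_self)
  also have "\<dots> = exp (-\<theta>) ^ T" by (simp only: exp_of_nat_mult)
  finally have 2: "1 / 2 \<le> exp (-\<theta>) ^ T" .
  have "1 * (\<theta> / 2) * (1 / 2) * p \<le> exp (\<theta>\<^sup>2) * (\<theta> / 2) * exp (-\<theta>) ^ T * p"
    using t p 2 by (intro mult_mono) auto
  then have "exp (\<theta>\<^sup>2) ^ Suc T - exp (\<theta>\<^sup>2) * (\<theta> / 2) * exp (-\<theta>) ^ T * p \<le> 1 - p * \<theta> / 8"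
    using 1 by (simp add: algebra_simps)
  moreover have "p * \<theta> \<le> 1 * 1" using p t by (intro mult_mono) auto
  ultimately show ?thesis using p t by (intro exI[of _ \<theta>] exI[of _ "1 - p * \<theta> / 8"]) auto
qed

definition pair_exp :: "real \<Rightarrow> pairstate \<Rightarrow> real" where
  "pair_exp \<theta> s = exp (\<theta> * real (fst s (fst (snd s)))) + exp (\<theta> * real (fst s (snd (snd s))))"

lemma fst_move: "fst (move L u s) = rbb_update L u (fst s)"
  by (cases s) (simp add: move_def)

lemma trans_op_pow_fst:
  assumes "s \<in> pairs L N"
  shows "(trans_op L (move L) ^^ n) (\<lambda>s. f (fst s)) s = (trans_op L (rbb_update L) ^^ n) f (fst s)"
  by (rule trans_op_pow_project[OF closed_move _ assms]) (simp add: fst_move)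

text \<open>
  Parameters of the Lyapunov functions: blocks have \<open>Suc T\<close> steps, loads are weighted by
  \<open>exp (\<theta> * load)\<close>, and \<open>rate\<close> is the factor that the block drift yields for these weights.
\<close>

locale block_rate =
  fixes r \<theta> \<rho> :: real and T :: nat
  assumes r: "0 < r" and T: "2 * r \<le> real T" and \<theta>: "0 < \<theta>" "\<theta> \<le> 1" and \<rho>: "0 < \<rho>" "\<rho> < 1"
    and rate: "exp (\<theta>\<^sup>2) ^ Suc T - exp (\<theta>\<^sup>2) * (\<theta> / 2) * exp (-\<theta>) ^ T * (exp (-4) ^ T / 2) \<le> \<rho>"
begin

definition block_const :: real where
  "block_const = real (Suc T) * 4 ^ Suc T * exp 2"

lemma block_const_pos: "block_const > 0"
  unfolding block_const_def by simp

lemma exp1: "exp (1::real) \<le> 3"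
  by (rule exp_le)

lemma gamma: "1 \<le> exp (\<theta>\<^sup>2)" "exp (\<theta>\<^sup>2) \<le> exp 1" "exp (\<theta>\<^sup>2) \<le> 4"
proof -
  show "1 \<le> exp (\<theta>\<^sup>2)" by simp
  show g: "exp (\<theta>\<^sup>2) \<le> exp 1" using \<theta> by (simp add: power_le_one)
  show "exp (\<theta>\<^sup>2) \<le> 4" using g exp1 by linarith
qed

lemma step_factor_le: "exp (\<theta>\<^sup>2) * (1 - \<theta> / 2 * emp L \<zeta>) \<le> exp 1"
proof -
  have "exp (\<theta>\<^sup>2) * (1 - \<theta> / 2 * emp L \<zeta>) \<le> exp 1 * 1"
    using gamma \<theta> emp_range[of L \<zeta>] mult_mono[of "\<theta>/2" 1 "emp L \<zeta>" 1] by (intro mult_mono) auto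
  then show ?thesis by simp
qed

lemma step_factor_nonneg: "0 \<le> exp (\<theta>\<^sup>2) * (1 - \<theta> / 2 * emp L \<zeta>)"
  using \<theta> emp_range[of L \<zeta>] mult_mono[of "\<theta>/2" 1 "emp L \<zeta>" 1] by (intro mult_nonneg_nonneg) auto

lemma mean_exp_step:
  assumes "L \<ge> 1"
  shows "avg L (\<lambda>u. mean_exp \<theta> L (rbb_update L u \<zeta>)) \<le> exp 1 * mean_exp \<theta> L \<zeta> + exp 2"
  using one_step_mean_exp[OF assms, of \<theta> \<zeta>] \<theta>
    mult_right_mono[OF step_factor_le mean_exp_nonneg, of L \<zeta> \<theta> L \<zeta>] by linarith

lemma particles_bound: "real N \<le> r * real L \<Longrightarrow> 2 * N \<le> T * L"
proof -
  assume "real N \<le> r * real L"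
  moreover have "2 * r * real L \<le> real T * real L" using T by (intro mult_right_mono) auto
  ultimately have "real (2 * N) \<le> real (T * L)" by simp
  then show "2 * N \<le> T * L" by linarith
qed

lemma mean_exp_block:
  assumes L: "L \<ge> 4" and N: "real N \<le> r * real L" and z: "\<zeta> \<in> confs L N"
  shows "(trans_op L (rbb_update L) ^^ Suc T) (mean_exp \<theta> L) \<zeta> \<le> \<rho> * mean_exp \<theta> L \<zeta> + block_const"
proof -
  have L1: "L \<ge> 1" using L by simp
  have "(trans_op L (rbb_update L) ^^ Suc T) (mean_exp \<theta> L) \<zeta>
    \<le> (exp (\<theta>\<^sup>2) ^ Suc T - exp (\<theta>\<^sup>2) * (\<theta> / 2) * exp (-\<theta>) ^ T * (exp (-4) ^ T / 2)) * mean_exp \<theta> L \<zeta>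
      + real (Suc T) * 4 ^ Suc T * exp 2"
  proof (rule block_drift[OF closed_update[where N = N], where z = "emp L"])
    fix \<zeta> assume z: "\<zeta> \<in> confs L N"
    show "0 \<le> mean_exp \<theta> L \<zeta>" by (rule mean_exp_nonneg)
    show "0 \<le> emp L \<zeta>" by (rule emp_range)
    show "trans_op L (rbb_update L) (mean_exp \<theta> L) \<zeta>
      \<le> exp (\<theta>\<^sup>2) * (1 - \<theta> / 2 * emp L \<zeta>) * mean_exp \<theta> L \<zeta> + exp 2"
      unfolding trans_op_def using \<theta> by (intro one_step_mean_exp L1) auto
    show "exp (-4) ^ T / 2 \<le> (trans_op L (rbb_update L) ^^ T) (emp L) \<zeta>"
      by (rule mean_empty[OF L z particles_bound[OF N]])
    show "exp (-\<theta>) * mean_exp \<theta> L \<zeta> \<le> mean_exp \<theta> L (rbb_update L u \<zeta>)" for u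
    proof -
      have "exp (-\<theta>) * exp (\<theta> * real (\<zeta> x)) \<le> exp (\<theta> * real (rbb_update L u \<zeta> x))" if "x \<in> {1..L}" for x
      proof -
        have "real (\<zeta> x) \<le> real (rbb_update L u \<zeta> x) + 1" using update_ge[OF that, of \<zeta> u] by linarith
        from mult_left_mono[OF this, of \<theta>] show ?thesis
          using \<theta> by (simp add: exp_add[symmetric] algebra_simps)
      qed
      then show ?thesis
        unfolding mean_exp_def times_divide_eq_right sum_distrib_left
        by (intro divide_right_mono sum_mono) auto
    qed
  qed (use z gamma \<theta> in auto)
  also have "\<dots> \<le> \<rho> * mean_exp \<theta> L \<zeta> + block_const"
    unfolding block_const_def using rate mean_exp_nonneg by (intro add_right_mono mult_right_mono) auto
  finally show ?thesis .
qed

lemma pair_exp_one_particle: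
  assumes L: "L \<ge> 1" and a: "a \<in> {1..L}" and c: "c \<in> {1..L}" "\<zeta> a = 0 \<Longrightarrow> \<zeta> c = 0"
  shows "avg L (\<lambda>u. exp (\<theta> * real (rbb_update L u \<zeta> (if \<zeta> a = 0 then u c else a))))
    \<le> exp (\<theta>\<^sup>2) * (1 - \<theta> / 2 * emp L \<zeta>) * exp (\<theta> * real (\<zeta> a)) + (exp 1 * mean_exp \<theta> L \<zeta> + exp 2)"
proof (cases "\<zeta> a = 0")
  case True
  then show ?thesis
    using one_step_jump[OF L _ _ c(1), of \<theta> \<zeta>] c(2) \<theta> step_factor_nonneg[of L \<zeta>] by simp
next
  case False
  moreover have "0 \<le> exp 1 * mean_exp \<theta> L \<zeta>" using mean_exp_nonneg by simp
  ultimately show ?thesis using one_step_site[OF L a, of \<theta> \<zeta>] \<theta> by simp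
qed

lemma pair_exp_block:
  assumes L: "L \<ge> 4" and N: "real N \<le> r * real L" and s: "s \<in> pairs L N"
  shows "(trans_op L (move L) ^^ Suc T) (pair_exp \<theta>) s
    \<le> \<rho> * pair_exp \<theta> s + 2 * block_const * (3 * mean_exp \<theta> L (fst s) + 1)"
proof -
  have L1: "L \<ge> 1" using L by simp
  let ?h = "\<lambda>s. 2 * (exp 1 * mean_exp \<theta> L (fst s) + exp 2)"
  have pos: "0 \<le> pair_exp \<theta> s" for s by (simp add: pair_exp_def)
  have "(trans_op L (move L) ^^ Suc T) (pair_exp \<theta>) s
    \<le> (exp (\<theta>\<^sup>2) ^ Suc T - exp (\<theta>\<^sup>2) * (\<theta> / 2) * exp (-\<theta>) ^ T * (exp (-4) ^ T / 2)) * pair_exp \<theta> s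
      + real (Suc T) * 4 ^ Suc T * ?h s"
  proof (rule block_drift[OF closed_move[where N = N], where z = "\<lambda>s. emp L (fst s)"])
    fix s assume s: "s \<in> pairs L N"
    obtain \<zeta> a b where seq: "s = (\<zeta>, a, b)" by (cases s) auto
    have ab: "\<zeta> \<in> confs L N" "a \<in> {1..L}" "b \<in> {1..L}" using s unfolding seq pairs_def by auto
    show "0 \<le> pair_exp \<theta> s" by (rule pos)
    show "0 \<le> emp L (fst s)" by (rule emp_range)
    show "0 \<le> ?h s" using mean_exp_nonneg by simp
    let ?c = "if \<zeta> b = 0 then min a b else a" and ?d = "if \<zeta> a = 0 then min a b else b"
    have c: "?c \<in> {1..L}" "\<zeta> a = 0 \<Longrightarrow> \<zeta> ?c = 0" "?d \<in> {1..L}" "\<zeta> b = 0 \<Longrightarrow> \<zeta> ?d = 0"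
      using ab by (auto simp: min_def)
    have "trans_op L (move L) (pair_exp \<theta>) s
        = avg L (\<lambda>u. exp (\<theta> * real (rbb_update L u \<zeta> (if \<zeta> a = 0 then u ?c else a))))
        + avg L (\<lambda>u. exp (\<theta> * real (rbb_update L u \<zeta> (if \<zeta> b = 0 then u ?d else b))))"
      unfolding trans_op_def avg_add[symmetric] by (simp add: pair_exp_def seq move_def)
    also have "\<dots> \<le> (exp (\<theta>\<^sup>2) * (1 - \<theta> / 2 * emp L \<zeta>) * exp (\<theta> * real (\<zeta> a)) + (exp 1 * mean_exp \<theta> L \<zeta> + exp 2))
      + (exp (\<theta>\<^sup>2) * (1 - \<theta> / 2 * emp L \<zeta>) * exp (\<theta> * real (\<zeta> b)) + (exp 1 * mean_exp \<theta> L \<zeta> + exp 2))"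
      by (intro add_mono pair_exp_one_particle L1 ab c)
    also have "\<dots> = exp (\<theta>\<^sup>2) * (1 - \<theta> / 2 * emp L (fst s)) * pair_exp \<theta> s + ?h s"
      by (simp add: seq pair_exp_def algebra_simps)
    finally show "trans_op L (move L) (pair_exp \<theta>) s
      \<le> exp (\<theta>\<^sup>2) * (1 - \<theta> / 2 * emp L (fst s)) * pair_exp \<theta> s + ?h s" .
    show "exp (-4) ^ T / 2 \<le> (trans_op L (move L) ^^ T) (\<lambda>s. emp L (fst s)) s"
      unfolding trans_op_pow_fst[OF s] using mean_empty[OF L ab(1) particles_bound[OF N]] by (simp add: seq)
    have "trans_op L (move L) ?h s = 2 * (exp 1 * avg L (\<lambda>u. mean_exp \<theta> L (rbb_update L u \<zeta>)) + exp 2)"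
      by (simp add: trans_op_def fst_move avg_add avg_cmult seq)
    also have "\<dots> \<le> 2 * (exp 1 * (exp 1 * mean_exp \<theta> L \<zeta> + exp 2) + exp 2)"
      using mean_exp_step[OF L1, of \<zeta>] by (intro mult_left_mono add_right_mono) auto
    also have "\<dots> \<le> 2 * (3 * (exp 1 * mean_exp \<theta> L \<zeta> + exp 2) + exp 2)"
      using exp1 mean_exp_nonneg[of \<theta> L \<zeta>] by (intro mult_left_mono add_right_mono mult_right_mono) auto
    also have "\<dots> \<le> 4 * ?h s"
      using mean_exp_nonneg[of \<theta> L \<zeta>] by (simp add: seq)
    finally show "trans_op L (move L) ?h s \<le> 4 * ?h s" .
    show "exp (-\<theta>) * pair_exp \<theta> s \<le> pair_exp \<theta> (move L u s)" if u: "u \<in> choices L" for u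
    proof -
      have one: "exp (-\<theta>) * exp (\<theta> * real (\<zeta> x)) \<le> exp (\<theta> * real (rbb_update L u \<zeta> (if \<zeta> x = 0 then y else x)))"
        if x: "x \<in> {1..L}" for x y
      proof (cases "\<zeta> x = 0")
        case True
        have "exp (-\<theta>) \<le> 1" using \<theta> by simp
        also have "1 \<le> exp (\<theta> * real (rbb_update L u \<zeta> y))" using \<theta> by simp
        finally show ?thesis using True by simp
      next
        case False
        have "real (\<zeta> x) \<le> real (rbb_update L u \<zeta> x) + 1" using update_ge[OF x, of \<zeta> u] by linarith
        from mult_left_mono[OF this, of \<theta>] show ?thesis
          using \<theta> False by (simp add: exp_add[symmetric] algebra_simps)
      qed
      show ?thesis
        using add_mono[OF one[OF ab(2), of "u ?c"] one[OF ab(3), of "u ?d"]]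
        by (simp add: pair_exp_def seq move_def distrib_left)
    qed
  qed (use s gamma \<theta> in auto)
  also have "\<dots> \<le> \<rho> * pair_exp \<theta> s + 2 * block_const * (3 * mean_exp \<theta> L (fst s) + 1)"
  proof (intro add_mono mult_right_mono rate pos)
    have "?h s \<le> 2 * (exp 2 * (3 * mean_exp \<theta> L (fst s) + 1))"
    proof -
      have "exp (1::real) \<le> exp 2 * 3" by (rule order_trans[of _ "exp 2"]) simp_all
      from mult_right_mono[OF this mean_exp_nonneg[of \<theta> L "fst s"]]
      show ?thesis by (simp add: algebra_simps)
    qed
    then have "real (Suc T) * 4 ^ Suc T * ?h s
      \<le> real (Suc T) * 4 ^ Suc T * (2 * (exp 2 * (3 * mean_exp \<theta> L (fst s) + 1)))"
      by (intro mult_left_mono) auto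
    then show "real (Suc T) * 4 ^ Suc T * ?h s \<le> 2 * block_const * (3 * mean_exp \<theta> L (fst s) + 1)"
      by (simp add: block_const_def mult_ac)
  qed
  finally show ?thesis .
qed

text \<open>
  A jump exposes a second class particle to a site of average weight, so the drift of \<open>pair_exp\<close>
  has an error proportional to \<open>mean_exp\<close>. The weight is chosen such that the drift of
  \<open>mean_exp\<close> absorbs it at the cost of replacing the rate \<open>\<rho>\<close> by \<open>(1 + \<rho>) / 2\<close>.
\<close>

definition phi_weight :: real where
  "phi_weight = 12 * block_const / (1 - \<rho>)"

definition lyapunov :: "nat \<Rightarrow> pairstate \<Rightarrow> real" where
  "lyapunov L s = pair_exp \<theta> s + phi_weight * mean_exp \<theta> L (fst s)"

definition drift_const :: real where
  "drift_const = 2 * block_const + phi_weight * block_const"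

lemma phi_weight_pos: "phi_weight > 0"
  unfolding phi_weight_def using block_const_pos \<rho> by simp

lemma drift_const_pos: "drift_const > 0"
  unfolding drift_const_def using block_const_pos phi_weight_pos by (intro add_pos_pos) auto

lemma lyapunov_ge_1: "1 \<le> lyapunov L s"
proof -
  have "1 \<le> exp (\<theta> * real (fst s (fst (snd s))))" using \<theta> by simp
  moreover have "0 \<le> phi_weight * mean_exp \<theta> L (fst s)"
    using phi_weight_pos mean_exp_nonneg by (intro mult_nonneg_nonneg) auto
  ultimately show ?thesis unfolding lyapunov_def pair_exp_def
    by (smt (verit) exp_gt_zero)
qed

lemma lyapunov_block:
  assumes L: "L \<ge> 4" and N: "real N \<le> r * real L" and s: "s \<in> pairs L N"
  shows "(trans_op L (move L) ^^ Suc T) (lyapunov L) s \<le> (1 + \<rho>) / 2 * lyapunov L s + drift_const"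
proof -
  have z: "fst s \<in> confs L N" using s by (auto simp: pairs_def)
  let ?m = "mean_exp \<theta> L (fst s)"
  have l: "lyapunov L = (\<lambda>s. pair_exp \<theta> s + phi_weight * mean_exp \<theta> L (fst s))"
    by (rule ext) (rule lyapunov_def)
  have "(trans_op L (move L) ^^ Suc T) (lyapunov L) s
      = (trans_op L (move L) ^^ Suc T) (pair_exp \<theta>) s
        + phi_weight * (trans_op L (rbb_update L) ^^ Suc T) (mean_exp \<theta> L) (fst s)"
    unfolding l trans_op_pow_add trans_op_pow_cmult trans_op_pow_fst[OF s] ..
  also have "\<dots> \<le> (\<rho> * pair_exp \<theta> s + 2 * block_const * (3 * ?m + 1)) + phi_weight * (\<rho> * ?m + block_const)"
    using phi_weight_pos by (intro add_mono mult_left_mono pair_exp_block[OF L N s] mean_exp_block[OF L N z]) auto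
  also have "\<dots> = \<rho> * pair_exp \<theta> s + (6 * block_const + phi_weight * \<rho>) * ?m + drift_const"
    unfolding drift_const_def by (simp add: algebra_simps)
  also have "6 * block_const + phi_weight * \<rho> = (1 + \<rho>) / 2 * phi_weight"
    unfolding phi_weight_def using \<rho> by (simp add: field_simps)
  also have "\<rho> * pair_exp \<theta> s \<le> (1 + \<rho>) / 2 * pair_exp \<theta> s"
    using \<rho> by (intro mult_right_mono) (auto simp: pair_exp_def)
  finally show ?thesis unfolding lyapunov_def by (simp add: algebra_simps)
qed

end

section \<open>Prescribed arrivals\<close>

text \<open>
  All arrival patterns below are unions of disjoint events of this form: finitely many sites have
  a prescribed target and all others avoid two given sites.
\<close>

lemma prob_prescribed_targets:
  assumes L: "L \<ge> 4" and D: "D \<subseteq> {1..L}" "\<And>y. y \<in> D \<Longrightarrow> h y \<in> {1..L}"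
    and xb: "x \<in> {1..L}" "b \<in> {1..L}" "x \<noteq> b"
  shows "(1 / real L) ^ card D * exp (-4)
    \<le> avg L (\<lambda>u. of_bool ((\<forall>y\<in>D. u y = h y) \<and> (\<forall>y\<in>{1..L} - D. u y \<noteq> x \<and> u y \<noteq> b)))"
proof -
  have L1: "L \<ge> 1" using L by simp
  let ?q = "1 - 2 / real L"
  have q: "0 \<le> ?q" "?q \<le> 1" using L by (auto simp: field_simps)
  let ?f = "\<lambda>y v. of_bool (if y \<in> D then v = h y else v \<noteq> x \<and> v \<noteq> b) :: real"
  have "avg L (\<lambda>u. of_bool ((\<forall>y\<in>D. u y = h y) \<and> (\<forall>y\<in>{1..L} - D. u y \<noteq> x \<and> u y \<noteq> b)))
      = avg L (\<lambda>u. \<Prod>y\<in>{1..L}. ?f y (u y))"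
  proof (rule avg_cong)
    fix u :: "nat \<Rightarrow> nat"
    have e: "(\<forall>y\<in>D. u y = h y) \<and> (\<forall>y\<in>{1..L} - D. u y \<noteq> x \<and> u y \<noteq> b)
        \<longleftrightarrow> (\<forall>y\<in>{1..L}. if y \<in> D then u y = h y else u y \<noteq> x \<and> u y \<noteq> b)"
      using D(1) by auto
    show "of_bool ((\<forall>y\<in>D. u y = h y) \<and> (\<forall>y\<in>{1..L} - D. u y \<noteq> x \<and> u y \<noteq> b)) = (\<Prod>y\<in>{1..L}. ?f y (u y))"
    proof (cases "\<forall>y\<in>{1..L}. if y \<in> D then u y = h y else u y \<noteq> x \<and> u y \<noteq> b")
      case True
      then have "(\<Prod>y\<in>{1..L}. ?f y (u y)) = (\<Prod>y\<in>{1..L}. 1)" by (intro prod.cong refl) simp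
      moreover have "of_bool (\<forall>y\<in>{1..L}. if y \<in> D then u y = h y else u y \<noteq> x \<and> u y \<noteq> b) = (1::real)"
        using True by (rule of_bool_eq_1_iff[THEN iffD2])
      ultimately show ?thesis unfolding e by (simp only: prod.neutral_const)
    next
      case False
      then obtain y where y: "y \<in> {1..L}" "\<not> (if y \<in> D then u y = h y else u y \<noteq> x \<and> u y \<noteq> b)" by blast
      then have "(\<Prod>y\<in>{1..L}. ?f y (u y)) = 0"
        by (intro prod_zero bexI[of _ y]) (simp_all only: of_bool_eq finite_atLeastAtMost)
      moreover have "of_bool (\<forall>y\<in>{1..L}. if y \<in> D then u y = h y else u y \<noteq> x \<and> u y \<noteq> b) = (0::real)"
        using False by (rule of_bool_eq_0_iff[THEN iffD2])
      ultimately show ?thesis unfolding e by (simp only:)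
    qed
  qed
  also have "\<dots> = (\<Prod>y\<in>{1..L}. (\<Sum>v\<in>{1..L}. ?f y v) / real L)"
    by (rule avg_prod[OF L1]) simp
  also have "\<dots> = (\<Prod>y\<in>{1..L}. if y \<in> D then 1 / real L else ?q)"
  proof (rule prod.cong[OF refl])
    fix y assume "y \<in> {1..L}"
    show "(\<Sum>v\<in>{1..L}. ?f y v) / real L = (if y \<in> D then 1 / real L else ?q)"
    proof (cases "y \<in> D")
      case True
      then have "(\<Sum>v\<in>{1..L}. ?f y v) = (\<Sum>v\<in>{1..L}. if v = h y then 1 else 0)"
        by (intro sum.cong) auto
      also have "\<dots> = 1" using D(2)[OF True] by simp
      finally show ?thesis using True by simp
    next
      case False
      then have "(\<Sum>v\<in>{1..L}. ?f y v)
          = (\<Sum>v\<in>{1..L}. 1 - (if v = x then 1 else 0) - (if v = b then 1 else 0))"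
        using xb by (intro sum.cong) auto
      also have "\<dots> = real L - 2" using xb by (simp add: sum_subtractf)
      finally show ?thesis using False L by (simp add: diff_divide_distrib)
    qed
  qed
  also have "\<dots> = (\<Prod>y\<in>{1..L} \<inter> D. 1 / real L) * (\<Prod>y\<in>{1..L} - D. ?q)"
    by (simp add: prod.If_cases Diff_eq)
  also have "\<dots> = (1 / real L) ^ card D * ?q ^ card ({1..L} - D)"
    using D(1) by (simp add: Int_absorb1)
  also have "\<dots> \<ge> (1 / real L) ^ card D * exp (-4)"
  proof (intro mult_left_mono)
    have "exp (-4) \<le> ?q ^ L" by (rule one_minus_power_bound[OF L])
    also have "\<dots> \<le> ?q ^ card ({1..L} - D)"
      using q card_mono[of "{1..L}" "{1..L} - D"] by (intro power_decreasing) auto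
    finally show "exp (-4) \<le> ?q ^ card ({1..L} - D)" .
  qed auto
  finally show ?thesis .
qed

lemma avg_disjoint_events:
  assumes fin: "finite I" and sub: "\<And>i u. i \<in> I \<Longrightarrow> u \<in> choices L \<Longrightarrow> E i u \<Longrightarrow> G u"
    and dis: "\<And>i j u. i \<in> I \<Longrightarrow> j \<in> I \<Longrightarrow> E i u \<Longrightarrow> E j u \<Longrightarrow> i = j"
    and p: "\<And>i. i \<in> I \<Longrightarrow> p \<le> avg L (\<lambda>u. of_bool (E i u))"
  shows "real (card I) * p \<le> avg L (\<lambda>u. of_bool (G u))"
proof -
  have "real (card I) * p = (\<Sum>i\<in>I. p)" by simp
  also have "\<dots> \<le> (\<Sum>i\<in>I. avg L (\<lambda>u. of_bool (E i u)))" by (rule sum_mono[OF p])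
  also have "\<dots> = avg L (\<lambda>u. \<Sum>i\<in>I. of_bool (E i u))" by (simp only: avg_sum)
  also have "\<dots> \<le> avg L (\<lambda>u. of_bool (G u))"
  proof (rule avg_mono)
    fix u assume u: "u \<in> choices L"
    show "(\<Sum>i\<in>I. of_bool (E i u)) \<le> (of_bool (G u) :: real)"
    proof (cases "\<exists>i\<in>I. E i u")
      case True
      then obtain i where i: "i \<in> I" "E i u" by blast
      have "(\<Sum>j\<in>I. of_bool (E j u)) = (\<Sum>j\<in>I. if j = i then 1 else (0::real))"
      proof (rule sum.cong[OF refl])
        fix j assume j: "j \<in> I"
        show "of_bool (E j u) = (if j = i then 1 else (0::real))"
          using i dis[OF i(1) j i(2)] by (cases "E j u") auto
      qed
      also have "\<dots> = 1" using i fin by simp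
      finally show ?thesis using sub[OF i(1) u i(2)] by (simp del: sum_of_bool_eq)
    next
      case False
      then have "(\<Sum>j\<in>I. of_bool (E j u)) = (0::real)" by (intro sum.neutral) auto
      then show ?thesis by (simp del: sum_of_bool_eq)
    qed
  qed
  finally show ?thesis .
qed

lemma update_one_arrival:
  assumes x: "x \<in> {1..L}" and s: "s \<in> {1..L}" "\<zeta> s > 0" "u s = x"
    and o: "\<And>y. y \<in> {1..L} \<Longrightarrow> y \<noteq> s \<Longrightarrow> \<zeta> y > 0 \<Longrightarrow> u y \<noteq> x"
  shows "rbb_update L u \<zeta> x = \<zeta> x - of_bool (\<zeta> x > 0) + 1"
proof -
  have "(\<Sum>y\<in>{1..L}. of_bool (\<zeta> y > 0) * of_bool (u y = x) :: nat)
      = (\<Sum>y\<in>{1..L}. if y = s then 1 else 0)"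
  proof (rule sum.cong[OF refl])
    fix y assume "y \<in> {1..L}"
    then show "(of_bool (\<zeta> y > 0) * of_bool (u y = x) :: nat) = (if y = s then 1 else 0)"
      using s o[of y] by (cases "y = s"; cases "\<zeta> y = 0") auto
  qed
  also have "\<dots> = 1" using s(1) by simp
  finally show ?thesis unfolding rbb_update_def if_P[OF x] by (simp only:)
qed

section \<open>Meeting with positive probability\<close>

context block_rate
begin

definition nonempty :: "nat \<Rightarrow> (nat \<Rightarrow> nat) \<Rightarrow> nat set" where
  "nonempty L \<zeta> = {y\<in>{1..L}. \<zeta> y > 0}"

lemma finite_nonempty [simp]: "finite (nonempty L \<zeta>)"
  unfolding nonempty_def by auto

definition occupied_const :: "real \<Rightarrow> real" where
  "occupied_const R = r\<^sup>2 * \<theta>\<^sup>2 / (8 * R)"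

lemma occupied_const_pos: "0 < R \<Longrightarrow> 0 < occupied_const R"
  unfolding occupied_const_def using r \<theta> by simp

text \<open>By Cauchy--Schwarz, a bounded second moment prevents concentration on few sites.\<close>

lemma card_nonempty:
  assumes L: "L \<ge> 1" and N: "r * real L / 2 \<le> real N" and z: "\<zeta> \<in> confs L N"
    and R: "0 < R" "mean_exp \<theta> L \<zeta> \<le> R"
  shows "occupied_const R * real L \<le> real (card (nonempty L \<zeta>))"
proof -
  have L0: "real L > 0" using L by simp
  let ?W = "real (card (nonempty L \<zeta>))"
  have "real N = (\<Sum>x\<in>{1..L}. real (\<zeta> x) * of_bool (\<zeta> x > 0))"
  proof -
    have "real N = (\<Sum>x\<in>{1..L}. real (\<zeta> x))" using z unfolding confs_def by auto
    also have "\<dots> = (\<Sum>x\<in>{1..L}. real (\<zeta> x) * of_bool (\<zeta> x > 0))" by (rule sum.cong) auto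
    finally show ?thesis .
  qed
  then have "(real N)\<^sup>2 \<le> (\<Sum>x\<in>{1..L}. (real (\<zeta> x))\<^sup>2) * (\<Sum>x\<in>{1..L}. (of_bool (\<zeta> x > 0))\<^sup>2)"
    using Cauchy_Schwarz_ineq_sum[of "\<lambda>x. real (\<zeta> x)" "\<lambda>x. of_bool (\<zeta> x > 0)" "{1..L}"] by simp
  also have "(\<Sum>x\<in>{1..L}. (of_bool (\<zeta> x > 0))\<^sup>2) = ?W"
  proof -
    have "?W = (\<Sum>x\<in>nonempty L \<zeta>. 1)" by simp
    also have "\<dots> = (\<Sum>x\<in>{1..L}. (of_bool (\<zeta> x > 0))\<^sup>2)"
      by (rule sum.mono_neutral_cong_left) (auto simp: nonempty_def)
    finally show ?thesis by simp
  qed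
  also have "(\<Sum>x\<in>{1..L}. (real (\<zeta> x))\<^sup>2) \<le> 2 / \<theta>\<^sup>2 * (real L * R)"
  proof -
    have "(\<Sum>x\<in>{1..L}. (real (\<zeta> x))\<^sup>2) \<le> (\<Sum>x\<in>{1..L}. 2 / \<theta>\<^sup>2 * exp (\<theta> * real (\<zeta> x)))"
    proof (rule sum_mono)
      fix x
      have p: "0 \<le> \<theta> * real (\<zeta> x)" using \<theta> by simp
      have "(\<theta> * real (\<zeta> x))\<^sup>2 / 2 \<le> exp (\<theta> * real (\<zeta> x))"
        using exp_lower_Taylor_quadratic[OF p] p by linarith
      then show "(real (\<zeta> x))\<^sup>2 \<le> 2 / \<theta>\<^sup>2 * exp (\<theta> * real (\<zeta> x))"
        using \<theta> by (simp add: power_mult_distrib field_simps)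
    qed
    also have "\<dots> = 2 / \<theta>\<^sup>2 * (real L * mean_exp \<theta> L \<zeta>)"
      unfolding sum_distrib_left[symmetric] mean_exp_def using L0 by simp
    also have "\<dots> \<le> 2 / \<theta>\<^sup>2 * (real L * R)"
      using R L0 by (intro mult_left_mono) auto
    finally show ?thesis .
  qed
  finally have main: "(real N)\<^sup>2 \<le> 2 / \<theta>\<^sup>2 * (real L * R) * ?W" by (simp add: mult_right_mono)
  have "(r * real L / 2)\<^sup>2 \<le> (real N)\<^sup>2" using N r by (intro power_mono) auto
  with main have "(r * real L / 2)\<^sup>2 \<le> 2 / \<theta>\<^sup>2 * (real L * R) * ?W" by linarith
  then have "real L * (r\<^sup>2 * real L * \<theta>\<^sup>2) \<le> real L * (8 * R * ?W)"
    using \<theta> by (simp add: field_simps power2_eq_square)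
  then have "r\<^sup>2 * real L * \<theta>\<^sup>2 \<le> 8 * R * ?W" using L0 by (simp only: mult_le_cancel_left_pos)
  then show ?thesis unfolding occupied_const_def using R by (simp add: field_simps)
qed

definition typical :: "real \<Rightarrow> nat \<Rightarrow> nat \<Rightarrow> pairstate \<Rightarrow> bool" where
  "typical R L N s \<longleftrightarrow> r * real L / 2 \<le> real N \<and> real N \<le> r * real L \<and>
     s \<in> pairs L N \<and> mean_exp \<theta> L (fst s) \<le> R"

definition pair_loads :: "pairstate \<Rightarrow> nat \<times> nat" where
  "pair_loads s = (fst s (fst (snd s)), fst s (snd (snd s)))"

text \<open>
  Quantifying over all levels \<open>R\<close> makes the property stable under prefixing a step: the bound on
  the mean exponential weight may deteriorate by a constant factor at each step of a strategy.
\<close>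

definition can_meet :: "(nat \<times> nat) set \<Rightarrow> bool" where
  "can_meet D \<longleftrightarrow> (\<forall>R. \<exists>q>0. \<exists>S L0. \<forall>L\<ge>L0. \<forall>N s. typical R L N s \<longrightarrow> pair_loads s \<in> D \<longrightarrow>
     (trans_op L (move L) ^^ S) apart s \<le> 1 - q)"

lemma can_meet_union:
  assumes "can_meet D" "can_meet D'"
  shows "can_meet (D \<union> D')"
  unfolding can_meet_def
proof
  fix R
  obtain q S L0 where 1: "q > 0" "\<And>L N s. L \<ge> L0 \<Longrightarrow> typical R L N s \<Longrightarrow> pair_loads s \<in> D \<Longrightarrow>
     (trans_op L (move L) ^^ S) apart s \<le> 1 - q"
    using assms(1) unfolding can_meet_def by meson
  obtain q' S' L0' where 2: "q' > 0" "\<And>L N s. L \<ge> L0' \<Longrightarrow> typical R L N s \<Longrightarrow> pair_loads s \<in> D' \<Longrightarrow>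
     (trans_op L (move L) ^^ S') apart s \<le> 1 - q'"
    using assms(2) unfolding can_meet_def by meson
  have "(trans_op L (move L) ^^ max S S') apart s \<le> 1 - min q q'"
    if L: "L \<ge> max L0 L0'" and t: "typical R L N s" and D: "pair_loads s \<in> D \<union> D'" for L N s
  proof -
    have s: "s \<in> pairs L N" using t by (simp add: typical_def)
    show ?thesis
    proof (cases "pair_loads s \<in> D")
      case True
      from apart_pow_antimono[OF max.cobounded1[of S S'] s] 1(2)[OF _ t True] L show ?thesis by simp
    next
      case False
      with D have "pair_loads s \<in> D'" by simp
      from apart_pow_antimono[OF max.cobounded2[of S' S] s] 2(2)[OF _ t this] L show ?thesis by simp
    qed
  qed
  moreover have "min q q' > 0" using 1(1) 2(1) by simp
  ultimately show "\<exists>q>0. \<exists>S L0. \<forall>L\<ge>L0. \<forall>N s. typical R L N s \<longrightarrow> pair_loads s \<in> D \<union> D' \<longrightarrow>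
     (trans_op L (move L) ^^ S) apart s \<le> 1 - q" by blast
qed

lemma can_meet_empty: "can_meet {}"
  unfolding can_meet_def by (auto intro!: exI[of _ 1])

lemma can_meet_finite: "finite D \<Longrightarrow> (\<And>d. d \<in> D \<Longrightarrow> can_meet {d}) \<Longrightarrow> can_meet D"
proof (induction D rule: finite_induct)
  case empty show ?case by (rule can_meet_empty)
next
  case (insert d D)
  then have "can_meet ({d} \<union> D)" by (intro can_meet_union) auto
  then show ?case by simp
qed

lemma can_meet_swap:
  assumes "can_meet {(k, m)}"
  shows "can_meet {(m, k)}"
proof -
  have sw: "(trans_op L (move L) ^^ S) apart (swap_pair s) = (trans_op L (move L) ^^ S) apart s"
    if "s \<in> pairs L N" for L S N s
  proof -
    have "(trans_op L (move L) ^^ S) (\<lambda>s. apart (swap_pair s)) s = (trans_op L (move L) ^^ S) apart (swap_pair s)"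
      by (rule trans_op_pow_project[OF closed_move _ that]) (simp add: move_swap)
    moreover have "(\<lambda>s. apart (swap_pair s)) = apart"
      by (rule ext) (auto simp: apart_def swap_pair_def)
    ultimately show ?thesis by simp
  qed
  have t: "typical R L N s \<Longrightarrow> typical R L N (swap_pair s)" for R L N s
    by (auto simp: typical_def swap_pair_in) (simp add: swap_pair_def)
  have l: "pair_loads s \<in> {(m, k)} \<Longrightarrow> pair_loads (swap_pair s) \<in> {(k, m)}" for s
    by (auto simp: pair_loads_def swap_pair_def)
  show ?thesis
    unfolding can_meet_def
  proof
    fix R
    obtain q S L0 where 1: "q > 0" "\<And>L N s. L \<ge> L0 \<Longrightarrow> typical R L N s \<Longrightarrow> pair_loads s \<in> {(k, m)} \<Longrightarrow>
       (trans_op L (move L) ^^ S) apart s \<le> 1 - q"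
      using assms unfolding can_meet_def by meson
    have "(trans_op L (move L) ^^ S) apart s \<le> 1 - q"
      if "L \<ge> L0" "typical R L N s" "pair_loads s \<in> {(m, k)}" for L N s
    proof -
      have "s \<in> pairs L N" using that(2) by (simp add: typical_def)
      from sw[OF this, of S] 1(2)[OF that(1) t[OF that(2)] l[OF that(3)]] show ?thesis by simp
    qed
    then show "\<exists>q>0. \<exists>S L0. \<forall>L\<ge>L0. \<forall>N s. typical R L N s \<longrightarrow> pair_loads s \<in> {(m, k)} \<longrightarrow>
       (trans_op L (move L) ^^ S) apart s \<le> 1 - q"
      using 1(1) by blast
  qed
qed

text \<open>
  Typicality survives a step that is conditioned on an event of probability at least \<open>q\<close>,
  by Markov's inequality at a level inversely proportional to \<open>q\<close>.
\<close>

lemma can_meet_step: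
  assumes D': "can_meet D'"
    and st: "\<And>R. R > 0 \<Longrightarrow> \<exists>q>0. \<exists>L0. \<forall>L\<ge>L0. \<forall>N s. typical R L N s \<longrightarrow> pair_loads s \<in> D \<longrightarrow> apart s = 1 \<longrightarrow>
       q \<le> avg L (\<lambda>u. of_bool (pair_loads (move L u s) \<in> D'))"
  shows "can_meet D"
proof -
  have "\<exists>q>0. \<exists>S L0. \<forall>L\<ge>L0. \<forall>N s. typical R L N s \<longrightarrow> pair_loads s \<in> D \<longrightarrow>
     (trans_op L (move L) ^^ S) apart s \<le> 1 - q" for R0 R
  proof -
    define R1 where "R1 = max R 1"
    have R1: "R1 > 0" "R \<le> R1" unfolding R1_def by auto
    obtain q L0 where 1: "q > 0" "\<And>L N s. L \<ge> L0 \<Longrightarrow> typical R1 L N s \<Longrightarrow> pair_loads s \<in> D \<Longrightarrow> apart s = 1 \<Longrightarrow>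
       q \<le> avg L (\<lambda>u. of_bool (pair_loads (move L u s) \<in> D'))"
      using st[OF R1(1)] by meson
    define R' where "R' = 2 * (exp 1 * R1 + exp 2) / q"
    have R': "R' > 0" unfolding R'_def using 1(1) R1 by (intro divide_pos_pos mult_pos_pos add_pos_pos) auto
    obtain q' S L0' where 2: "q' > 0" "\<And>L N s. L \<ge> L0' \<Longrightarrow> typical R' L N s \<Longrightarrow> pair_loads s \<in> D' \<Longrightarrow>
       (trans_op L (move L) ^^ S) apart s \<le> 1 - q'"
      using D' unfolding can_meet_def by meson
    define p where "p = min 1 (q' * (q / 2))"
    have p: "p > 0" "p \<le> 1" "p \<le> q' * (q / 2)" unfolding p_def using 1(1) 2(1) by auto
    have "(trans_op L (move L) ^^ Suc S) apart s \<le> 1 - p"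
      if L: "L \<ge> max 1 (max L0 L0')" and t: "typical R L N s" and sD: "pair_loads s \<in> D" for L N s
    proof (cases "apart s = 1")
      case False
      then have a0: "apart s = 0" by (simp add: apart_def split: if_splits)
      have "s \<in> pairs L N" using t by (simp add: typical_def)
      from apart_pow_antimono[OF _ this, of 0 "Suc S"] a0 p show ?thesis by simp
    next
      case True
      have Ls: "L \<ge> 1" "L \<ge> L0" "L \<ge> L0'" using L by auto
      have t1: "typical R1 L N s" using t R1 by (simp add: typical_def)
      have s: "s \<in> pairs L N" using t by (simp add: typical_def)
      let ?M = "\<lambda>u. mean_exp \<theta> L (rbb_update L u (fst s))"
      have pt: "(trans_op L (move L) ^^ S) apart (move L u s)
          \<le> 1 + (q' / R' * ?M u - q' * of_bool (pair_loads (move L u s) \<in> D'))" if u: "u \<in> choices L" for u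
      proof -
        have m: "move L u s \<in> pairs L N" by (rule closed_underD[OF closed_move u s])
        have le1: "(trans_op L (move L) ^^ S) apart (move L u s) \<le> 1"
          using apart_pow_antimono[OF _ m, of 0 S] apart_range(2)[of "move L u s"] by simp
        have M0: "0 \<le> q' / R' * ?M u" using 2(1) R' mean_exp_nonneg by simp
        show ?thesis
        proof (cases "pair_loads (move L u s) \<in> D'")
          case False
          then show ?thesis using le1 M0 by simp
        next
          case in': True
          show ?thesis
          proof (cases "?M u \<le> R'")
            case True
            then have "typical R' L N (move L u s)" using t m by (simp add: typical_def fst_move)
            from 2(2)[OF Ls(3) this in'] show ?thesis using in' M0 by simp
          next
            case False
            then have "q' \<le> q' / R' * ?M u" using R' 2(1) by (simp add: field_simps)
            then show ?thesis using in' le1 by simp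
          qed
        qed
      qed
      have "(trans_op L (move L) ^^ Suc S) apart s = avg L (\<lambda>u. (trans_op L (move L) ^^ S) apart (move L u s))"
        by (rule trans_op_pow_Suc)
      also have "\<dots> \<le> avg L (\<lambda>u. 1 + (q' / R' * ?M u - q' * of_bool (pair_loads (move L u s) \<in> D')))"
        by (rule avg_mono[OF pt])
      also have "\<dots> = 1 + (q' / R' * avg L ?M - q' * avg L (\<lambda>u. of_bool (pair_loads (move L u s) \<in> D')))"
        by (simp only: avg_add avg_diff avg_cmult avg_const)
      also have "\<dots> \<le> 1 + (q' / R' * (exp 1 * R1 + exp 2) - q' * q)"
      proof -
        have "avg L ?M \<le> exp 1 * mean_exp \<theta> L (fst s) + exp 2" by (rule mean_exp_step[OF Ls(1)])
        also have "\<dots> \<le> exp 1 * R1 + exp 2"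
          using t1 by (intro add_right_mono mult_left_mono) (auto simp: typical_def)
        finally have "q' / R' * avg L ?M \<le> q' / R' * (exp 1 * R1 + exp 2)"
          using 2(1) R' by (intro mult_left_mono) auto
        moreover have "q' * q \<le> q' * avg L (\<lambda>u. of_bool (pair_loads (move L u s) \<in> D'))"
          using 1(2)[OF Ls(2) t1 sD True] 2(1) by (intro mult_left_mono) auto
        ultimately show ?thesis by linarith
      qed
      also have "q' / R' * (exp 1 * R1 + exp 2) = q' * (q / 2)"
      proof -
        have "exp 1 * R1 + exp 2 > 0" using R1 by (intro add_pos_pos) auto
        then show ?thesis unfolding R'_def using 1(1) by (simp add: field_simps)
      qed
      finally show ?thesis using p(3) by (simp add: algebra_simps)
    qed
    then show ?thesis using p(1) by blast
  qed
  then show ?thesis unfolding can_meet_def by blast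
qed

lemma can_meet_0_0: "can_meet {(0, 0)}"
proof -
  have z: "(trans_op L (move L) ^^ 1) apart s \<le> 1 - 1" if "pair_loads s \<in> {(0, 0)}" for L s
  proof -
    have "apart (move L u s) = 0" for u
      using that by (cases s) (auto simp: apart_def move_def pair_loads_def)
    then show ?thesis by (simp add: trans_op_def)
  qed
  show ?thesis
    unfolding can_meet_def
  proof
    fix R
    show "\<exists>q>0. \<exists>S L0. \<forall>L\<ge>L0. \<forall>N s. typical R L N s \<longrightarrow> pair_loads s \<in> {(0, 0)} \<longrightarrow>
      (trans_op L (move L) ^^ S) apart s \<le> 1 - q"
      using z zero_less_one by blast
  qed
qed

text \<open>Without arrivals at the two sites both loads reach zero at the same time.\<close>

lemma can_meet_equal: "can_meet {(k, k)}"
proof (induction k)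
  case 0 show ?case by (rule can_meet_0_0)
next
  case (Suc k)
  show ?case
  proof (rule can_meet_step[OF Suc.IH], intro exI[of _ "exp (-4)"] conjI exI[of _ 4] allI impI)
    show "0 < exp (-4::real)" by simp
    fix R L N s
    assume L: "4 \<le> L" and t: "typical R L N s" and D: "pair_loads s \<in> {(Suc k, Suc k)}" and ap: "apart s = 1"
    obtain \<zeta> a b where seq: "s = (\<zeta>, a, b)" by (cases s) auto
    have ab: "a \<in> {1..L}" "b \<in> {1..L}" using t unfolding seq typical_def pairs_def by auto
    have ne: "a \<noteq> b" using ap unfolding seq apart_def by auto
    have z: "\<zeta> a = Suc k" "\<zeta> b = Suc k" using D unfolding seq pair_loads_def by auto
    have "exp (-4) \<le> avg L (\<lambda>u. of_bool ((\<forall>y\<in>{}. u y = y) \<and> (\<forall>y\<in>{1..L} - {}. u y \<noteq> a \<and> u y \<noteq> b)))"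
      using prob_prescribed_targets[OF L _ _ ab ne, of "{}" "\<lambda>y. y"] by simp
    also have "\<dots> \<le> avg L (\<lambda>u. of_bool (pair_loads (move L u s) \<in> {(k, k)}))"
    proof (rule avg_mono)
      fix u
      show "of_bool ((\<forall>y\<in>{}. u y = y) \<and> (\<forall>y\<in>{1..L} - {}. u y \<noteq> a \<and> u y \<noteq> b))
          \<le> (of_bool (pair_loads (move L u s) \<in> {(k, k)}) :: real)"
      proof (cases "\<forall>y\<in>{1..L}. u y \<noteq> a \<and> u y \<noteq> b")
        case True
        have "rbb_update L u \<zeta> a = \<zeta> a - 1" by (rule update_no_arrival[OF ab(1)]) (use True in blast)
        moreover have "rbb_update L u \<zeta> b = \<zeta> b - 1" by (rule update_no_arrival[OF ab(2)]) (use True in blast)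
        ultimately have "rbb_update L u \<zeta> a = k" "rbb_update L u \<zeta> b = k" using z by simp_all
        then show ?thesis using z by (simp add: seq move_def pair_loads_def)
      next
        case False
        then have "of_bool ((\<forall>y\<in>{}. u y = y) \<and> (\<forall>y\<in>{1..L} - {}. u y \<noteq> a \<and> u y \<noteq> b)) = (0::real)"
          by (intro of_bool_eq_0_iff[THEN iffD2]) blast
        then show ?thesis by (simp only: of_bool_def) auto
      qed
    qed
    finally show "exp (-4) \<le> avg L (\<lambda>u. of_bool (pair_loads (move L u s) \<in> {(k, k)}))" .
  qed
qed

text \<open>A single arrival at \<open>a\<close> delays its particle by one step.\<close>

lemma can_meet_delay:
  assumes k: "k \<ge> 1" and prev: "can_meet {(k, m)}"
  shows "can_meet {(k, Suc m)}"
proof (rule can_meet_step[OF prev])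
  fix R :: real assume R: "R > 0"
  let ?c = "occupied_const R"
  show "\<exists>q>0. \<exists>L0. \<forall>L\<ge>L0. \<forall>N s. typical R L N s \<longrightarrow> pair_loads s \<in> {(k, Suc m)} \<longrightarrow> apart s = 1 \<longrightarrow>
       q \<le> avg L (\<lambda>u. of_bool (pair_loads (move L u s) \<in> {(k, m)}))"
  proof (intro exI[of _ "?c * exp (-4)"] conjI exI[of _ 4] allI impI)
    show "0 < ?c * exp (-4::real)" using occupied_const_pos[OF R] by simp
    fix L N s
    assume L: "4 \<le> L" and t: "typical R L N s" and D: "pair_loads s \<in> {(k, Suc m)}" and ap: "apart s = 1"
    obtain \<zeta> a b where seq: "s = (\<zeta>, a, b)" by (cases s) auto
    have ab: "a \<in> {1..L}" "b \<in> {1..L}" using t unfolding seq typical_def pairs_def by auto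
    have ne: "a \<noteq> b" using ap unfolding seq apart_def by auto
    have z: "\<zeta> a = k" "\<zeta> b = Suc m" using D unfolding seq pair_loads_def by auto
    have W: "?c * real L \<le> real (card (nonempty L \<zeta>))"
      using t L R unfolding seq typical_def pairs_def by (intro card_nonempty[of L N]) auto
    let ?E = "\<lambda>y0 u. (\<forall>y\<in>{y0}. u y = a) \<and> (\<forall>y\<in>{1..L} - {y0}. u y \<noteq> a \<and> u y \<noteq> b)"
    have "?c * exp (-4) = ?c * real L * (1 / real L * exp (-4))" using L by simp
    also have "\<dots> \<le> real (card (nonempty L \<zeta>)) * (1 / real L * exp (-4))"
      by (intro mult_right_mono W) auto
    also have "\<dots> \<le> avg L (\<lambda>u. of_bool (pair_loads (move L u s) \<in> {(k, m)}))"
    proof (rule avg_disjoint_events[where E = ?E])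
      show "finite (nonempty L \<zeta>)" by simp
      fix y0 assume y0: "y0 \<in> nonempty L \<zeta>"
      then have y: "y0 \<in> {1..L}" "\<zeta> y0 > 0" unfolding nonempty_def by auto
      show "1 / real L * exp (-4) \<le> avg L (\<lambda>u. of_bool (?E y0 u))"
        using prob_prescribed_targets[OF L _ _ ab ne, of "{y0}" "\<lambda>_. a"] y ab by simp
      show "pair_loads (move L u s) \<in> {(k, m)}" if "?E y0 u" for u
      proof -
        have "rbb_update L u \<zeta> a = \<zeta> a - of_bool (\<zeta> a > 0) + 1"
          by (rule update_one_arrival[where s = y0, OF ab(1)]) (use that y in auto)
        moreover have "rbb_update L u \<zeta> b = \<zeta> b - 1"
          by (rule update_no_arrival[OF ab(2)]) (metis that Diff_iff ne singletonI insert_iff empty_iff)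
        ultimately show ?thesis using z k by (simp add: seq move_def pair_loads_def)
      qed
    next
      fix i j u assume "i \<in> nonempty L \<zeta>" "j \<in> nonempty L \<zeta>" and e: "?E i u" "?E j u"
      then have "i \<in> {1..L}" unfolding nonempty_def by auto
      then show "i = j" using e by blast
    qed
    finally show "?c * exp (-4) \<le> avg L (\<lambda>u. of_bool (pair_loads (move L u s) \<in> {(k, m)}))" .
  qed
qed

lemma can_meet_positive:
  assumes "k \<ge> 1" "m \<ge> 1"
  shows "can_meet {(k, m)}"
proof -
  have up: "can_meet {(k, k + d)}" if "k \<ge> 1" for k d
  proof (induction d)
    case 0 show ?case using can_meet_equal by simp
  next
    case (Suc d) show ?case using can_meet_delay[OF that Suc] by simp
  qed
  show ?thesis
  proof (cases "k \<le> m")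
    case True
    then show ?thesis using up[OF assms(1), of "m - k"] by simp
  next
    case False
    then have "can_meet {(m, k)}" using up[OF assms(2), of "k - m"] by simp
    then show ?thesis by (rule can_meet_swap)
  qed
qed

text \<open>
  If only one of the particles is free, it jumps to a uniform site; half of the sites have load at
  most \<open>T\<close>. One arrival there and one at the other particle make both loads positive.
\<close>

lemma can_meet_jump:
  assumes m: "m \<ge> 1"
  shows "can_meet {(0, m)}"
proof -
  let ?D = "{1..Suc T} \<times> {m}"
  have D': "can_meet ?D"
    by (rule can_meet_finite) (use m can_meet_positive in auto)
  show ?thesis
  proof (rule can_meet_step[OF D'])
    fix R :: real assume R: "R > 0"
    let ?c = "occupied_const R"
    have c: "?c > 0" by (rule occupied_const_pos[OF R])
    show "\<exists>q>0. \<exists>L0. \<forall>L\<ge>L0. \<forall>N s. typical R L N s \<longrightarrow> pair_loads s \<in> {(0, m)} \<longrightarrow> apart s = 1 \<longrightarrow>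
       q \<le> avg L (\<lambda>u. of_bool (pair_loads (move L u s) \<in> ?D))"
    proof (intro exI[of _ "?c\<^sup>2 / 8 * exp (-4)"] conjI exI[of _ "max 4 (nat \<lceil>2 / ?c\<rceil>)"] allI impI)
      show "0 < ?c\<^sup>2 / 8 * exp (-4::real)" using c by simp
      fix L N s
      assume L': "max 4 (nat \<lceil>2 / ?c\<rceil>) \<le> L" and t: "typical R L N s" and D: "pair_loads s \<in> {(0, m)}"
        and ap: "apart s = 1"
      have L: "L \<ge> 4" using L' by simp
      have cL: "2 \<le> ?c * real L"
      proof -
        have "2 / ?c \<le> real L" using L' by linarith
        then show ?thesis using c by (simp add: field_simps)
      qed
      obtain \<zeta> a b where seq: "s = (\<zeta>, a, b)" by (cases s) auto
      have ab: "a \<in> {1..L}" "b \<in> {1..L}" using t unfolding seq typical_def pairs_def by auto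
      have zc: "\<zeta> \<in> confs L N" "real N \<le> r * real L" using t unfolding seq typical_def pairs_def by auto
      have z: "\<zeta> a = 0" "\<zeta> b = m" using D unfolding seq pair_loads_def by auto
      let ?W = "nonempty L \<zeta>"
      have W: "?c * real L \<le> real (card ?W)"
        using t L R unfolding seq typical_def pairs_def by (intro card_nonempty[of L N]) auto
      let ?A = "{x\<in>{1..L}. \<zeta> x \<le> T} - {b}"
      have A: "real L / 4 \<le> real (card ?A)"
      proof -
        have "real L \<le> 2 * real (card {x\<in>{1..L}. \<zeta> x \<le> T})"
          by (rule card_low_load[OF zc(1) particles_bound[OF zc(2)]])
        moreover have "card {x\<in>{1..L}. \<zeta> x \<le> T} \<le> card ?A + 1"
          using diff_card_le_card_Diff[of "{b}" "{x\<in>{1..L}. \<zeta> x \<le> T}"] by simp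
        ultimately show ?thesis using L by linarith
      qed
      let ?I = "SIGMA x:?A. SIGMA y:?W. ?W - {y}"
      let ?S = "\<lambda>i. {a, fst (snd i), snd (snd i)}"
      let ?h = "\<lambda>i y. if y = snd (snd i) then b else fst i"
      let ?E = "\<lambda>i u. (\<forall>y\<in>?S i. u y = ?h i y) \<and> (\<forall>y\<in>{1..L} - ?S i. u y \<noteq> fst i \<and> u y \<noteq> b)"
      have card: "real (card ?I) = real (card ?A) * (real (card ?W) * (real (card ?W) - 1))"
      proof -
        have "card (SIGMA y:?W. ?W - {y}) = card ?W * (card ?W - 1)" by simp
        moreover have "real (card ?W - 1) = real (card ?W) - 1" using W cL by (simp add: of_nat_diff)
        ultimately show ?thesis by simp
      qed
      have big: "real L / 4 * (?c * real L * (?c * real L / 2)) \<le> real (card ?I)"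
        unfolding card using A W cL by (intro mult_mono) auto
      have "?c\<^sup>2 / 8 * exp (-4) = real L / 4 * (?c * real L * (?c * real L / 2)) * ((1 / real L) ^ 3 * exp (-4))"
        using L by (simp add: power2_eq_square power3_eq_cube)
      also have "\<dots> \<le> real (card ?I) * ((1 / real L) ^ 3 * exp (-4))"
        by (intro mult_right_mono big) auto
      also have "\<dots> \<le> avg L (\<lambda>u. of_bool (pair_loads (move L u s) \<in> ?D))"
      proof (rule avg_disjoint_events[where E = ?E])
        show "finite ?I" by (intro finite_SigmaI) auto
        fix i assume "i \<in> ?I"
        then obtain x y y' where i: "i = (x, y, y')" and x: "x \<in> ?A" and y: "y \<in> ?W" "y' \<in> ?W" "y \<noteq> y'"
          by auto
        have ys: "y \<in> {1..L}" "\<zeta> y > 0" "y' \<in> {1..L}" "\<zeta> y' > 0" using y unfolding nonempty_def by auto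
        have xs: "x \<in> {1..L}" "x \<noteq> b" "\<zeta> x \<le> T" using x by auto
        have ya: "y \<noteq> a" "y' \<noteq> a" using ys z by auto
        have cS: "card (?S i) = 3" using ya y(3) by (simp add: i)
        show "(1 / real L) ^ 3 * exp (-4) \<le> avg L (\<lambda>u. of_bool (?E i u))"
          unfolding cS[symmetric]
          by (rule prob_prescribed_targets[OF L]) (use ys xs ab in \<open>auto simp: i\<close>)
        show "pair_loads (move L u s) \<in> ?D" if E: "?E i u" for u
        proof -
          have ua: "u a = x" using E ya by (simp add: i)
          have uy: "u y = x" "u y' = b" using E y(3) by (auto simp: i)
          have oth: "u v \<noteq> x \<and> u v \<noteq> b" if "v \<in> {1..L}" "v \<noteq> y" "v \<noteq> y'" "\<zeta> v > 0" for v
          proof -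
            have "v \<in> {1..L} - ?S i" using that z by (auto simp: i)
            with E show ?thesis by (metis i fst_conv)
          qed
          have 1: "rbb_update L u \<zeta> x = \<zeta> x - of_bool (\<zeta> x > 0) + 1"
            by (rule update_one_arrival[where u = u and \<zeta> = \<zeta> and s = y])
              (use xs ys uy in simp_all, metis oth uy(2) xs(2) atLeastAtMost_iff One_nat_def)
          have 2: "rbb_update L u \<zeta> b = \<zeta> b - of_bool (\<zeta> b > 0) + 1"
            by (rule update_one_arrival[where u = u and \<zeta> = \<zeta> and s = y'])
              (use ab ys uy in simp_all, metis oth uy(1) xs(2) atLeastAtMost_iff One_nat_def)
          show ?thesis using z m xs(3) ua 1 2 by (simp add: seq move_def pair_loads_def)
        qed
      next
        fix i j u assume ij: "i \<in> ?I" "j \<in> ?I" and e: "?E i u" "?E j u"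
        obtain x y y' where i: "i = (x, y, y')" "y \<in> ?W" "y' \<in> ?W" "y \<noteq> y'" "x \<noteq> b" using ij(1) by auto
        obtain x2 y2 y2' where j: "j = (x2, y2, y2')" "y2 \<in> ?W" "y2' \<in> ?W" "y2 \<noteq> y2'" "x2 \<noteq> b" using ij(2) by auto
        have ne: "v \<noteq> a \<and> v \<in> {1..L}" if "v \<in> ?W" for v using that z unfolding nonempty_def by auto
        have ui: "u a = x" "u y = x" "u y' = b" using e(1) i ne by auto
        have uj: "u a = x2" "u y2 = x2" "u y2' = b" using e(2) j ne by auto
        have oi: "u v \<noteq> x \<and> u v \<noteq> b" if "v \<in> ?W" "v \<noteq> y" "v \<noteq> y'" for v
          using e(1) i that ne[OF that(1)] by (metis (no_types, lifting) Diff_iff empty_iff fst_conv insert_iff snd_conv)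
        have "x = x2" using ui uj by simp
        moreover have "y2 = y" using oi[OF j(2)] uj ui i(5) \<open>x = x2\<close> by metis
        moreover have "y2' = y'" using oi[OF j(3)] uj ui i(5) by metis
        ultimately show "i = j" using i j by simp
      qed
      finally show "?c\<^sup>2 / 8 * exp (-4) \<le> avg L (\<lambda>u. of_bool (pair_loads (move L u s) \<in> ?D))" .
    qed
  qed
qed

lemma can_meet_any: "finite D \<Longrightarrow> can_meet D"
proof (rule can_meet_finite)
  fix d :: "nat \<times> nat"
  obtain k m where d: "d = (k, m)" by (cases d)
  consider "k = 0" "m = 0" | "k = 0" "m \<ge> 1" | "k \<ge> 1" "m = 0" | "k \<ge> 1" "m \<ge> 1" by linarith
  then show "can_meet {d}"
    unfolding d
    by cases (use can_meet_0_0 can_meet_jump can_meet_swap[OF can_meet_jump] can_meet_positive in auto)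
qed

section \<open>Contraction\<close>

text \<open>
  Far from the centre the Lyapunov function contracts; near the centre the particles meet with
  probability \<open>q\<close>, which an additive constant \<open>\<beta>\<close> turns into a contraction. The threshold
  between the two regimes does not depend on \<open>\<beta>\<close>, hence not on \<open>q\<close>.
\<close>

lemma pair_contraction:
  "\<exists>M \<alpha> C L0. M \<ge> 1 \<and> 0 < \<alpha> \<and> \<alpha> < 1 \<and> 0 < C \<and>
     (\<forall>L\<ge>L0. \<forall>N s n. r * real L / 2 \<le> real N \<longrightarrow> real N \<le> r * real L \<longrightarrow> s \<in> pairs L N \<longrightarrow>
        (trans_op L (move L) ^^ (M * n)) apart s \<le> C * \<alpha> ^ n * lyapunov L s)"
proof -
  define \<rho>1 where "\<rho>1 = (1 + \<rho>) / 2"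
  have \<rho>1: "0 < \<rho>1" "\<rho>1 < 1" unfolding \<rho>1_def using \<rho> by auto
  define d where "d = drift_const / (1 - \<rho>1)"
  have d: "d > 0" unfolding d_def using drift_const_pos \<rho>1 by simp
  \<comment> \<open>above level \<open>R\<close> the drift contracts by the factor \<open>\<rho>2\<close>\<close>
  define \<rho>2 where "\<rho>2 = (1 + \<rho>1) / 2"
  have \<rho>2: "\<rho>1 < \<rho>2" "\<rho>2 < 1" "0 < \<rho>2" unfolding \<rho>2_def using \<rho>1 by auto
  define R where "R = d / (\<rho>2 - \<rho>1)"
  have R: "R > 0" unfolding R_def using d \<rho>2 by simp
  define K where "K = nat \<lceil>R / \<theta>\<rceil>"
  obtain q S L0 where q: "q > 0" and S: "\<And>L N s. L \<ge> L0 \<Longrightarrow> typical (R / phi_weight) L N s \<Longrightarrow>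
      pair_loads s \<in> {..K} \<times> {..K} \<Longrightarrow> (trans_op L (move L) ^^ S) apart s \<le> 1 - q"
    using can_meet_any[of "{..K} \<times> {..K}"] unfolding can_meet_def by (metis finite_SigmaI finite_atMost)
  \<comment> \<open>a multiple of the block length that is at least the meeting time \<open>S\<close>\<close>
  define M where "M = Suc T * Suc S"
  have M: "M \<ge> 1" "S \<le> M" unfolding M_def by auto
  define \<beta> where "\<beta> = 2 * d / q"
  have \<beta>: "\<beta> > 0" unfolding \<beta>_def using d q by simp
  \<comment> \<open>a loss that is affordable in both regimes, and small relative to \<open>R / \<beta>\<close>\<close>
  define \<epsilon> where "\<epsilon> = min (min (q / 2) (1 - \<rho>2)) (min ((1 - \<rho>2) / 2) ((1 - \<rho>2) / 2 * R / \<beta>))"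
  define \<alpha> where "\<alpha> = 1 - \<epsilon>"
  have e: "0 < \<epsilon>" "\<epsilon> \<le> q / 2" "\<epsilon> \<le> (1 - \<rho>2) / 2" "\<epsilon> * \<beta> \<le> (1 - \<rho>2) / 2 * R"
  proof -
    show "0 < \<epsilon>" unfolding \<epsilon>_def using q \<rho>2 R \<beta> by auto
    show "\<epsilon> \<le> q / 2" unfolding \<epsilon>_def by linarith
    show "\<epsilon> \<le> (1 - \<rho>2) / 2" unfolding \<epsilon>_def by linarith
    have "\<epsilon> \<le> (1 - \<rho>2) / 2 * R / \<beta>" unfolding \<epsilon>_def by linarith
    then show "\<epsilon> * \<beta> \<le> (1 - \<rho>2) / 2 * R" using \<beta> by (simp add: field_simps)
  qed
  have \<alpha>: "0 < \<alpha>" "\<alpha> < 1" "\<rho>2 \<le> \<alpha>" unfolding \<alpha>_def using e \<rho>2 by auto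
  have main: "(trans_op L (move L) ^^ (M * n)) apart s \<le> (1 + 1 / \<beta>) * \<alpha> ^ n * lyapunov L s"
    if L: "L \<ge> max 4 L0" and N: "r * real L / 2 \<le> real N" "real N \<le> r * real L" and s: "s \<in> pairs L N"
    for L N s n
  proof -
    let ?Q = "trans_op L (move L)" and ?V = "lyapunov L"
    have L4: "L \<ge> 4" "L \<ge> L0" using L by auto
    let ?G = "\<lambda>s. (?V s + \<beta>) * apart s"
    have drift: "(?Q ^^ M) ?V s \<le> \<rho>1 * ?V s + d" if s: "s \<in> pairs L N" for s
    proof -
      have "(?Q ^^ M) ?V s \<le> \<rho>1 ^ Suc S * ?V s + drift_const / (1 - \<rho>1)"
        unfolding M_def
        by (rule iterated_drift[OF closed_move _ _ _ _ s])
          (use \<rho>1 drift_const_pos lyapunov_block[OF L4(1) N(2)] in \<open>auto simp: \<rho>1_def\<close>)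
      moreover have "\<rho>1 ^ Suc S * ?V s \<le> \<rho>1 * ?V s"
        using \<rho>1 lyapunov_ge_1[of L s] power_decreasing[of 1 "Suc S" \<rho>1] by (intro mult_right_mono) auto
      ultimately show ?thesis unfolding d_def by linarith
    qed
    have step: "(?Q ^^ M) ?G s \<le> \<alpha> * ?G s" if s: "s \<in> pairs L N" for s
    proof (cases "apart s = 1")
      case False
      then have a0: "apart s = 0" by (simp add: apart_def split: if_splits)
      obtain \<zeta> a where seq: "s = (\<zeta>, a, a)" using a0 by (cases s) (auto simp: apart_def)
      have "(?Q ^^ k) ?G (\<zeta>, a, a) = 0" for k \<zeta> a
      proof (induction k arbitrary: \<zeta> a)
        case 0 then show ?case by (simp add: apart_def)
      next
        case (Suc k)
        have "(?Q ^^ k) ?G (move L u (\<zeta>, a, a)) = 0" for u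
        proof -
          obtain a' where "move L u (\<zeta>, a, a) = (rbb_update L u \<zeta>, a', a')"
            by (cases "\<zeta> a = 0") (auto simp: move_def)
          then show ?thesis by (simp only: Suc)
        qed
        then show ?case unfolding trans_op_pow_Suc by simp
      qed
      then show ?thesis unfolding a0 by (simp add: seq)
    next
      case True
      have split: "(?Q ^^ M) ?G s \<le> (?Q ^^ M) ?V s + \<beta> * (?Q ^^ M) apart s"
      proof -
        have "(?Q ^^ M) ?G s \<le> (?Q ^^ M) (\<lambda>s. ?V s + \<beta> * apart s) s"
        proof (rule trans_op_pow_mono[OF closed_move s])
          fix s :: pairstate
          have "?V s * apart s \<le> ?V s * 1"
            using lyapunov_ge_1[of L s] apart_range[of s] by (intro mult_left_mono) auto
          then show "?G s \<le> ?V s + \<beta> * apart s" by (simp add: distrib_right)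
        qed
        then show ?thesis by (simp only: trans_op_pow_add trans_op_pow_cmult)
      qed
      show ?thesis
      proof (cases "?V s \<le> R")
        case False
        have "(?Q ^^ M) apart s \<le> 1"
          using apart_pow_antimono[of 0 M s L N] s True by simp
        then have "\<beta> * (?Q ^^ M) apart s \<le> \<beta>" using \<beta> by (simp add: mult_left_le)
        then have "(?Q ^^ M) ?G s \<le> \<rho>1 * ?V s + d + \<beta>" using split drift[OF s] by linarith
        moreover have "d \<le> (\<rho>2 - \<rho>1) * ?V s"
          using False \<rho>2 unfolding R_def by (simp add: field_simps)
        moreover have "\<epsilon> * \<beta> \<le> (1 - \<rho>2) / 2 * ?V s"
          using e(4) False \<rho>2 by (meson diff_ge_0_iff_ge divide_nonneg_pos less_imp_le linorder_not_le mult_left_mono order_trans zero_less_numeral)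
        moreover have "\<epsilon> * ?V s \<le> (1 - \<rho>2) / 2 * ?V s"
          using e(3) lyapunov_ge_1[of L s] by (intro mult_right_mono) auto
        ultimately show ?thesis
          using True unfolding \<alpha>_def by (simp add: algebra_simps)
      next
        case V: True
        have m: "0 \<le> phi_weight * mean_exp \<theta> L (fst s)" "0 \<le> pair_exp \<theta> s"
          using phi_weight_pos mean_exp_nonneg[of \<theta> L "fst s"] by (auto simp: pair_exp_def)
        have "mean_exp \<theta> L (fst s) \<le> R / phi_weight"
          using V m phi_weight_pos unfolding lyapunov_def by (simp add: field_simps)
        then have ty: "typical (R / phi_weight) L N s" using N s by (simp add: typical_def)
        have K: "k \<le> K" if "exp (\<theta> * real k) \<le> R" for k
        proof -
          have "\<theta> * real k \<le> R" using that exp_ge_add_one_self[of "\<theta> * real k"] by linarith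
          then have "real k \<le> R / \<theta>" using \<theta> by (simp add: field_simps)
          then show ?thesis unfolding K_def by linarith
        qed
        have "pair_exp \<theta> s \<le> R" using V m unfolding lyapunov_def by linarith
        then have "exp (\<theta> * real (fst s (fst (snd s)))) \<le> R" "exp (\<theta> * real (fst s (snd (snd s)))) \<le> R"
          unfolding pair_exp_def by (smt (verit) exp_gt_zero)+
        then have "pair_loads s \<in> {..K} \<times> {..K}" unfolding pair_loads_def using K by auto
        from S[OF L4(2) ty this] have "(?Q ^^ M) apart s \<le> 1 - q"
          using apart_pow_antimono[OF M(2) s] by linarith
        then have "\<beta> * (?Q ^^ M) apart s \<le> \<beta> * (1 - q)" using \<beta> by (intro mult_left_mono) auto
        also have "\<beta> * (1 - q) = \<beta> - 2 * d" unfolding \<beta>_def using q by (simp add: field_simps)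
        finally have "(?Q ^^ M) ?G s \<le> \<rho>1 * ?V s + \<beta> - d" using split drift[OF s] by linarith
        moreover have "\<epsilon> * \<beta> \<le> d"
        proof -
          have "\<epsilon> * \<beta> \<le> q / 2 * \<beta>" using e \<beta> by (intro mult_right_mono) auto
          also have "\<dots> = d" unfolding \<beta>_def using q by simp
          finally show ?thesis .
        qed
        moreover have "\<rho>1 * ?V s \<le> \<alpha> * ?V s"
          using \<alpha> \<rho>2 lyapunov_ge_1[of L s] by (intro mult_right_mono) auto
        moreover have "\<alpha> * \<beta> = \<beta> - \<epsilon> * \<beta>" unfolding \<alpha>_def by (simp add: algebra_simps)
        ultimately have "(?Q ^^ M) ?G s \<le> \<alpha> * ?V s + \<alpha> * \<beta>" by linarith
        then show ?thesis using True by (simp add: distrib_left)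
      qed
    qed
    have "(?Q ^^ (M * n)) ?G s \<le> \<alpha> ^ n * ?G s + 0 / (1 - \<alpha>)"
      by (rule iterated_drift[OF closed_move _ _ _ _ s]) (use \<alpha> step in auto)
    also have "\<dots> \<le> \<alpha> ^ n * (?V s + \<beta>)"
    proof -
      have "?G s \<le> (?V s + \<beta>) * 1"
        using apart_range[of s] lyapunov_ge_1[of L s] \<beta> by (intro mult_left_mono) auto
      then show ?thesis using \<alpha> by (simp add: mult_left_mono)
    qed
    also have "\<dots> \<le> \<alpha> ^ n * ((1 + \<beta>) * ?V s)"
    proof (intro mult_left_mono)
      have "\<beta> * 1 \<le> \<beta> * ?V s" using \<beta> lyapunov_ge_1[of L s] by (intro mult_left_mono) auto
      then show "?V s + \<beta> \<le> (1 + \<beta>) * ?V s" by (simp add: algebra_simps)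
    qed (use \<alpha> in auto)
    finally have G: "(?Q ^^ (M * n)) ?G s \<le> \<alpha> ^ n * ((1 + \<beta>) * ?V s)" .
    have "\<beta> * (?Q ^^ (M * n)) apart s = (?Q ^^ (M * n)) (\<lambda>s. \<beta> * apart s) s"
      by (simp only: trans_op_pow_cmult)
    also have "\<dots> \<le> (?Q ^^ (M * n)) ?G s"
    proof (rule trans_op_pow_mono[OF closed_move s])
      fix s :: pairstate
      show "\<beta> * apart s \<le> ?G s"
        using lyapunov_ge_1[of L s] apart_range[of s] by (intro mult_right_mono) auto
    qed
    also note G
    finally show ?thesis using \<beta> by (simp add: field_simps)
  qed
  show ?thesis
    using M(1) \<alpha> \<beta> main
    by (intro exI[of _ M] exI[of _ \<alpha>] exI[of _ "1 + 1 / \<beta>"] exI[of _ "max 4 L0"]) (auto simp: add_pos_pos)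
qed

end

section \<open>Paths of configurations\<close>

text \<open>
  Path coupling: particles are moved one at a time from an excess site to a deficit site. All
  configurations on the way stay below \<open>m\<close>, which keeps their exponential weights under control.
\<close>

lemma confs_path:
  fixes g :: "(nat \<Rightarrow> nat) \<Rightarrow> real"
  assumes edge: "\<And>\<zeta> a b. \<zeta> \<in> confs L N \<Longrightarrow> a \<in> {1..L} \<Longrightarrow> b \<in> {1..L} \<Longrightarrow> (\<And>x. \<zeta> x \<le> m x) \<Longrightarrow>
      g (put a \<zeta>) - g (put b \<zeta>) \<le> B"
    and B: "0 \<le> B"
    and mem: "\<eta> \<in> confs L (Suc N)" "\<xi> \<in> confs L (Suc N)"
    and le: "\<And>x. \<eta> x \<le> m x" "\<And>x. \<xi> x \<le> m x"
  shows "g \<eta> - g \<xi> \<le> real (Suc N) * B"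
proof -
  have ind: "g \<eta> - g \<xi> \<le> real d * B"
    if "(\<Sum>x\<in>{1..L}. \<eta> x - \<xi> x) = d" "\<eta> \<in> confs L (Suc N)" "\<And>x. \<eta> x \<le> m x" for d \<eta>
    using that
  proof (induction d arbitrary: \<eta>)
    case 0
    have sums: "(\<Sum>x\<in>{1..L}. \<eta> x) = (\<Sum>x\<in>{1..L}. \<xi> x)" using 0(2) mem(2) by (simp add: confs_def)
    have le: "\<eta> x \<le> \<xi> x" if "x \<in> {1..L}" for x using 0(1) that by simp
    have "\<eta> x = \<xi> x" for x
    proof (cases "x \<in> {1..L}")
      case True
      show ?thesis
      proof (rule ccontr)
        assume "\<eta> x \<noteq> \<xi> x"
        then have "\<eta> x < \<xi> x" using le[OF True] by simp
        then have "(\<Sum>x\<in>{1..L}. \<eta> x) < (\<Sum>x\<in>{1..L}. \<xi> x)"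
          using le True by (intro sum_strict_mono_ex1) auto
        then show False using sums by simp
      qed
    next
      case False
      then show ?thesis using 0(2) mem(2) by (simp add: confs_def)
    qed
    then have "\<eta> = \<xi>" by (rule ext)
    then show ?case by simp
  next
    case (Suc d)
    have sums: "(\<Sum>x\<in>{1..L}. \<eta> x) = (\<Sum>x\<in>{1..L}. \<xi> x)" using Suc(3) mem(2) by (simp add: confs_def)
    have "\<exists>x\<in>{1..L}. \<xi> x < \<eta> x"
    proof (rule ccontr)
      assume "\<not> ?thesis"
      then have "(\<Sum>x\<in>{1..L}. \<eta> x - \<xi> x) = 0" by (intro sum.neutral) force
      then show False using Suc(2) by simp
    qed
    then obtain x where x: "x \<in> {1..L}" "\<xi> x < \<eta> x" by blast
    have "\<exists>y\<in>{1..L}. \<eta> y < \<xi> y"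
    proof (rule ccontr)
      assume "\<not> ?thesis"
      then have "(\<Sum>x\<in>{1..L}. \<xi> x) < (\<Sum>x\<in>{1..L}. \<eta> x)"
        using x by (intro sum_strict_mono_ex1) force+
      then show False using sums by simp
    qed
    then obtain y where y: "y \<in> {1..L}" "\<eta> y < \<xi> y" by blast
    define \<zeta> where "\<zeta> = \<eta>(x := \<eta> x - 1)"
    have xy: "x \<noteq> y" using x y by auto
    have px: "put x \<zeta> = \<eta>" unfolding put_def \<zeta>_def using x by auto
    have "(\<Sum>v\<in>{1..L}. \<eta> v) = \<eta> x + (\<Sum>v\<in>{1..L}-{x}. \<eta> v)" by (rule sum.remove[OF finite_atLeastAtMost x(1)])
    moreover have "(\<Sum>v\<in>{1..L}. \<zeta> v) = \<zeta> x + (\<Sum>v\<in>{1..L}-{x}. \<zeta> v)" by (rule sum.remove[OF finite_atLeastAtMost x(1)])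
    moreover have "(\<Sum>v\<in>{1..L}-{x}. \<zeta> v) = (\<Sum>v\<in>{1..L}-{x}. \<eta> v)"
      by (rule sum.cong) (auto simp: \<zeta>_def)
    moreover have "\<zeta> x = \<eta> x - 1" by (simp add: \<zeta>_def)
    moreover have "(\<Sum>v\<in>{1..L}. \<eta> v) = Suc N" using Suc(3) by (simp add: confs_def)
    ultimately have "(\<Sum>v\<in>{1..L}. \<zeta> v) = N" using x by linarith
    then have z: "\<zeta> \<in> confs L N" using Suc(3) x by (auto simp: confs_def \<zeta>_def)
    have zm: "\<zeta> v \<le> m v" for v using Suc(4)[of v] by (auto simp: \<zeta>_def)
    define \<eta>' where "\<eta>' = put y \<zeta>"
    have "(\<Sum>v\<in>{1..L}. \<eta>' v) = \<eta>' y + (\<Sum>v\<in>{1..L}-{y}. \<eta>' v)" by (rule sum.remove[OF finite_atLeastAtMost y(1)])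
    moreover have "(\<Sum>v\<in>{1..L}. \<zeta> v) = \<zeta> y + (\<Sum>v\<in>{1..L}-{y}. \<zeta> v)" by (rule sum.remove[OF finite_atLeastAtMost y(1)])
    moreover have "(\<Sum>v\<in>{1..L}-{y}. \<eta>' v) = (\<Sum>v\<in>{1..L}-{y}. \<zeta> v)"
      by (rule sum.cong) (auto simp: \<eta>'_def put_def)
    moreover have "\<eta>' y = \<zeta> y + 1" by (simp add: \<eta>'_def put_def)
    ultimately have m': "\<eta>' \<in> confs L (Suc N)" using z y(1) by (auto simp: confs_def \<eta>'_def put_def)
    have le': "\<eta>' v \<le> m v" for v
      using Suc(4)[of v] le(2)[of v] y xy by (auto simp: \<eta>'_def put_def \<zeta>_def)
    have d': "(\<Sum>v\<in>{1..L}. \<eta>' v - \<xi> v) = d"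
    proof -
      have "(\<Sum>v\<in>{1..L}. \<eta> v - \<xi> v) = (\<eta> x - \<xi> x) + (\<Sum>v\<in>{1..L}-{x}. \<eta> v - \<xi> v)"
        by (rule sum.remove[OF finite_atLeastAtMost x(1)])
      moreover have "(\<Sum>v\<in>{1..L}. \<eta>' v - \<xi> v) = (\<eta>' x - \<xi> x) + (\<Sum>v\<in>{1..L}-{x}. \<eta>' v - \<xi> v)"
        by (rule sum.remove[OF finite_atLeastAtMost x(1)])
      moreover have "(\<Sum>v\<in>{1..L}-{x}. \<eta>' v - \<xi> v) = (\<Sum>v\<in>{1..L}-{x}. \<eta> v - \<xi> v)"
        using y by (intro sum.cong) (auto simp: \<eta>'_def put_def \<zeta>_def)
      moreover have "\<eta>' x = \<eta> x - 1" using xy by (simp add: \<eta>'_def put_def \<zeta>_def)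
      ultimately show ?thesis using Suc(2) x by linarith
    qed
    have "g \<eta> - g \<eta>' \<le> B"
      using edge[OF z x(1) y(1) zm] unfolding px \<eta>'_def .
    moreover have "g \<eta>' - g \<xi> \<le> real d * B" by (rule Suc.IH[OF d' m' le'])
    ultimately show ?case by (simp add: algebra_simps)
  qed
  have "(\<Sum>x\<in>{1..L}. \<eta> x - \<xi> x) \<le> (\<Sum>x\<in>{1..L}. \<eta> x)" by (rule sum_mono) simp
  also have "\<dots> = Suc N" using mem(1) by (simp add: confs_def)
  finally have "real (\<Sum>x\<in>{1..L}. \<eta> x - \<xi> x) * B \<le> real (Suc N) * B"
    using B by (intro mult_right_mono) (simp_all only: of_nat_le_iff)
  with ind[OF refl mem(1) le(1)] show ?thesis by linarith
qed

section \<open>The laws of the chain and its invariant law\<close>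

lemma finite_set_rbb_step: "L \<ge> 1 \<Longrightarrow> finite (set_pmf (rbb_step L \<eta>))"
  unfolding rbb_step_def targets_eq by (simp add: set_pmf_of_set)

lemma expectation_rbb_step:
  "L \<ge> 1 \<Longrightarrow> measure_pmf.expectation (rbb_step L \<eta>) f = trans_op L (rbb_update L) f \<eta>"
  unfolding rbb_step_def integral_map_pmf trans_op_def by (rule expectation_targets)

lemma set_rbb_step:
  assumes "L \<ge> 1" "\<eta> \<in> confs L N"
  shows "set_pmf (rbb_step L \<eta>) \<subseteq> confs L N"
  unfolding rbb_step_def targets_eq[OF assms(1)]
  using closed_underD[OF closed_update _ assms(2)] by (auto simp: set_pmf_of_set)

lemma expectation_bind_rbb_step:
  assumes L: "L \<ge> 1" and p: "set_pmf p \<subseteq> confs L N"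
  shows "measure_pmf.expectation (bind_pmf p (rbb_step L)) f
    = measure_pmf.expectation p (trans_op L (rbb_update L) f)"
proof -
  have "measure_pmf.expectation (bind_pmf p (rbb_step L)) f
      = (\<Sum>a\<in>confs L N. pmf p a *\<^sub>R measure_pmf.expectation (rbb_step L a) f)"
    using p by (intro pmf_expectation_bind finite_set_rbb_step L) auto
  also have "\<dots> = measure_pmf.expectation p (trans_op L (rbb_update L) f)"
    unfolding expectation_rbb_step[OF L] using p by (intro integral_measure_pmf[symmetric]) auto
  finally show ?thesis .
qed

lemma set_rbb_law:
  assumes L: "L \<ge> 1" and e: "\<eta> \<in> confs L N"
  shows "set_pmf (rbb_law L \<eta> n) \<subseteq> confs L N"
proof (induction n)
  case (Suc n)
  then show ?case using set_rbb_step[OF L] by (auto simp: set_bind_pmf)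
qed (use e in auto)

lemma expectation_rbb_law:
  assumes L: "L \<ge> 1" and e: "\<eta> \<in> confs L N"
  shows "measure_pmf.expectation (rbb_law L \<eta> n) f = (trans_op L (rbb_update L) ^^ n) f \<eta>"
proof (induction n arbitrary: f)
  case (Suc n)
  have "measure_pmf.expectation (rbb_law L \<eta> (Suc n)) f
      = measure_pmf.expectation (rbb_law L \<eta> n) (trans_op L (rbb_update L) f)"
    unfolding rbb_law.simps by (rule expectation_bind_rbb_step[OF L set_rbb_law[OF L e]])
  also have "\<dots> = (trans_op L (rbb_update L) ^^ Suc n) f \<eta>"
    unfolding Suc.IH by (simp add: funpow_swap1)
  finally show ?case .
qed simp

lemma expectation_confs:
  assumes "set_pmf p \<subseteq> confs L N"
  shows "measure_pmf.expectation p f = (\<Sum>a\<in>confs L N. pmf p a * f a)"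
  using assms by (subst integral_measure_pmf[of "confs L N"]) auto

lemma expectation_confs_mono:
  assumes "set_pmf p \<subseteq> confs L N" "\<And>a. a \<in> confs L N \<Longrightarrow> f a \<le> g a"
  shows "measure_pmf.expectation p f \<le> measure_pmf.expectation p (g :: _ \<Rightarrow> real)"
  unfolding expectation_confs[OF assms(1)] using assms(2) by (intro sum_mono mult_left_mono) auto

lemma expectation_confs_add:
  assumes "set_pmf p \<subseteq> confs L N"
  shows "measure_pmf.expectation p (\<lambda>a. f a + g a :: real)
    = measure_pmf.expectation p f + measure_pmf.expectation p g"
  unfolding expectation_confs[OF assms] by (simp add: sum.distrib algebra_simps)

lemma expectation_invariant:
  assumes L: "L \<ge> 1" and p: "set_pmf p \<subseteq> confs L N" and i: "bind_pmf p (rbb_step L) = p"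
  shows "measure_pmf.expectation p ((trans_op L (rbb_update L) ^^ n) f) = measure_pmf.expectation p f"
proof (induction n)
  case (Suc n)
  have "measure_pmf.expectation p ((trans_op L (rbb_update L) ^^ Suc n) f)
      = measure_pmf.expectation (bind_pmf p (rbb_step L)) ((trans_op L (rbb_update L) ^^ n) f)"
    by (simp add: expectation_bind_rbb_step[OF L p])
  then show ?case unfolding i Suc .
qed simp

lemma expectation_indicator_eq_prob:
  "measure_pmf.expectation p (\<lambda>a. of_bool (a \<in> A)) = measure_pmf.prob p A"
proof -
  have "(\<lambda>a. of_bool (a \<in> A) :: real) = indicator A" by (rule ext) (simp add: indicator_def)
  then show ?thesis by simp
qed

lemma confs_pmf_eqI:
  fixes p q :: "(nat \<Rightarrow> nat) pmf"
  assumes p: "set_pmf p \<subseteq> confs L N" "set_pmf q \<subseteq> confs L N"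
    and e: "\<And>f :: (nat \<Rightarrow> nat) \<Rightarrow> real. (\<And>a. 0 \<le> f a \<and> f a \<le> 1) \<Longrightarrow> measure_pmf.expectation p f = measure_pmf.expectation q f"
  shows "p = q"
proof (rule pmf_eqI)
  fix x
  have "measure_pmf.prob p {x} = measure_pmf.prob q {x}"
    unfolding expectation_indicator_eq_prob[symmetric] by (rule e) auto
  then show "pmf p x = pmf q x" by (simp add: pmf.rep_eq)
qed

text \<open>
  If the influence of the initial configuration vanishes, the laws started from one configuration
  form a Cauchy sequence, whose limit is invariant.
\<close>

lemma invariant_ex1:
  fixes \<kappa> :: "nat \<Rightarrow> real"
  assumes L: "L \<ge> 1" and e0: "\<eta>0 \<in> confs L N" and M: "M \<ge> 1"
    and \<kappa>: "\<kappa> \<longlonglongrightarrow> 0"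
    and forget: "\<And>f n \<eta> \<xi>. (\<And>a. 0 \<le> f a \<and> f a \<le> 1) \<Longrightarrow> \<eta> \<in> confs L N \<Longrightarrow> \<xi> \<in> confs L N \<Longrightarrow>
      \<bar>(trans_op L (rbb_update L) ^^ (M * n)) f \<eta> - (trans_op L (rbb_update L) ^^ (M * n)) f \<xi>\<bar> \<le> \<kappa> n"
  shows "\<exists>!\<nu>. set_pmf \<nu> \<subseteq> confs L N \<and> bind_pmf \<nu> (rbb_step L) = \<nu>"
proof -
  let ?P = "trans_op L (rbb_update L)" and ?S = "confs L N"
  have mean_close: "\<bar>(?P ^^ (M * n)) f \<eta>0 - measure_pmf.expectation p ((?P ^^ (M * n)) f)\<bar> \<le> \<kappa> n"
    if f: "\<And>a. 0 \<le> f a \<and> f a \<le> 1" and p: "set_pmf p \<subseteq> ?S" for f p n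
  proof -
    let ?g = "(?P ^^ (M * n)) f"
    have g: "?g \<eta>0 - \<kappa> n \<le> ?g a" "?g a \<le> ?g \<eta>0 + \<kappa> n" if "a \<in> ?S" for a
      using forget[of f \<eta>0 a n, OF f e0 that] by linarith+
    have "measure_pmf.expectation p (\<lambda>_. ?g \<eta>0 - \<kappa> n) \<le> measure_pmf.expectation p ?g"
      by (rule expectation_confs_mono[OF p g(1)])
    moreover have "measure_pmf.expectation p ?g \<le> measure_pmf.expectation p (\<lambda>_. ?g \<eta>0 + \<kappa> n)"
      by (rule expectation_confs_mono[OF p g(2)])
    ultimately show ?thesis by simp
  qed
  show ?thesis
  proof (rule ex_ex1I)
    have conv: "convergent (\<lambda>n. (?P ^^ n) f \<eta>0)" if f: "\<And>a. 0 \<le> f a \<and> f a \<le> 1" for f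
    proof (rule real_Cauchy_convergent)
      have near: "\<bar>(?P ^^ (M * n)) f \<eta>0 - (?P ^^ k) f \<eta>0\<bar> \<le> \<kappa> n" if "k \<ge> M * n" for k n
      proof -
        have "(?P ^^ k) f \<eta>0 = (?P ^^ (k - M * n)) ((?P ^^ (M * n)) f) \<eta>0"
          using funpow_add[of "k - M * n" "M * n" ?P] that by simp
        also have "\<dots> = measure_pmf.expectation (rbb_law L \<eta>0 (k - M * n)) ((?P ^^ (M * n)) f)"
          by (rule expectation_rbb_law[OF L e0, symmetric])
        finally show ?thesis using mean_close[where f = f and n = n, OF f set_rbb_law[OF L e0, of "k - M * n"]] by simp
      qed
      show "Cauchy (\<lambda>n. (?P ^^ n) f \<eta>0)"
      proof (rule metric_CauchyI)
        fix e :: real assume "e > 0"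
        then have "\<forall>\<^sub>F n in sequentially. \<kappa> n < e / 2"
          using \<kappa> by (intro order_tendstoD(2)[of \<kappa> 0]) auto
        then obtain n where n: "\<kappa> n < e / 2" by (auto dest: eventually_happens)
        have "dist ((?P ^^ i) f \<eta>0) ((?P ^^ j) f \<eta>0) < e" if "i \<ge> M * n" "j \<ge> M * n" for i j
          using near[OF that(1)] near[OF that(2)] n unfolding dist_real_def by linarith
        then show "\<exists>m. \<forall>i\<ge>m. \<forall>j\<ge>m. dist ((?P ^^ i) f \<eta>0) ((?P ^^ j) f \<eta>0) < e" by blast
      qed
    qed
    define w where "w x = (if x \<in> ?S then lim (\<lambda>n. (?P ^^ n) (\<lambda>a. of_bool (a = x)) \<eta>0) else 0)" for x
    have w: "(\<lambda>n. (?P ^^ n) (\<lambda>a. of_bool (a = x)) \<eta>0) \<longlonglongrightarrow> w x" if "x \<in> ?S" for x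
      using conv[of "\<lambda>a. of_bool (a = x)"] that unfolding w_def by (simp add: convergent_LIMSEQ_iff)
    have lim: "(\<lambda>n. (?P ^^ n) f \<eta>0) \<longlonglongrightarrow> (\<Sum>x\<in>?S. w x * f x)" for f
    proof -
      have "(\<lambda>n. \<Sum>x\<in>?S. (?P ^^ n) (\<lambda>a. of_bool (a = x)) \<eta>0 * f x) \<longlonglongrightarrow> (\<Sum>x\<in>?S. w x * f x)"
        by (intro tendsto_sum tendsto_mult_right w)
      moreover have "(\<Sum>x\<in>?S. (?P ^^ n) (\<lambda>a. of_bool (a = x)) \<eta>0 * f x) = (?P ^^ n) f \<eta>0" for n
      proof -
        have "(\<Sum>x\<in>?S. (?P ^^ n) (\<lambda>a. of_bool (a = x)) \<eta>0 * f x)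
            = (?P ^^ n) (\<lambda>a. \<Sum>x\<in>?S. f x * of_bool (a = x)) \<eta>0"
          unfolding trans_op_pow_sum trans_op_pow_cmult by (simp only: mult.commute)
        also have "\<dots> = (?P ^^ n) f \<eta>0"
        proof (rule trans_op_pow_cong[OF closed_update e0])
          fix a assume a: "a \<in> ?S"
          have "(\<Sum>x\<in>?S. f x * of_bool (a = x)) = (\<Sum>x\<in>?S. if x = a then f x else 0)"
            by (rule sum.cong) auto
          then show "(\<Sum>x\<in>?S. f x * of_bool (a = x)) = f a" using a by simp
        qed
        finally show ?thesis .
      qed
      ultimately show ?thesis by simp
    qed
    have w0: "0 \<le> w x" for x
    proof (cases "x \<in> ?S")
      case True
      have "0 \<le> (?P ^^ n) (\<lambda>a. of_bool (a = x)) \<eta>0" for n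
        by (rule trans_op_pow_nonneg[OF closed_update e0]) simp
      then show ?thesis by (intro LIMSEQ_le_const[OF w[OF True]]) auto
    qed (simp add: w_def)
    have w1: "(\<Sum>x\<in>?S. w x) = 1"
    proof -
      have "(\<lambda>n. 1::real) \<longlonglongrightarrow> (\<Sum>x\<in>?S. w x * 1)" using lim[of "\<lambda>_. 1"] by simp
      then show ?thesis using LIMSEQ_unique[OF _ tendsto_const] by force
    qed
    define \<nu> where "\<nu> = embed_pmf w"
    have pm: "pmf \<nu> x = w x" for x
      unfolding \<nu>_def
    proof (rule pmf_embed_pmf[OF w0])
      have "(\<integral>\<^sup>+ x. ennreal (w x) \<partial>count_space UNIV) = (\<Sum>x\<in>?S. ennreal (w x))"
        by (rule nn_integral_count_space') (auto simp: w_def)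
      also have "\<dots> = 1" using w0 w1 by (simp add: sum_ennreal)
      finally show "(\<integral>\<^sup>+ x. ennreal (w x) \<partial>count_space UNIV) = 1" .
    qed
    have sub: "set_pmf \<nu> \<subseteq> ?S"
      unfolding set_pmf_eq pm by (auto simp: w_def split: if_splits)
    have ex: "(\<lambda>n. (?P ^^ n) f \<eta>0) \<longlonglongrightarrow> measure_pmf.expectation \<nu> f" for f
      unfolding expectation_confs[OF sub] pm by (rule lim)
    have sub': "set_pmf (bind_pmf \<nu> (rbb_step L)) \<subseteq> ?S"
      using sub set_rbb_step[OF L] by (auto simp: set_bind_pmf)
    have "bind_pmf \<nu> (rbb_step L) = \<nu>"
    proof (rule confs_pmf_eqI[OF sub' sub])
      fix f :: "(nat \<Rightarrow> nat) \<Rightarrow> real"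
      have "(\<lambda>n. (?P ^^ Suc n) f \<eta>0) \<longlonglongrightarrow> measure_pmf.expectation \<nu> (?P f)"
        using ex[of "?P f"] by (simp add: funpow_swap1)
      moreover have "(\<lambda>n. (?P ^^ Suc n) f \<eta>0) \<longlonglongrightarrow> measure_pmf.expectation \<nu> f"
        by (rule LIMSEQ_Suc[OF ex])
      ultimately show "measure_pmf.expectation (bind_pmf \<nu> (rbb_step L)) f = measure_pmf.expectation \<nu> f"
        unfolding expectation_bind_rbb_step[OF L sub] by (rule LIMSEQ_unique)
    qed
    then show "\<exists>\<nu>. set_pmf \<nu> \<subseteq> ?S \<and> bind_pmf \<nu> (rbb_step L) = \<nu>" using sub by blast
  next
    fix \<mu> \<nu>
    assume \<mu>: "set_pmf \<mu> \<subseteq> ?S \<and> bind_pmf \<mu> (rbb_step L) = \<mu>"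
      and \<nu>: "set_pmf \<nu> \<subseteq> ?S \<and> bind_pmf \<nu> (rbb_step L) = \<nu>"
    show "\<mu> = \<nu>"
    proof (rule confs_pmf_eqI[of _ L N])
      fix f :: "(nat \<Rightarrow> nat) \<Rightarrow> real" assume f: "\<And>a. 0 \<le> f a \<and> f a \<le> 1"
      let ?d = "\<bar>measure_pmf.expectation \<mu> f - measure_pmf.expectation \<nu> f\<bar>"
      have "?d \<le> 2 * \<kappa> n" for n
      proof -
        have c: "\<bar>(?P ^^ (M * n)) f \<eta>0 - measure_pmf.expectation p f\<bar> \<le> \<kappa> n"
          if "set_pmf p \<subseteq> ?S" "bind_pmf p (rbb_step L) = p" for p
          using mean_close[where f = f and p = p and n = n, OF f that(1)]
          unfolding expectation_invariant[OF L that] .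
        show ?thesis using c[of \<mu>] c[of \<nu>] \<mu> \<nu> by linarith
      qed
      moreover have "(\<lambda>n. 2 * \<kappa> n) \<longlonglongrightarrow> 0" using tendsto_mult_left[OF \<kappa>, of 2] by simp
      ultimately have "?d \<le> 0" by (intro LIMSEQ_le_const[of "\<lambda>n. 2 * \<kappa> n" 0]) auto
      then show "measure_pmf.expectation \<mu> f = measure_pmf.expectation \<nu> f" by simp
    qed (use \<mu> \<nu> in auto)
  qed
qed

lemma tv_dist_le:
  assumes "\<And>A. \<bar>measure_pmf.prob \<mu> A - measure_pmf.prob \<nu> A\<bar> \<le> B"
  shows "tv_dist \<mu> \<nu> \<le> B"
  unfolding tv_dist_def using assms by (intro cSUP_least) auto

lemma tv_dist_ge: "\<bar>measure_pmf.prob \<mu> A - measure_pmf.prob \<nu> A\<bar> \<le> tv_dist \<mu> \<nu>"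
  unfolding tv_dist_def
proof (rule cSUP_upper)
  show "bdd_above (range (\<lambda>A. \<bar>measure_pmf.prob \<mu> A - measure_pmf.prob \<nu> A\<bar>))"
  proof (rule bdd_aboveI2[of _ _ 1])
    fix A
    show "\<bar>measure_pmf.prob \<mu> A - measure_pmf.prob \<nu> A\<bar> \<le> 1"
      using measure_nonneg[of \<mu> A] measure_nonneg[of \<nu> A] measure_pmf.prob_le_1[of \<mu> A] measure_pmf.prob_le_1[of \<nu> A]
      by linarith
  qed
qed simp

section \<open>Exponential convergence\<close>

context block_rate
begin

definition total_exp :: "nat \<Rightarrow> (nat \<Rightarrow> nat) \<Rightarrow> real" where
  "total_exp L \<eta> = (\<Sum>x\<in>{1..L}. exp (\<theta> * real (\<eta> x)))"

lemma total_exp_nonneg: "0 \<le> total_exp L \<eta>"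
  unfolding total_exp_def by (intro sum_nonneg) simp

lemma lyapunov_le_total_exp:
  assumes L: "L \<ge> 1" and s: "s \<in> pairs L N"
  shows "lyapunov L s \<le> (2 + phi_weight) * total_exp L (fst s)"
proof -
  have "exp (\<theta> * real (fst s x)) \<le> total_exp L (fst s)" if "x \<in> {1..L}" for x
    unfolding total_exp_def by (rule member_le_sum[OF that]) auto
  then have "pair_exp \<theta> s \<le> total_exp L (fst s) + total_exp L (fst s)"
    unfolding pair_exp_def using s by (intro add_mono) (auto simp: pairs_def)
  moreover have "mean_exp \<theta> L (fst s) \<le> total_exp L (fst s)"
    unfolding mean_exp_def total_exp_def[symmetric] using L total_exp_nonneg[of L "fst s"]
    by (simp add: divide_le_eq mult_le_cancel_left1)
  then have "phi_weight * mean_exp \<theta> L (fst s) \<le> phi_weight * total_exp L (fst s)"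
    using phi_weight_pos by (intro mult_left_mono) auto
  ultimately show ?thesis unfolding lyapunov_def by (simp add: algebra_simps)
qed

lemma forgetting:
  "\<exists>M \<alpha> C L0. M \<ge> 1 \<and> 0 < \<alpha> \<and> \<alpha> < 1 \<and> 0 < C \<and>
     (\<forall>L\<ge>L0. \<forall>N \<eta> \<xi> n f. real N = r * real L \<longrightarrow> \<eta> \<in> confs L N \<longrightarrow> \<xi> \<in> confs L N \<longrightarrow>
        (\<forall>a. 0 \<le> f a \<and> f a \<le> 1) \<longrightarrow>
        \<bar>(trans_op L (rbb_update L) ^^ (M * n)) f \<eta> - (trans_op L (rbb_update L) ^^ (M * n)) f \<xi>\<bar>
          \<le> C * real L * \<alpha> ^ n * (total_exp L \<eta> + total_exp L \<xi>))"
proof -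
  obtain M \<alpha> C L0 where M: "M \<ge> 1" and \<alpha>: "0 < \<alpha>" "\<alpha> < 1" and C: "0 < C"
    and pc: "\<And>L N s n. L \<ge> L0 \<Longrightarrow> r * real L / 2 \<le> real N \<Longrightarrow> real N \<le> r * real L \<Longrightarrow> s \<in> pairs L N \<Longrightarrow>
        (trans_op L (move L) ^^ (M * n)) apart s \<le> C * \<alpha> ^ n * lyapunov L s"
    using pair_contraction by meson
  let ?C = "r * C * (2 + phi_weight)"
  have C': "0 < ?C" using r C phi_weight_pos by simp
  have one: "(trans_op L (rbb_update L) ^^ (M * n)) f \<eta> - (trans_op L (rbb_update L) ^^ (M * n)) f \<xi>
          \<le> ?C * real L * \<alpha> ^ n * (total_exp L \<eta> + total_exp L \<xi>)"
    if L: "L \<ge> max 1 (max L0 (nat \<lceil>2 / r\<rceil>))" and N: "real N = r * real L"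
      and mem: "\<eta> \<in> confs L N" "\<xi> \<in> confs L N" and f: "\<And>a. 0 \<le> f a \<and> f a \<le> 1"
    for L N \<eta> \<xi> n f
  proof -
    have Ls: "L \<ge> 1" "L \<ge> L0" "2 / r \<le> real L" using L by linarith+
    then have rL: "2 \<le> r * real L" using r by (simp add: field_simps)
    then obtain N' where N': "N = Suc N'" using N by (cases N) auto
    let ?E = "total_exp L \<eta> + total_exp L \<xi>"
    let ?B = "C * \<alpha> ^ n * ((2 + phi_weight) * ?E)"
    have E0: "0 \<le> ?E" using total_exp_nonneg by simp
    define g where "g = (trans_op L (rbb_update L) ^^ (M * n)) f"
    have "g \<eta> - g \<xi> \<le> real (Suc N') * ?B"
    proof (rule confs_path[where m = "\<lambda>x. max (\<eta> x) (\<xi> x)" and L = L])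
      fix \<zeta> a b assume z: "\<zeta> \<in> confs L N'" and ab: "a \<in> {1..L}" "b \<in> {1..L}"
        and le: "\<And>x. \<zeta> x \<le> max (\<eta> x) (\<xi> x)"
      have s: "(\<zeta>, a, b) \<in> pairs L N'" using z ab by (simp add: pairs_def)
      have "g (put a \<zeta>) - g (put b \<zeta>) \<le> (trans_op L (move L) ^^ (M * n)) apart (\<zeta>, a, b)"
        unfolding g_def by (rule coupling_bound) (use f z ab in auto)
      also have "\<dots> \<le> C * \<alpha> ^ n * lyapunov L (\<zeta>, a, b)"
        by (rule pc[OF Ls(2) _ _ s]) (use N N' rL in auto)
      also have "\<dots> \<le> ?B"
      proof (intro mult_left_mono)
        have "lyapunov L (\<zeta>, a, b) \<le> (2 + phi_weight) * total_exp L \<zeta>"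
          using lyapunov_le_total_exp[OF Ls(1) s] by simp
        also have "\<dots> \<le> (2 + phi_weight) * ?E"
        proof (intro mult_left_mono)
          show "total_exp L \<zeta> \<le> ?E"
            unfolding total_exp_def sum.distrib[symmetric]
          proof (rule sum_mono)
            fix x
            have "exp (\<theta> * real (\<zeta> x)) \<le> exp (\<theta> * real (\<eta> x)) \<or> exp (\<theta> * real (\<zeta> x)) \<le> exp (\<theta> * real (\<xi> x))"
              using le[of x] \<theta> by auto
            then show "exp (\<theta> * real (\<zeta> x)) \<le> exp (\<theta> * real (\<eta> x)) + exp (\<theta> * real (\<xi> x))"
              by (smt (verit) exp_gt_zero)
          qed
        qed (use phi_weight_pos in auto)
        finally show "lyapunov L (\<zeta>, a, b) \<le> (2 + phi_weight) * ?E" .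
      qed (use C \<alpha> in auto)
      finally show "g (put a \<zeta>) - g (put b \<zeta>) \<le> ?B" .
    next
      show "0 \<le> ?B" using C \<alpha> phi_weight_pos E0 by simp
    qed (use mem N' in auto)
    also have "real (Suc N') * ?B = ?C * real L * \<alpha> ^ n * ?E"
      unfolding N'[symmetric] N by (simp add: mult_ac)
    finally show ?thesis unfolding g_def .
  qed
  have "\<bar>(trans_op L (rbb_update L) ^^ (M * n)) f \<eta> - (trans_op L (rbb_update L) ^^ (M * n)) f \<xi>\<bar>
          \<le> ?C * real L * \<alpha> ^ n * (total_exp L \<eta> + total_exp L \<xi>)"
    if "L \<ge> max 1 (max L0 (nat \<lceil>2 / r\<rceil>))" "real N = r * real L" "\<eta> \<in> confs L N" "\<xi> \<in> confs L N"
      "\<forall>a. 0 \<le> f a \<and> f a \<le> 1" for L N \<eta> \<xi> n f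
    using one[of L N \<eta> \<xi> f n] one[of L N \<xi> \<eta> f n] that by (simp add: abs_le_iff add.commute)
  then show ?thesis using M \<alpha> C' by blast
qed

lemma invariant_total_exp:
  assumes L: "L \<ge> 4" and N: "real N = r * real L" and p: "set_pmf p \<subseteq> confs L N"
    and i: "bind_pmf p (rbb_step L) = p"
  shows "measure_pmf.expectation p (total_exp L) \<le> block_const / (1 - \<rho>) * real L"
proof -
  have L1: "L \<ge> 1" using L by simp
  let ?m = "measure_pmf.expectation p (mean_exp \<theta> L)"
  have "?m = measure_pmf.expectation p ((trans_op L (rbb_update L) ^^ Suc T) (mean_exp \<theta> L))"
    by (rule expectation_invariant[OF L1 p i, symmetric])
  also have "\<dots> \<le> measure_pmf.expectation p (\<lambda>\<zeta>. \<rho> * mean_exp \<theta> L \<zeta> + block_const)"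
    by (rule expectation_confs_mono[OF p mean_exp_block[OF L]]) (use N in auto)
  also have "\<dots> = \<rho> * ?m + block_const"
    by (simp add: expectation_confs_add[OF p])
  finally have "?m \<le> block_const / (1 - \<rho>)" using \<rho> by (simp add: field_simps)
  moreover have "total_exp L = (\<lambda>\<zeta>. real L * mean_exp \<theta> L \<zeta>)"
    using L by (intro ext) (simp add: total_exp_def mean_exp_def)
  ultimately have "measure_pmf.expectation p (total_exp L) = real L * ?m" by simp
  also have "\<dots> \<le> real L * (block_const / (1 - \<rho>))"
    using \<open>?m \<le> _\<close> by (intro mult_left_mono) auto
  finally show ?thesis by (simp add: mult.commute)
qed

end

lemma rbb_invariant_confs:
  "real N = r * real L \<Longrightarrow> rbb_invariant r L \<nu> \<longleftrightarrow> set_pmf \<nu> \<subseteq> confs L N \<and> bind_pmf \<nu> (rbb_step L) = \<nu>"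
  unfolding rbb_invariant_def by (simp add: configs_eq_confs)

lemma exponential_convergence:
  fixes r :: real
  assumes r: "r > 0"
  shows "\<exists>M \<theta> \<alpha> C L0. M \<ge> 1 \<and> 0 < \<theta> \<and> 0 < \<alpha> \<and> \<alpha> < 1 \<and> 0 < C \<and>
    (\<forall>L\<ge>L0. \<forall>N. real N = r * real L \<longrightarrow> rbb_invariant r L (rbb_stationary r L) \<and>
      (\<forall>\<eta>\<in>configs r L. \<forall>n. tv_dist (rbb_law L \<eta> (M * n)) (rbb_stationary r L)
         \<le> C * (real L)\<^sup>2 * \<alpha> ^ n * exp (\<theta> * real (config_norm L \<eta>))))"
proof -
  define T where "T = nat \<lceil>2 * r\<rceil>"
  have T: "2 * r \<le> real T" unfolding T_def by linarith
  have p: "0 < exp (-4) ^ T / (2::real)" "exp (-4) ^ T / (2::real) \<le> 1"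
    using power_le_one[of "exp (-4::real)" T] by auto
  obtain \<theta> \<rho> :: real where "0 < \<theta>" "\<theta> \<le> 1" "0 < \<rho>" "\<rho> < 1"
    "exp (\<theta>\<^sup>2) ^ Suc T - exp (\<theta>\<^sup>2) * (\<theta> / 2) * exp (-\<theta>) ^ T * (exp (-4) ^ T / 2) \<le> \<rho>"
    using exists_block_rate[OF p, of T] by blast
  with r T interpret block_rate r \<theta> \<rho> T by unfold_locales auto
  obtain M \<alpha> C L0 where M: "M \<ge> 1" and \<alpha>: "0 < \<alpha>" "\<alpha> < 1" and C: "0 < C"
    and fg: "\<And>L N \<eta> \<xi> n f. L \<ge> L0 \<Longrightarrow> real N = r * real L \<Longrightarrow> \<eta> \<in> confs L N \<Longrightarrow> \<xi> \<in> confs L N \<Longrightarrow>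
        (\<And>a. 0 \<le> f a \<and> f a \<le> 1) \<Longrightarrow>
        \<bar>(trans_op L (rbb_update L) ^^ (M * n)) f \<eta> - (trans_op L (rbb_update L) ^^ (M * n)) f \<xi>\<bar>
          \<le> C * real L * \<alpha> ^ n * (total_exp L \<eta> + total_exp L \<xi>)"
    using forgetting by meson
  define D where "D = block_const / (1 - \<rho>)"
  have D: "D > 0" unfolding D_def using block_const_pos \<rho> by simp
  have main: "rbb_invariant r L (rbb_stationary r L) \<and>
      (\<forall>\<eta>\<in>configs r L. \<forall>n. tv_dist (rbb_law L \<eta> (M * n)) (rbb_stationary r L)
         \<le> C * (1 + D) * (real L)\<^sup>2 * \<alpha> ^ n * exp (\<theta> * real (config_norm L \<eta>)))"
    if L: "L \<ge> max 4 L0" and N: "real N = r * real L" for L N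
  proof -
    have Ls: "L \<ge> 4" "L \<ge> L0" "L \<ge> 1" using L by auto
    let ?P = "trans_op L (rbb_update L)"
    let ?\<nu> = "rbb_stationary r L"
    define \<eta>0 :: "nat \<Rightarrow> nat" where "\<eta>0 = (\<lambda>x. if x = 1 then N else 0)"
    have e0: "\<eta>0 \<in> confs L N" unfolding \<eta>0_def confs_def using Ls by (auto simp: sum.delta)
    have te: "total_exp L \<eta> \<le> real L * exp (\<theta> * real k)" if "\<And>x. x \<in> {1..L} \<Longrightarrow> \<eta> x \<le> k" for \<eta> k
    proof -
      have "total_exp L \<eta> \<le> (\<Sum>x\<in>{1..L}. exp (\<theta> * real k))"
        unfolding total_exp_def by (rule sum_mono) (use that \<theta> in auto)
      then show ?thesis by simp
    qed
    have teN: "total_exp L \<eta> \<le> real L * exp (\<theta> * real N)" if "\<eta> \<in> confs L N" for \<eta>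
      using that unfolding confs_def by (intro te) (auto intro!: member_le_sum)
    define \<kappa> where "\<kappa> n = C * real L * \<alpha> ^ n * (2 * (real L * exp (\<theta> * real N)))" for n
    have k0: "\<kappa> \<longlonglongrightarrow> 0"
      unfolding \<kappa>_def using \<alpha> by (intro tendsto_mult_left_zero tendsto_mult_right_zero LIMSEQ_power_zero) auto
    have "\<exists>!\<nu>. set_pmf \<nu> \<subseteq> confs L N \<and> bind_pmf \<nu> (rbb_step L) = \<nu>"
    proof (rule invariant_ex1[OF Ls(3) e0 M k0])
      fix f :: "(nat \<Rightarrow> nat) \<Rightarrow> real" and n \<eta> \<xi>
      assume f: "\<And>a. 0 \<le> f a \<and> f a \<le> 1" and m: "\<eta> \<in> confs L N" "\<xi> \<in> confs L N"
      have "C * real L * \<alpha> ^ n * (total_exp L \<eta> + total_exp L \<xi>) \<le> \<kappa> n"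
        unfolding \<kappa>_def using teN[OF m(1)] teN[OF m(2)] C \<alpha> by (intro mult_left_mono) auto
      with fg[where f = f and n = n, OF Ls(2) N m f]
      show "\<bar>(?P ^^ (M * n)) f \<eta> - (?P ^^ (M * n)) f \<xi>\<bar> \<le> \<kappa> n" by linarith
    qed
    then have "\<exists>!\<nu>. rbb_invariant r L \<nu>" unfolding rbb_invariant_confs[OF N] .
    then have inv: "rbb_invariant r L ?\<nu>" unfolding rbb_stationary_def by (rule theI')
    then have n1: "set_pmf ?\<nu> \<subseteq> confs L N" and n2: "bind_pmf ?\<nu> (rbb_step L) = ?\<nu>"
      unfolding rbb_invariant_confs[OF N] by auto
    have "tv_dist (rbb_law L \<eta> (M * n)) ?\<nu> \<le> C * (1 + D) * (real L)\<^sup>2 * \<alpha> ^ n * exp (\<theta> * real (config_norm L \<eta>))"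
      if e: "\<eta> \<in> confs L N" for \<eta> n
    proof -
      let ?K = "C * real L * \<alpha> ^ n"
      have K: "0 \<le> ?K" using C \<alpha> by simp
      have "tv_dist (rbb_law L \<eta> (M * n)) ?\<nu> \<le> ?K * (total_exp L \<eta> + D * real L)"
      proof (rule tv_dist_le)
        fix A :: "(nat \<Rightarrow> nat) set"
        let ?f = "\<lambda>a. of_bool (a \<in> A) :: real"
        let ?g = "(?P ^^ (M * n)) ?f"
        have cl: "\<bar>?g \<eta> - ?g a\<bar> \<le> ?K * (total_exp L \<eta> + total_exp L a)" if "a \<in> confs L N" for a
          by (rule fg[OF Ls(2) N e that]) auto
        have 1: "measure_pmf.prob (rbb_law L \<eta> (M * n)) A = ?g \<eta>"
          using expectation_rbb_law[OF Ls(3) e, of "M * n" ?f] by (simp only: expectation_indicator_eq_prob)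
        have 2: "measure_pmf.prob ?\<nu> A = measure_pmf.expectation ?\<nu> ?g"
          using expectation_invariant[OF Ls(3) n1 n2, of "M * n" ?f] by (simp only: expectation_indicator_eq_prob)
        have lin: "measure_pmf.expectation ?\<nu> (\<lambda>a. c + d * (total_exp L \<eta> + total_exp L a))
            = c + d * (total_exp L \<eta> + measure_pmf.expectation ?\<nu> (total_exp L))" for c d
          by (simp add: expectation_confs_add[OF n1])
        have le: "?K * (total_exp L \<eta> + measure_pmf.expectation ?\<nu> (total_exp L)) \<le> ?K * (total_exp L \<eta> + D * real L)"
          using invariant_total_exp[OF Ls(1) N n1 n2] K unfolding D_def by (intro mult_left_mono) auto
        have "measure_pmf.expectation ?\<nu> ?g \<le> measure_pmf.expectation ?\<nu> (\<lambda>a. ?g \<eta> + ?K * (total_exp L \<eta> + total_exp L a))"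
          by (rule expectation_confs_mono[OF n1]) (use cl in \<open>fastforce simp: abs_le_iff\<close>)
        moreover have "measure_pmf.expectation ?\<nu> (\<lambda>a. ?g \<eta> + (-?K) * (total_exp L \<eta> + total_exp L a))
            \<le> measure_pmf.expectation ?\<nu> ?g"
          by (rule expectation_confs_mono[OF n1]) (use cl in \<open>fastforce simp: abs_le_iff\<close>)
        ultimately show "\<bar>measure_pmf.prob (rbb_law L \<eta> (M * n)) A - measure_pmf.prob ?\<nu> A\<bar>
            \<le> ?K * (total_exp L \<eta> + D * real L)"
          unfolding lin 1 2 using le by (simp only: mult_minus_left)
      qed
      also have "\<dots> \<le> ?K * (real L * exp (\<theta> * real (config_norm L \<eta>)) + D * real L * exp (\<theta> * real (config_norm L \<eta>)))"
      proof (intro mult_left_mono[OF add_mono] K)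
        show "total_exp L \<eta> \<le> real L * exp (\<theta> * real (config_norm L \<eta>))"
          by (rule te) (auto simp: config_norm_def)
        have "D * real L * 1 \<le> D * real L * exp (\<theta> * real (config_norm L \<eta>))"
          using D \<theta> by (intro mult_left_mono) auto
        then show "D * real L \<le> D * real L * exp (\<theta> * real (config_norm L \<eta>))" by simp
      qed
      also have "\<dots> = C * (1 + D) * (real L)\<^sup>2 * \<alpha> ^ n * exp (\<theta> * real (config_norm L \<eta>))"
        by (simp add: power2_eq_square algebra_simps)
      finally show ?thesis .
    qed
    then show ?thesis using inv unfolding configs_eq_confs[OF N] by blast
  qed
  have "0 < C * (1 + D)" using C D by simp
  then show ?thesis using M \<theta>(1) \<alpha> main by blast
qed

section \<open>Mixing times\<close>

lemma exp_minus_le_cube: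
  fixes y :: real
  assumes "y > 0"
  shows "exp (- y) \<le> 27 / y ^ 3"
proof -
  have "(y / 3) ^ 3 \<le> exp (y / 3) ^ 3"
    using assms exp_ge_add_one_self[of "y / 3"] by (intro power_mono) linarith+
  also have "\<dots> = exp y" by (simp add: exp_of_nat_mult[symmetric])
  finally have "y ^ 3 \<le> 27 * exp y" by (simp add: power_divide)
  then show ?thesis using assms by (simp add: exp_minus field_simps)
qed

lemma mixing_time_from_le:
  "tv_dist (rbb_law L \<eta> t) (rbb_stationary r L) < \<epsilon> \<Longrightarrow> mixing_time_from r L \<eta> \<epsilon> \<le> enat t"
  unfolding mixing_time_from_def by (rule Inf_lower) auto

lemma config_norm_le: "\<eta> \<in> confs L N \<Longrightarrow> L \<ge> 1 \<Longrightarrow> config_norm L \<eta> \<le> N"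
  unfolding config_norm_def confs_def by (auto intro!: Max.boundedI member_le_sum)

lemma load_lower_bound:
  assumes L: "L \<ge> 1" and x: "x \<in> {1..L}"
  shows "\<xi> \<in> set_pmf (rbb_law L \<eta> t) \<Longrightarrow> \<eta> x \<le> \<xi> x + t"
proof (induction t arbitrary: \<xi>)
  case (Suc t)
  then obtain \<zeta> where z: "\<zeta> \<in> set_pmf (rbb_law L \<eta> t)" "\<xi> \<in> set_pmf (rbb_step L \<zeta>)"
    by (auto simp: set_bind_pmf)
  then obtain u where "\<xi> = rbb_update L u \<zeta>" unfolding rbb_step_def by auto
  then have "\<zeta> x - 1 \<le> \<xi> x" using update_ge[OF x] by simp
  then show ?case using Suc.IH[OF z(1)] by linarith
qed simp

text \<open>
  At most one site can hold more than half of the particles, so for some site this has stationary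
  probability at most \<open>1 / L\<close>. A tower built there comes down by at most one
  particle per step.
\<close>

lemma mixing_time_ge:
  assumes L: "L \<ge> 2" and N: "real N = r * real L" and inv: "rbb_invariant r L (rbb_stationary r L)"
    and e: "\<epsilon> < 1 / 2"
  shows "ereal (r * real L / 2) \<le> ereal_of_enat (mixing_time r L \<epsilon>)"
proof -
  have L1: "L \<ge> 1" using L by simp
  let ?\<nu> = "rbb_stationary r L"
  have n1: "set_pmf ?\<nu> \<subseteq> confs L N" using inv unfolding rbb_invariant_confs[OF N] by simp
  let ?A = "\<lambda>x. {\<xi>. N < 2 * \<xi> x} :: (nat \<Rightarrow> nat) set"
  have "\<exists>x\<in>{1..L}. measure_pmf.prob ?\<nu> (?A x) \<le> 1 / real L"
  proof (rule ccontr)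
    assume "\<not> ?thesis"
    then have "(\<Sum>x\<in>{1..L}. 1 / real L) < (\<Sum>x\<in>{1..L}. measure_pmf.prob ?\<nu> (?A x))"
      using L1 by (intro sum_strict_mono) (auto simp: not_le)
    moreover have "(\<Sum>x\<in>{1..L}. measure_pmf.prob ?\<nu> (?A x)) \<le> 1"
    proof -
      have "(\<Sum>x\<in>{1..L}. measure_pmf.prob ?\<nu> (?A x))
          = measure_pmf.expectation ?\<nu> (\<lambda>\<xi>. \<Sum>x\<in>{1..L}. of_bool (\<xi> \<in> ?A x))"
        unfolding expectation_indicator_eq_prob[symmetric] expectation_confs[OF n1] sum_distrib_left
        by (rule sum.swap)
      also have "\<dots> \<le> measure_pmf.expectation ?\<nu> (\<lambda>_. 1)"
      proof (rule expectation_confs_mono[OF n1])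
        fix \<xi> assume xi: "\<xi> \<in> confs L N"
        have uniq: "x = y" if "x \<in> {1..L}" "y \<in> {1..L}" "N < 2 * \<xi> x" "N < 2 * \<xi> y" for x y
        proof (rule ccontr)
          assume "x \<noteq> y"
          then have "\<xi> x + \<xi> y = (\<Sum>v\<in>{x, y}. \<xi> v)" by simp
          also have "\<dots> \<le> (\<Sum>v\<in>{1..L}. \<xi> v)" using that by (intro sum_mono2) auto
          also have "\<dots> = N" using xi by (simp add: confs_def)
          finally show False using that by linarith
        qed
        have "card {x\<in>{1..L}. N < 2 * \<xi> x} \<le> 1"
          using uniq by (subst card_le_Suc0_iff_eq[unfolded One_nat_def[symmetric]]) auto
        moreover have "(\<Sum>x\<in>{1..L}. of_bool (\<xi> \<in> ?A x)) = real (card {x\<in>{1..L}. N < 2 * \<xi> x})"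
          by (simp add: Int_def)
        ultimately show "(\<Sum>x\<in>{1..L}. of_bool (\<xi> \<in> ?A x)) \<le> (1::real)" by simp
      qed
      finally show ?thesis by simp
    qed
    ultimately show False using L1 by simp
  qed
  then obtain x where x: "x \<in> {1..L}" "measure_pmf.prob ?\<nu> (?A x) \<le> 1 / real L" by blast
  define \<eta> where "\<eta> = (\<lambda>y. if y = x then N else 0)"
  have eta: "\<eta> \<in> confs L N" unfolding \<eta>_def confs_def using x(1) by (auto simp: sum.delta)
  let ?k = "(N + 1) div 2"
  have "enat ?k \<le> mixing_time_from r L \<eta> \<epsilon>"
    unfolding mixing_time_from_def
  proof (rule Inf_greatest)
    fix i assume "i \<in> {enat t |t. tv_dist (rbb_law L \<eta> t) ?\<nu> < \<epsilon>}"
    then obtain t where t: "i = enat t" "tv_dist (rbb_law L \<eta> t) ?\<nu> < \<epsilon>" by blast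
    have "\<not> 2 * t < N"
    proof
      assume small: "2 * t < N"
      have "set_pmf (rbb_law L \<eta> t) \<subseteq> ?A x"
        using load_lower_bound[OF L1 x(1), of _ \<eta> t] small by (force simp: \<eta>_def)
      then have "measure_pmf.prob (rbb_law L \<eta> t) (?A x) = 1"
        by (intro measure_pmf.prob_eq_1[THEN iffD2]) (auto simp: AE_measure_pmf_iff)
      then have "1 - 1 / real L \<le> tv_dist (rbb_law L \<eta> t) ?\<nu>"
        using tv_dist_ge[of "rbb_law L \<eta> t" "?A x" ?\<nu>] x(2) by linarith
      moreover have "1 / real L \<le> 1 / 2" using L by (simp add: field_simps)
      ultimately show False using t(2) e by linarith
    qed
    then show "enat ?k \<le> i" unfolding t(1) by simp
  qed
  also have "\<dots> \<le> mixing_time r L \<epsilon>"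
    unfolding mixing_time_def by (rule SUP_upper) (simp add: configs_eq_confs[OF N] eta)
  finally have "ereal_of_enat (enat ?k) \<le> ereal_of_enat (mixing_time r L \<epsilon>)"
    by (simp only: ereal_of_enat_le_iff)
  moreover have "ereal (r * real L / 2) \<le> ereal_of_enat (enat ?k)"
  proof -
    have "N \<le> 2 * ?k" by simp
    then have "real N \<le> 2 * real ?k" by linarith
    then show ?thesis unfolding N[symmetric] by simp
  qed
  ultimately show ?thesis by (rule order_trans[rotated])
qed

lemma admissible_particles:
  assumes "r > 0" "L \<in> admissible_sizes r"
  obtains N where "real N = r * real L"
  using assms unfolding admissible_sizes_def by (auto elim: Nats_cases)

theorem mainTheorem2:
  fixes r :: real
  assumes "r > 0"
  shows "(\<exists>c>0. \<exists>c'>0. \<forall>\<epsilon>::real. 0 < \<epsilon> \<longrightarrow> \<epsilon> < 1/2 \<longrightarrow>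
            (\<forall>L\<in>admissible_sizes r. real L \<ge> c / \<epsilon> \<longrightarrow>
               ereal (r * real L / 2) \<le> ereal_of_enat (mixing_time r L \<epsilon>) \<and>
               ereal_of_enat (mixing_time r L \<epsilon>) \<le> ereal (c' * real L)))
       \<and> (\<forall>\<epsilon>::real. 0 < \<epsilon> \<longrightarrow> \<epsilon> < 1/2 \<longrightarrow>
            (\<forall>\<eta> :: nat \<Rightarrow> nat \<Rightarrow> nat.
               (\<forall>L\<in>admissible_sizes r. \<eta> L \<in> configs r L) \<longrightarrow>
               (\<lambda>L. real (config_norm L (\<eta> L))) \<in> o[sizes_at_top r](\<lambda>L. real L) \<longrightarrow>
               (\<forall>\<delta>>0. \<forall>\<^sub>F L in sizes_at_top r.
                  ereal_of_enat (mixing_time_from r L (\<eta> L) \<epsilon>) \<le> ereal (\<delta> * real L))))"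
proof -
  obtain M \<theta> \<alpha> C L0 where M: "M \<ge> 1" and \<theta>: "0 < \<theta>" and \<alpha>: "0 < \<alpha>" "\<alpha> < 1" and C: "0 < C"
    and inv: "\<And>L N. L \<ge> L0 \<Longrightarrow> real N = r * real L \<Longrightarrow> rbb_invariant r L (rbb_stationary r L)"
    and conv: "\<And>L N \<eta> n. L \<ge> L0 \<Longrightarrow> real N = r * real L \<Longrightarrow> \<eta> \<in> configs r L \<Longrightarrow>
      tv_dist (rbb_law L \<eta> (M * n)) (rbb_stationary r L)
         \<le> C * (real L)\<^sup>2 * \<alpha> ^ n * exp (\<theta> * real (config_norm L \<eta>))"
    using exponential_convergence[OF assms] by (elim exE conjE) blast
  define \<tau> where "\<tau> = - ln \<alpha>"
  have \<tau>: "\<tau> > 0" unfolding \<tau>_def using \<alpha> by simp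
  have pow: "\<alpha> ^ n = exp (- (\<tau> * real n))" for n
    unfolding \<tau>_def using \<alpha> exp_of_nat_mult[of n "ln \<alpha>"] by (simp add: mult.commute)
  show ?thesis
  proof (rule conjI)
    \<comment> \<open>\<open>k * L\<close> contractions beat the initial weight \<open>exp (\<theta> * r * L)\<close> by the factor \<open>exp (- L)\<close>\<close>
    define k where "k = nat \<lceil>(\<theta> * r + 1) / \<tau>\<rceil> + 1"
    have k: "\<theta> * r + 1 \<le> \<tau> * real k"
    proof -
      have "(\<theta> * r + 1) / \<tau> \<le> real k" unfolding k_def by linarith
      then show ?thesis using \<tau> by (simp add: field_simps)
    qed
    define c where "c = 27 * C + real L0 + 1"
    have c: "c \<ge> 1" "27 * C < c" "real L0 \<le> c" unfolding c_def using C by auto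
    have "ereal (r * real L / 2) \<le> ereal_of_enat (mixing_time r L \<epsilon>) \<and>
          ereal_of_enat (mixing_time r L \<epsilon>) \<le> ereal (real (M * k) * real L)"
      if \<epsilon>: "0 < \<epsilon>" "\<epsilon> < 1/2" and L: "L \<in> admissible_sizes r" "real L \<ge> c / \<epsilon>" for \<epsilon> L
    proof -
      obtain N where N: "real N = r * real L" by (rule admissible_particles[OF assms L(1)])
      have "2 * c \<le> c / \<epsilon>" using \<epsilon> c by (simp add: field_simps)
      then have Lc: "2 * c \<le> real L" using L(2) by linarith
      have L2: "L \<ge> 2" "L \<ge> L0" using Lc c by linarith+
      have Lpos: "real L > 0" using L2 by simp
      have eps: "c / real L \<le> \<epsilon>" using L(2) \<epsilon> Lpos by (simp add: field_simps)
      have "mixing_time_from r L \<eta> \<epsilon> \<le> enat (M * (k * L))" if e: "\<eta> \<in> configs r L" for \<eta>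
      proof (rule mixing_time_from_le)
        have "config_norm L \<eta> \<le> N"
          using config_norm_le e L2 unfolding configs_eq_confs[OF N] by simp
        then have "real (config_norm L \<eta>) \<le> r * real L" unfolding N[symmetric] by simp
        then have h1: "\<theta> * real (config_norm L \<eta>) \<le> \<theta> * (r * real L)" using \<theta> by (intro mult_left_mono) auto
        have h2: "(\<theta> * r + 1) * real L \<le> \<tau> * real k * real L" using k by (intro mult_right_mono) auto
        have "\<alpha> ^ (k * L) * exp (\<theta> * real (config_norm L \<eta>))
            = exp (- (\<tau> * real k * real L) + \<theta> * real (config_norm L \<eta>))"
          unfolding pow exp_add by (simp add: mult.assoc)
        also have "\<dots> \<le> exp (- real L)" using h1 h2 by (simp add: algebra_simps)
        also have "\<dots> \<le> 27 / real L ^ 3" by (rule exp_minus_le_cube[OF Lpos])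
        finally have "C * (real L)\<^sup>2 * (\<alpha> ^ (k * L) * exp (\<theta> * real (config_norm L \<eta>)))
            \<le> C * (real L)\<^sup>2 * (27 / real L ^ 3)" using C by (intro mult_left_mono) auto
        also have "\<dots> = 27 * C / real L" using Lpos by (simp add: power2_eq_square power3_eq_cube)
        also have "\<dots> < c / real L" using c Lpos by (intro divide_strict_right_mono) auto
        also note eps
        finally show "tv_dist (rbb_law L \<eta> (M * (k * L))) (rbb_stationary r L) < \<epsilon>"
          using conv[OF L2(2) N e, of "k * L"] by (simp add: mult.assoc)
      qed
      then have "mixing_time r L \<epsilon> \<le> enat (M * (k * L))"
        unfolding mixing_time_def by (rule SUP_least)
      then have "ereal_of_enat (mixing_time r L \<epsilon>) \<le> ereal_of_enat (enat (M * (k * L)))"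
        by (simp only: ereal_of_enat_le_iff)
      also have "\<dots> = ereal (real (M * k) * real L)" by (simp add: mult.assoc)
      finally show ?thesis using mixing_time_ge[OF L2(1) N inv[OF L2(2) N] \<epsilon>(2)] by blast
    qed
    moreover have "0 < M * k" using M unfolding k_def by simp
    then have "real (M * k) > 0" by (simp only: of_nat_0_less_iff)
    moreover have "c > 0" using c by simp
    ultimately show "\<exists>c>0. \<exists>c'>0. \<forall>\<epsilon>::real. 0 < \<epsilon> \<longrightarrow> \<epsilon> < 1/2 \<longrightarrow>
            (\<forall>L\<in>admissible_sizes r. real L \<ge> c / \<epsilon> \<longrightarrow>
               ereal (r * real L / 2) \<le> ereal_of_enat (mixing_time r L \<epsilon>) \<and>
               ereal_of_enat (mixing_time r L \<epsilon>) \<le> ereal (c' * real L))"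
      by blast
  next
    show "\<forall>\<epsilon>::real. 0 < \<epsilon> \<longrightarrow> \<epsilon> < 1/2 \<longrightarrow>
            (\<forall>\<eta> :: nat \<Rightarrow> nat \<Rightarrow> nat.
               (\<forall>L\<in>admissible_sizes r. \<eta> L \<in> configs r L) \<longrightarrow>
               (\<lambda>L. real (config_norm L (\<eta> L))) \<in> o[sizes_at_top r](\<lambda>L. real L) \<longrightarrow>
               (\<forall>\<delta>>0. \<forall>\<^sub>F L in sizes_at_top r.
                  ereal_of_enat (mixing_time_from r L (\<eta> L) \<epsilon>) \<le> ereal (\<delta> * real L)))"
    proof (intro allI impI)
      fix \<epsilon> :: real and \<eta> :: "nat \<Rightarrow> nat \<Rightarrow> nat" and \<delta> :: real
      assume \<epsilon>: "0 < \<epsilon>" and mem: "\<forall>L\<in>admissible_sizes r. \<eta> L \<in> configs r L"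
        and o: "(\<lambda>L. real (config_norm L (\<eta> L))) \<in> o[sizes_at_top r](\<lambda>L. real L)" and \<delta>: "\<delta> > 0"
      \<comment> \<open>the exponential rate in \<open>L\<close> at which \<open>\<delta> * L\<close> steps contract; half of it beats the weight of \<open>\<eta> L\<close>\<close>
      define \<sigma> where "\<sigma> = \<tau> * \<delta> / real M"
      have \<sigma>: "\<sigma> > 0" unfolding \<sigma>_def using \<tau> \<delta> M by simp
      define K where "K = C * exp \<tau> * (27 / (\<sigma> / 2) ^ 3)"
      have "\<forall>\<^sub>F L in sizes_at_top r. norm (real (config_norm L (\<eta> L))) \<le> \<sigma> / (2 * \<theta>) * norm (real L)"
        using \<sigma> \<theta> by (intro landau_o.smallD[OF o]) auto
      moreover have "\<forall>\<^sub>F L in sizes_at_top r. L \<in> admissible_sizes r"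
        unfolding sizes_at_top_def eventually_inf_principal by simp
      moreover have "\<forall>\<^sub>F L in sizes_at_top r. L \<ge> max 1 (max L0 (nat \<lceil>K / \<epsilon>\<rceil> + 1))"
        unfolding sizes_at_top_def eventually_inf_principal
        by (rule eventually_mono[OF eventually_ge_at_top[of "max 1 (max L0 (nat \<lceil>K / \<epsilon>\<rceil> + 1))"]]) simp
      ultimately show "\<forall>\<^sub>F L in sizes_at_top r.
          ereal_of_enat (mixing_time_from r L (\<eta> L) \<epsilon>) \<le> ereal (\<delta> * real L)"
      proof eventually_elim
        case (elim L)
        obtain N where N: "real N = r * real L" by (rule admissible_particles[OF assms elim(2)])
        have Ls: "L \<ge> 1" "L \<ge> L0" "K / \<epsilon> < real L" using elim(3) by linarith+
        have Lpos: "real L > 0" using Ls by simp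
        have e: "\<eta> L \<in> configs r L" using mem elim(2) by blast
        define n where "n = nat \<lfloor>\<delta> * real L / real M\<rfloor>"
        have n0: "0 \<le> \<delta> * real L / real M" using \<delta> by simp
        have n: "real n \<le> \<delta> * real L / real M" "\<delta> * real L / real M - 1 \<le> real n"
          unfolding n_def using n0 by linarith+
        have "mixing_time_from r L (\<eta> L) \<epsilon> \<le> enat (M * n)"
        proof (rule mixing_time_from_le)
          have h1: "\<theta> * real (config_norm L (\<eta> L)) \<le> \<sigma> / 2 * real L"
            using mult_left_mono[OF elim(1), of \<theta>] \<theta> by simp
          have h2: "\<sigma> * real L - \<tau> \<le> \<tau> * real n"
            using mult_left_mono[OF n(2), of \<tau>] \<tau> unfolding \<sigma>_def by (simp add: algebra_simps)
          have "\<alpha> ^ n * exp (\<theta> * real (config_norm L (\<eta> L)))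
              = exp (- (\<tau> * real n) + \<theta> * real (config_norm L (\<eta> L)))"
            unfolding pow exp_add ..
          also have "\<dots> \<le> exp (\<tau> + - (\<sigma> / 2 * real L))" using h1 h2 by simp
          also have "\<dots> = exp \<tau> * exp (- (\<sigma> / 2 * real L))" by (rule exp_add)
          also have "\<dots> \<le> exp \<tau> * (27 / (\<sigma> / 2 * real L) ^ 3)"
            using \<sigma> Lpos by (intro mult_left_mono exp_minus_le_cube) auto
          finally have "C * (real L)\<^sup>2 * (\<alpha> ^ n * exp (\<theta> * real (config_norm L (\<eta> L))))
              \<le> C * (real L)\<^sup>2 * (exp \<tau> * (27 / (\<sigma> / 2 * real L) ^ 3))"
            using C by (intro mult_left_mono) auto
          also have "\<dots> = K / real L"
            unfolding K_def using Lpos \<sigma> by (simp add: power_mult_distrib power2_eq_square power3_eq_cube)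
          also have "\<dots> < \<epsilon>" using Ls(3) Lpos \<epsilon> by (simp add: field_simps)
          finally show "tv_dist (rbb_law L (\<eta> L) (M * n)) (rbb_stationary r L) < \<epsilon>"
            using conv[OF Ls(2) N e, of n] by (simp add: mult.assoc)
        qed
        then have "ereal_of_enat (mixing_time_from r L (\<eta> L) \<epsilon>) \<le> ereal_of_enat (enat (M * n))"
          by (simp only: ereal_of_enat_le_iff)
        also have "\<dots> \<le> ereal (\<delta> * real L)"
          using n(1) M by (simp add: field_simps)
        finally show ?case .
      qed
    qed
  qed
qed

end
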